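(* Let $n\geq 2$, $t\in[0,1]$ and \[ \mu_{0}= \frac{(3-2n)t+1-2n+\sqrt{(1-t)[(4n-5)t+4n^2-4n+1]} }{2(n-1)^2}. \] Let $\mu\in\mathbb{R}\setminus[\mu_0,-t/n]$ with $n+1+2t+(n-1)\mu\neq 0$. Then there is no $\underline{\xi}\in\mathbb{R}^n$ (with $1,\xi_1,\ldots,\xi_n$ linearly independent over $\mathbb{Q}$) such that \[ \overline{\varphi}_{n+1}=t, \qquad \underline{\varphi}_{n+1}=(1-n)\frac{t+n\mu }{n+1+2t+(n-1)\mu}, \qquad \underline{\varphi}_{1}=\mu. \] Equivalently, no $\underline{\xi}$ has $\overline{\varphi}_{n+1}=t$, $\underline{\varphi}_{1}=\mu$ and equality in $n\underline{\varphi}_{1} +\overline{\varphi}_{n+1} \leq -\underline{\varphi}_{n+1}\left(\frac{n+1}{n-1}+\underline{\varphi}_{1}+\frac{2}{n-1}\overline{\varphi}_{n+1} \right)$.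
   Context: For $\underline{\xi}=(\xi_1,\ldots,\xi_n)\in\mathbb{R}^n$ with $\{1,\xi_1,\ldots,\xi_n\}$ linearly independent over $\mathbb{Q}$ and $q>0$, let $K(q)\subseteq\mathbb{R}^{n+1}$ be the box $|z_0|\leq e^{nq}$, $\max_{1\le i\le n}|z_i|\leq e^{-q}$, and $\Lambda_{\underline{\xi}}=\{(x,\xi_1x-y_1,\ldots,\xi_nx-y_n): x,y_i\in\mathbb{Z}\}$. Let $\lambda_1(q)\le\cdots\le\lambda_{n+1}(q)$ be the successive minima of $K(q)$ w.r.t. $\Lambda_{\underline{\xi}}$, $\varphi_j(q)=\log\lambda_j(q)/q$, $\underline{\varphi}_j=\liminf_{q\to\infty}\varphi_j(q)$, $\overline{\varphi}_j=\limsup_{q\to\infty}\varphi_j(q)$. *)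

theory Defs
  imports "HOL-Analysis.Analysis"
begin

text \<open>Points of R^(n+1) are represented as functions nat => real; only the
coordinates 0..n are meaningful (index 0 is z_0, indices 1..n are z_1..z_n).
The vector xi = (xi_1,...,xi_n) is a function nat => real using indices 1..n.\<close>

definition Q_lin_indep :: "nat \<Rightarrow> (nat \<Rightarrow> real) \<Rightarrow> bool" where
  "Q_lin_indep n \<xi> \<longleftrightarrow>
     (\<forall>(a0::rat) (a::nat \<Rightarrow> rat).
        of_rat a0 + (\<Sum>i=1..n. of_rat (a i) * \<xi> i) = 0 \<longrightarrow>
        a0 = 0 \<and> (\<forall>i\<in>{1..n}. a i = 0))"

definition lattice_pt :: "nat \<Rightarrow> (nat \<Rightarrow> real) \<Rightarrow> int \<Rightarrow> (nat \<Rightarrow> int) \<Rightarrow> (nat \<Rightarrow> real)" where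
  "lattice_pt n \<xi> x y = (\<lambda>i. if i = 0 then real_of_int x
                               else if i \<le> n then \<xi> i * real_of_int x - real_of_int (y i)
                               else 0)"

definition lattice :: "nat \<Rightarrow> (nat \<Rightarrow> real) \<Rightarrow> (nat \<Rightarrow> real) set" where
  "lattice n \<xi> = {v. \<exists>x y. v = lattice_pt n \<xi> x y}"

definition in_scaled_box :: "nat \<Rightarrow> real \<Rightarrow> real \<Rightarrow> (nat \<Rightarrow> real) \<Rightarrow> bool" where
  "in_scaled_box n q lam v \<longleftrightarrow>
     \<bar>v 0\<bar> \<le> lam * exp (real n * q) \<and> (\<forall>i\<in>{1..n}. \<bar>v i\<bar> \<le> lam * exp (- q))"

definition lin_indep_fam :: "nat \<Rightarrow> nat \<Rightarrow> (nat \<Rightarrow> nat \<Rightarrow> real) \<Rightarrow> bool" where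
  "lin_indep_fam n j vs \<longleftrightarrow>
     (\<forall>c::nat \<Rightarrow> real. (\<forall>i\<le>n. (\<Sum>k<j. c k * vs k i) = 0) \<longrightarrow> (\<forall>k<j. c k = 0))"

definition succ_min :: "nat \<Rightarrow> (nat \<Rightarrow> real) \<Rightarrow> real \<Rightarrow> nat \<Rightarrow> real" where
  "succ_min n \<xi> q j = Inf {lam. lam > 0 \<and>
      (\<exists>vs. (\<forall>k<j. vs k \<in> lattice n \<xi> \<and> in_scaled_box n q lam (vs k)) \<and> lin_indep_fam n j vs)}"

definition phi :: "nat \<Rightarrow> (nat \<Rightarrow> real) \<Rightarrow> nat \<Rightarrow> real \<Rightarrow> real" where
  "phi n \<xi> j q = ln (succ_min n \<xi> q j) / q"

definition phi_lower :: "nat \<Rightarrow> (nat \<Rightarrow> real) \<Rightarrow> nat \<Rightarrow> ereal" where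
  "phi_lower n \<xi> j = Liminf at_top (\<lambda>q. ereal (phi n \<xi> j q))"

definition phi_upper :: "nat \<Rightarrow> (nat \<Rightarrow> real) \<Rightarrow> nat \<Rightarrow> ereal" where
  "phi_upper n \<xi> j = Limsup at_top (\<lambda>q. ereal (phi n \<xi> j q))"

end

theory Submission
  imports Defs "HOL-Library.Function_Algebras"
begin

text \<open>
  The last minimum of the approximation lattice is, up to constants, the inverse of the first
  minimum of the dual lattice, so \<open>\<phi>\<^sub>n\<^sub>+\<^sub>1\<close> is governed by the minimal points of the linear form
  \<open>v \<mapsto> v\<^sub>0 + v\<^sub>1 \<xi>\<^sub>1 + \<dots> + v\<^sub>n \<xi>\<^sub>n\<close>. Comparing heights and values of the form at consecutive minimal
  points turns \<open>t\<close> and \<open>\<nu> = liminf \<phi>\<^sub>n\<^sub>+\<^sub>1\<close> into linear inequalities between logarithms.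

  Let \<open>v\<^sub>0\<close> realise \<open>t\<close> at its peak time \<open>a\<close> and let \<open>v\<^sub>1\<close> be the next minimal point. The value
  prescribed for \<open>\<nu>\<close> is the extremal one: it forces the first \<open>n - 1\<close> minima at time \<open>a\<close> to be about
  \<open>e\<^bsup>\<mu>a\<^esup>\<close>, so that the first later minimal point outside the plane of \<open>v\<^sub>0, v\<^sub>1\<close> has a large height, and
  the minimal points staying in that plane do not outgrow \<open>v\<^sub>1\<close> on the logarithmic scale. The bound
  \<open>t\<close> on the next peak and the bound \<open>\<nu>\<close> on the valley after it then give
  \<open>(1 - t) (1 - \<mu>) \<le> (1 + t + (n - 1) \<mu>)\<^sup>2\<close>, whose larger root is \<open>\<mu>\<^sub>0\<close>; \<open>\<nu> \<le> t\<close> selects the branch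
  \<open>\<mu> \<ge> \<mu>\<^sub>0\<close>. The other bound, \<open>\<mu> \<le> - t / n\<close>, is Khintchine's transference inequality.
\<close>

section \<open>Reduced bases for seminorms\<close>

text \<open>Put X = 1 + t + (n - 1) \<mu>. Minkowski's inequality for v_0 and v_1 bounds the
  logarithm of the height of v_1 from below by about X a; the prescribed \<nu> is the value for
  which the valley between them gives X a as upper bound too. A later point off the plane then has
  logarithmic height at least about ((n - 2) \<mu> + 2 + t - X) a = (1 - \<mu>) a, while the bounds
  t and \<nu>, applied after a point of height at most exp (X a), allow at most X^2 a / (1 - t).
  This is the quadratic inequality. The obstacle is that v_1 need not be followed at once by a point
  off the plane. Cutting the sequence at height exp (X a) avoids following it, but the inequality
  that forbids the plane to contain the two points around the cut degenerates to an equality exactly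
  at this X; the cut is therefore raised slightly and moved back at the end. Only logarithms divided
  by q matter, so Minkowski's second theorem and transference are needed merely up to factors
  independent of q. Bases reduced with a constant depending on the rank alone provide both.\<close>

instantiation "fun" :: (type, real_vector) real_vector
begin

definition scaleR_fun :: "real \<Rightarrow> ('a \<Rightarrow> 'b) \<Rightarrow> 'a \<Rightarrow> 'b" where
  "scaleR_fun r f = (\<lambda>x. r *\<^sub>R f x)"

instance
  by standard (simp_all add: scaleR_fun_def fun_eq_iff scaleR_right_distrib scaleR_left_distrib)

end

lemma scaleR_fun_apply [simp]: "(r *\<^sub>R f) x = r *\<^sub>R f x"
  by (simp add: scaleR_fun_def)

lemma sum_fun_apply [simp]: "(\<Sum>i\<in>I. F i) x = (\<Sum>i\<in>I. F i x)"
  by (induction I rule: infinite_finite_induct) auto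

text \<open>Gaussian elimination: one coordinate is removed by subtracting multiples of a pivot
  member. It is applied to vectors and also to matrices of integer coordinates and of pairings,
  hence the bare family \<open>u\<close>.\<close>

lemma exists_linear_relation:
  fixes u :: "'i \<Rightarrow> 'l \<Rightarrow> real"
  assumes "finite A" "finite I" "card A < card I"
  shows "\<exists>c. (\<exists>i\<in>I. c i \<noteq> 0) \<and> (\<forall>l\<in>A. (\<Sum>i\<in>I. c i * u i l) = 0)"
  using assms
proof (induction A arbitrary: I u rule: finite_induct)
  case empty
  then have "I \<noteq> {}" by auto
  then show ?case by (intro exI[of _ "\<lambda>_. 1"]) auto
next
  case (insert l A)
  show ?case
  proof (cases "\<forall>i\<in>I. u i l = 0")
    case True
    have "card A < card I" using insert by simp
    then obtain c where "\<exists>i\<in>I. c i \<noteq> 0" "\<forall>l\<in>A. (\<Sum>i\<in>I. c i * u i l) = 0"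
      using insert.IH[OF insert.prems(1), of u] by auto
    with True show ?thesis by (intro exI[of _ c]) auto
  next
    case False
    then obtain j where j: "j \<in> I" "u j l \<noteq> 0" by auto
    define J where "J = I - {j}"
    define u' where "u' i m = u i m - u i l / u j l * u j m" for i m
    have J: "finite J" "I = insert j J" "j \<notin> J" using insert j by (auto simp: J_def)
    have "card A < card J" using insert J by auto
    then obtain c where c: "\<exists>i\<in>J. c i \<noteq> 0" "\<forall>m\<in>A. (\<Sum>i\<in>J. c i * u' i m) = 0"
      using insert.IH[OF J(1), of u'] by auto
    define s where "s = (\<Sum>i\<in>J. c i * u i l / u j l)"
    define c' where "c' = c(j := - s)"
    have sum: "(\<Sum>i\<in>I. c' i * u i m) = (\<Sum>i\<in>J. c i * u' i m)" for m
    proof -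
      have "(\<Sum>i\<in>J. c' i * u i m) = (\<Sum>i\<in>J. c i * u i m)"
        using J(3) by (intro sum.cong) (auto simp: c'_def)
      then have "(\<Sum>i\<in>I. c' i * u i m) = - s * u j m + (\<Sum>i\<in>J. c i * u i m)"
        using J by (simp add: c'_def)
      also have "\<dots> = (\<Sum>i\<in>J. c i * u i m - c i * u i l / u j l * u j m)"
        by (simp add: s_def sum_subtractf sum_distrib_right)
      also have "\<dots> = (\<Sum>i\<in>J. c i * u' i m)"
        by (intro sum.cong) (auto simp: u'_def algebra_simps)
      finally show ?thesis .
    qed
    have "(\<Sum>i\<in>I. c' i * u i l) = 0"
      unfolding sum using j by (intro sum.neutral) (auto simp: u'_def)
    moreover have "\<exists>i\<in>I. c' i \<noteq> 0" using c(1) J by (auto simp: c'_def)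
    ultimately show ?thesis using c(2) sum by (intro exI[of _ c']) auto
  qed
qed

section \<open>Seminorms and their quotients by a line\<close>

definition seminorm :: "('v::real_vector \<Rightarrow> real) \<Rightarrow> bool" where
  "seminorm N \<longleftrightarrow> (\<forall>x y. N (x + y) \<le> N x + N y) \<and> (\<forall>r x. N (r *\<^sub>R x) = \<bar>r\<bar> * N x)"

lemma seminorm_add: "seminorm N \<Longrightarrow> N (x + y) \<le> N x + N y"
  and seminorm_scale: "seminorm N \<Longrightarrow> N (r *\<^sub>R x) = \<bar>r\<bar> * N x"
  by (auto simp: seminorm_def)

lemma seminorm_zero: "seminorm N \<Longrightarrow> N 0 = 0"
  using seminorm_scale[of N 0 0] by simp

lemma seminorm_minus: "seminorm N \<Longrightarrow> N (- x) = N x"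
  using seminorm_scale[of N "-1" x] by simp

lemma seminorm_diff: "seminorm N \<Longrightarrow> N (x - y) \<le> N x + N y"
  using seminorm_add[of N x "- y"] by (simp add: seminorm_minus)

lemma seminorm_commute: "seminorm N \<Longrightarrow> N (x - y) = N (y - x)"
  using seminorm_minus[of N "x - y"] by simp

lemma seminorm_nonneg: "seminorm N \<Longrightarrow> N x \<ge> 0"
  using seminorm_diff[of N x x] by (simp add: seminorm_zero)

lemma seminorm_sum_le:
  "seminorm N \<Longrightarrow> N (\<Sum>i\<in>I. k i *\<^sub>R b i) \<le> (\<Sum>i\<in>I. \<bar>k i\<bar> * N (b i))"
proof (induction I rule: infinite_finite_induct)
  case (insert i I)
  then show ?case
    using seminorm_add[of N "k i *\<^sub>R b i" "\<Sum>i\<in>I. k i *\<^sub>R b i"] by (simp add: seminorm_scale)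
qed (auto simp: seminorm_zero)

lemma seminorm_cong: "seminorm N \<Longrightarrow> N (x - y) = 0 \<Longrightarrow> N x = N y"
  using seminorm_add[of N "x - y" y] seminorm_add[of N "y - x" x] seminorm_commute[of N x y]
  by simp

definition quot_seminorm :: "('v::real_vector \<Rightarrow> real) \<Rightarrow> 'v \<Rightarrow> 'v \<Rightarrow> real" where
  "quot_seminorm N b z = (INF s. N (z - s *\<^sub>R b))"

lemma quot_seminorm_le: "seminorm N \<Longrightarrow> quot_seminorm N b z \<le> N (z - s *\<^sub>R b)"
  unfolding quot_seminorm_def
  by (rule cINF_lower) (auto intro!: bdd_belowI[of _ 0] dest: seminorm_nonneg)

lemma quot_seminorm_less:
  assumes "quot_seminorm N b z < e"
  obtains s where "N (z - s *\<^sub>R b) < e"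
  using assms cInf_lessD[of "range (\<lambda>s. N (z - s *\<^sub>R b))" e]
  unfolding quot_seminorm_def by auto

lemma quot_seminorm_greatest: "(\<And>s. c \<le> N (z - s *\<^sub>R b)) \<Longrightarrow> c \<le> quot_seminorm N b z"
  unfolding quot_seminorm_def by (rule cINF_greatest) auto

lemma seminorm_quot_seminorm:
  assumes N: "seminorm N"
  shows "seminorm (quot_seminorm N b)"
proof -
  let ?Q = "quot_seminorm N b"
  have add: "?Q (x + y) \<le> ?Q x + ?Q y" for x y
  proof (rule field_le_epsilon)
    fix e :: real assume "e > 0"
    then have e: "?Q x < ?Q x + e / 2" "?Q y < ?Q y + e / 2" by auto
    obtain s where s: "N (x - s *\<^sub>R b) < ?Q x + e / 2" using e(1) by (rule quot_seminorm_less)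
    obtain r where r: "N (y - r *\<^sub>R b) < ?Q y + e / 2" using e(2) by (rule quot_seminorm_less)
    have "?Q (x + y) \<le> N (x + y - (s + r) *\<^sub>R b)" by (rule quot_seminorm_le[OF N])
    also have "\<dots> = N ((x - s *\<^sub>R b) + (y - r *\<^sub>R b))" by (simp add: algebra_simps)
    also have "\<dots> \<le> N (x - s *\<^sub>R b) + N (y - r *\<^sub>R b)" by (rule seminorm_add[OF N])
    finally show "?Q (x + y) \<le> ?Q x + ?Q y + e" using s r by simp
  qed
  have le: "?Q (r *\<^sub>R x) \<le> \<bar>r\<bar> * ?Q x" for r x
  proof (rule field_le_epsilon)
    fix e :: real assume e: "e > 0"
    define e' where "e' = e / (\<bar>r\<bar> + 1)"
    have "?Q x < ?Q x + e'" using e by (simp add: e'_def)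
    then obtain s where s: "N (x - s *\<^sub>R b) < ?Q x + e'" by (rule quot_seminorm_less)
    have "?Q (r *\<^sub>R x) \<le> N (r *\<^sub>R x - (r * s) *\<^sub>R b)" by (rule quot_seminorm_le[OF N])
    also have "\<dots> = \<bar>r\<bar> * N (x - s *\<^sub>R b)"
      by (simp add: seminorm_scale[OF N, symmetric] algebra_simps)
    also have "\<dots> \<le> \<bar>r\<bar> * (?Q x + e')" using s by (intro mult_left_mono) auto
    also have "\<bar>r\<bar> * e' \<le> e"
      using e by (simp add: e'_def field_simps)
    hence "\<bar>r\<bar> * (?Q x + e') \<le> \<bar>r\<bar> * ?Q x + e" by (simp add: algebra_simps)
    finally show "?Q (r *\<^sub>R x) \<le> \<bar>r\<bar> * ?Q x + e" .
  qed
  have "?Q (r *\<^sub>R x) = \<bar>r\<bar> * ?Q x" for r x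
  proof (cases "r = 0")
    case True
    have "?Q 0 \<le> 0" using quot_seminorm_le[OF N, of b 0 0] by (simp add: seminorm_zero[OF N])
    moreover have "0 \<le> ?Q 0" by (rule quot_seminorm_greatest) (rule seminorm_nonneg[OF N])
    ultimately show ?thesis using True by simp
  next
    case False
    have "\<bar>r\<bar> * ?Q x = \<bar>r\<bar> * ?Q ((1 / r) *\<^sub>R (r *\<^sub>R x))" using False by simp
    also have "\<dots> \<le> \<bar>r\<bar> * (\<bar>1 / r\<bar> * ?Q (r *\<^sub>R x))" by (intro mult_left_mono le) auto
    also have "\<dots> = ?Q (r *\<^sub>R x)" using False by (simp add: field_simps)
    finally show ?thesis using le[of r x] by simp
  qed
  with add show ?thesis by (auto simp: seminorm_def)
qed

text \<open>Turns a real approximate minimiser into an integral one, so that the translate stays in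
  the subgroup, at the price of half the norm of \<open>b\<close>.\<close>

lemma round_scale_bound:
  assumes "seminorm N"
  shows "N (z - real_of_int (round s) *\<^sub>R b) \<le> N (z - s *\<^sub>R b) + N b / 2"
proof -
  have "N (z - real_of_int (round s) *\<^sub>R b) = N ((z - s *\<^sub>R b) + (s - round s) *\<^sub>R b)"
    by (simp add: algebra_simps)
  also have "\<dots> \<le> N (z - s *\<^sub>R b) + \<bar>s - round s\<bar> * N b"
    using seminorm_add[OF assms] seminorm_scale[OF assms] by metis
  also have "\<bar>s - round s\<bar> * N b \<le> 1 / 2 * N b"
    using of_int_round_abs_le[of s] seminorm_nonneg[OF assms, of b]
    by (intro mult_right_mono) (auto simp: abs_minus_commute)
  finally show ?thesis by simp
qed

section \<open>Discrete subgroups of bounded rank and their reduced bases\<close>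

definition additive_subgroup :: "'v::real_vector set \<Rightarrow> bool" where
  "additive_subgroup L \<longleftrightarrow> 0 \<in> L \<and> (\<forall>x\<in>L. \<forall>y\<in>L. x - y \<in> L)"

lemma additive_subgroup_diff: "additive_subgroup L \<Longrightarrow> x \<in> L \<Longrightarrow> y \<in> L \<Longrightarrow> x - y \<in> L"
  by (simp add: additive_subgroup_def)

lemma additive_subgroup_zero: "additive_subgroup L \<Longrightarrow> 0 \<in> L"
  by (simp add: additive_subgroup_def)

lemma additive_subgroup_minus: "additive_subgroup L \<Longrightarrow> x \<in> L \<Longrightarrow> - x \<in> L"
  using additive_subgroup_diff[of L 0 x] additive_subgroup_zero by auto

lemma additive_subgroup_add: "additive_subgroup L \<Longrightarrow> x \<in> L \<Longrightarrow> y \<in> L \<Longrightarrow> x + y \<in> L"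
  using additive_subgroup_diff[of L x "- y"] additive_subgroup_minus by auto

lemma additive_subgroup_scale_int:
  assumes L: "additive_subgroup L" and x: "x \<in> L"
  shows "real_of_int k *\<^sub>R x \<in> L"
proof (induction k rule: int_induct[where k = 0])
  case base
  then show ?case using additive_subgroup_zero[OF L] by simp
next
  case (step1 i)
  then show ?case using additive_subgroup_add[OF L _ x] by (simp add: scaleR_left_distrib)
next
  case (step2 i)
  then show ?case using additive_subgroup_diff[OF L _ x] by (simp add: scaleR_left_diff_distrib)
qed

lemma additive_subgroup_sum:
  assumes "additive_subgroup L" "\<And>i. i \<in> I \<Longrightarrow> b i \<in> L"
  shows "(\<Sum>i\<in>I. real_of_int (k i) *\<^sub>R b i) \<in> L"
  using assms(2)
  by (induction I rule: infinite_finite_induct)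
     (auto intro: additive_subgroup_zero additive_subgroup_add additive_subgroup_scale_int assms(1))

definition discrete_mod :: "('v::real_vector \<Rightarrow> real) \<Rightarrow> 'v set \<Rightarrow> bool" where
  "discrete_mod N L \<longleftrightarrow> (\<forall>R. \<exists>F. finite F \<and> F \<subseteq> L \<and> (\<forall>z\<in>L. N z \<le> R \<longrightarrow> (\<exists>f\<in>F. N (z - f) = 0)))"

text \<open>The families are indexed by 0, ..., d and so have d + 1 members; the rank modulo the
  kernel is at most d.\<close>

definition rank_mod_le :: "nat \<Rightarrow> ('v::real_vector \<Rightarrow> real) \<Rightarrow> 'v set \<Rightarrow> bool" where
  "rank_mod_le d N L \<longleftrightarrow>
     (\<forall>v. (\<forall>i\<le>d. v i \<in> L) \<longrightarrow> (\<exists>c. (\<exists>i\<le>d. c i \<noteq> 0) \<and> N (\<Sum>i\<le>d. c i *\<^sub>R v i) = 0))"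

text \<open>By discreteness only finitely many values of \<open>N\<close> up to \<open>N z\<close>
  occur on \<open>L\<close>, so there is a least positive one.\<close>

lemma shortest_vector_exists:
  assumes N: "seminorm N" and disc: "discrete_mod N L" and z: "z \<in> L" "N z > 0"
  obtains b where "b \<in> L" "N b > 0" "\<And>x. x \<in> L \<Longrightarrow> N x < N b \<Longrightarrow> N x = 0"
proof -
  obtain F where F: "finite F" "F \<subseteq> L" "\<And>x. x \<in> L \<Longrightarrow> N x \<le> N z \<Longrightarrow> \<exists>f\<in>F. N (x - f) = 0"
    using disc unfolding discrete_mod_def by meson
  define P where "P = {f \<in> F. N f > 0}"
  have ex: "\<exists>f\<in>P. N f = N x" if x: "x \<in> L" "N x \<le> N z" "N x > 0" for x
  proof -
    obtain f where "f \<in> F" "N (x - f) = 0" using F(3)[OF x(1,2)] by blast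
    then show ?thesis using seminorm_cong[OF N, of x f] x(3) by (auto simp: P_def)
  qed
  have P: "finite P" "P \<noteq> {}" using F(1) ex[OF z(1) _ z(2)] by (auto simp: P_def)
  define b where "b = arg_min_on N P"
  have b: "b \<in> P" "\<And>f. f \<in> P \<Longrightarrow> N b \<le> N f"
    using arg_min_if_finite(1)[OF P, of N] arg_min_least[OF P, of _ N] by (auto simp: b_def)
  obtain f0 where "f0 \<in> P" "N f0 = N z" using ex[OF z(1) _ z(2)] by auto
  then have bz: "N b \<le> N z" using b(2) by force
  show thesis
  proof (rule that)
    show "b \<in> L" "N b > 0" using b(1) F(2) by (auto simp: P_def)
    fix x assume x: "x \<in> L" "N x < N b"
    show "N x = 0"
    proof (rule ccontr)
      assume "N x \<noteq> 0"
      then have "N x > 0" using seminorm_nonneg[OF N, of x] by simp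
      then obtain f where "f \<in> P" "N f = N x" using ex x bz by force
      then show False using b(2) x by force
    qed
  qed
qed

text \<open>A class of small quotient norm has a representative of small norm in \<open>L\<close>,
  obtained by subtracting a rounded multiple of \<open>b\<close>; the finite set that
  \<open>N\<close> needs at the larger radius serves the quotient.\<close>

lemma discrete_mod_quot:
  assumes N: "seminorm N" and L: "additive_subgroup L" and disc: "discrete_mod N L" and b: "b \<in> L"
  shows "discrete_mod (quot_seminorm N b) L"
  unfolding discrete_mod_def
proof
  fix R
  obtain F where F: "finite F" "F \<subseteq> L"
    "\<And>x. x \<in> L \<Longrightarrow> N x \<le> R + 1 + N b / 2 \<Longrightarrow> \<exists>f\<in>F. N (x - f) = 0"
    using disc unfolding discrete_mod_def by meson
  have "\<exists>f\<in>F. quot_seminorm N b (z - f) = 0" if z: "z \<in> L" "quot_seminorm N b z \<le> R" for z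
  proof -
    have "quot_seminorm N b z < R + 1" using z by simp
    then obtain s where s: "N (z - s *\<^sub>R b) < R + 1" by (rule quot_seminorm_less)
    define x where "x = z - real_of_int (round s) *\<^sub>R b"
    have "x \<in> L" unfolding x_def
      by (intro additive_subgroup_diff[OF L] z additive_subgroup_scale_int[OF L] b)
    moreover have "N x \<le> R + 1 + N b / 2"
      using round_scale_bound[OF N, of z s b] s by (simp add: x_def)
    ultimately obtain f where f: "f \<in> F" "N (x - f) = 0" using F(3) by blast
    have "quot_seminorm N b (z - f) \<le> N (z - f - real_of_int (round s) *\<^sub>R b)"
      by (rule quot_seminorm_le[OF N])
    also have "\<dots> = 0" using f by (simp add: x_def algebra_simps)
    finally show ?thesis
      using f(1) seminorm_nonneg[OF seminorm_quot_seminorm[OF N], of b "z - f"] by (intro bexI[of _ f]) auto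
  qed
  then show "\<exists>F. finite F \<and> F \<subseteq> L \<and>
      (\<forall>z\<in>L. quot_seminorm N b z \<le> R \<longrightarrow> (\<exists>f\<in>F. quot_seminorm N b (z - f) = 0))"
    using F(1,2) by blast
qed

text \<open>Append \<open>b\<close> to the family and use the rank for \<open>N\<close>. A relation
  involving \<open>b\<close> alone is impossible because \<open>N b > 0\<close>.\<close>

lemma rank_mod_le_quot:
  assumes N: "seminorm N" and rank: "rank_mod_le (Suc d) N L" and b: "b \<in> L" "N b > 0"
  shows "rank_mod_le d (quot_seminorm N b) L"
  unfolding rank_mod_le_def
proof (intro allI impI)
  fix v :: "nat \<Rightarrow> 'a" assume v: "\<forall>i\<le>d. v i \<in> L"
  define w where "w = v(Suc d := b)"
  have "\<forall>i\<le>Suc d. w i \<in> L" using v b by (auto simp: w_def le_Suc_eq)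
  then obtain c where c: "\<exists>i\<le>Suc d. c i \<noteq> 0" "N (\<Sum>i\<le>Suc d. c i *\<^sub>R w i) = 0"
    using rank unfolding rank_mod_le_def by (auto dest!: spec[of _ w])
  have "(\<Sum>i\<le>d. c i *\<^sub>R w i) = (\<Sum>i\<le>d. c i *\<^sub>R v i)"
    by (intro sum.cong) (auto simp: w_def)
  then have eq: "N ((\<Sum>i\<le>d. c i *\<^sub>R v i) + c (Suc d) *\<^sub>R b) = 0"
    using c(2) by (simp add: w_def)
  have "\<exists>i\<le>d. c i \<noteq> 0"
  proof (rule ccontr)
    assume "\<not> ?thesis"
    then have z: "\<forall>i\<le>d. c i = 0" by blast
    then have "(\<Sum>i\<le>d. c i *\<^sub>R v i) = 0" by simp
    then have "c (Suc d) = 0" using eq b by (simp add: seminorm_scale[OF N])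
    then show False using c(1) z by (auto simp: le_Suc_eq)
  qed
  moreover have "quot_seminorm N b (\<Sum>i\<le>d. c i *\<^sub>R v i) \<le> 0"
    using quot_seminorm_le[OF N, of b "\<Sum>i\<le>d. c i *\<^sub>R v i" "- c (Suc d)"] eq by simp
  ultimately show "\<exists>c. (\<exists>i\<le>d. c i \<noteq> 0) \<and> quot_seminorm N b (\<Sum>i\<le>d. c i *\<^sub>R v i) = 0"
    using seminorm_nonneg[OF seminorm_quot_seminorm[OF N]] by (meson order_antisym)
qed

text \<open>A basis of \<open>L\<close> modulo the kernel of \<open>N\<close>, orthogonal up to the
  factor \<open>C\<close>: no summand is much longer than the whole sum, and this for real
  coefficients, not only integral ones.\<close>

definition reduced_basis :: "real \<Rightarrow> nat \<Rightarrow> ('v::real_vector \<Rightarrow> real) \<Rightarrow> 'v set \<Rightarrow> (nat \<Rightarrow> 'v) \<Rightarrow> bool" where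
  "reduced_basis C m N L b \<longleftrightarrow>
     (\<forall>i<m. b i \<in> L \<and> N (b i) > 0) \<and>
     (\<forall>z\<in>L. \<exists>k::nat \<Rightarrow> int. N (z - (\<Sum>i<m. real_of_int (k i) *\<^sub>R b i)) = 0) \<and>
     (\<forall>k::nat \<Rightarrow> real. \<forall>i<m. \<bar>k i\<bar> * N (b i) \<le> C * N (\<Sum>i<m. k i *\<^sub>R b i))"

text \<open>Vectors reduced in the quotient are lifted to nearly shortest representatives and
  \<open>b\<close> is added in position \<open>m\<close>. The quotient controls the coefficients of
  the lifts; the coefficient of \<open>b\<close> follows by the triangle inequality, which sums up
  to \<open>d\<close> of those bounds.\<close>

lemma reduced_basis_step:
  assumes N: "seminorm N" and L: "additive_subgroup L" and b: "b \<in> L" "N b > 0"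
    and short: "\<And>x. x \<in> L \<Longrightarrow> N x < N b \<Longrightarrow> N x = 0"
    and rb: "reduced_basis C m (quot_seminorm N b) L b'" and C: "C \<ge> 1" and md: "m \<le> d"
  shows "\<exists>b''. reduced_basis (1 + 4 * C * (real d + 1)) (Suc m) N L b''"
proof -
  let ?Q = "quot_seminorm N b"
  note Q = seminorm_quot_seminorm[OF N, of b]
  have b': "b' i \<in> L" "?Q (b' i) > 0" if "i < m" for i using rb that by (auto simp: reduced_basis_def)
  have "\<exists>k::int. N (b' i - real_of_int k *\<^sub>R b) \<le> 4 * ?Q (b' i)" if i: "i < m" for i
  proof -
    obtain s where s: "N (b' i - s *\<^sub>R b) < 2 * ?Q (b' i)"
      using quot_seminorm_less[of N b "b' i" "2 * ?Q (b' i)"] b'(2)[OF i] by auto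
    let ?x = "b' i - real_of_int (round s) *\<^sub>R b"
    have x: "N ?x \<le> 2 * ?Q (b' i) + N b / 2"
      using round_scale_bound[OF N, of "b' i" s b] s by simp
    have "?x \<in> L" by (intro additive_subgroup_diff[OF L] b' i additive_subgroup_scale_int[OF L] b)
    moreover have "N ?x > 0" using quot_seminorm_le[OF N, of b "b' i" "round s"] b'(2)[OF i] by simp
    ultimately have "N b \<le> N ?x" using short by force
    \<comment> \<open>As \<open>N b \<le> N ?x\<close>, the term \<open>N b / 2\<close> in the bound
      \<open>x\<close> is absorbed by half of the left side, which turns the factor 2 into
      4.\<close>
    then show ?thesis using x by (intro exI[of _ "round s"]) simp
  qed
  then obtain e :: "nat \<Rightarrow> int" where e: "\<And>i. i < m \<Longrightarrow> N (b' i - real_of_int (e i) *\<^sub>R b) \<le> 4 * ?Q (b' i)"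
    by metis
  define b1 where "b1 i = (if i < m then b' i - real_of_int (e i) *\<^sub>R b else b)" for i
  have b1m: "b1 m = b" by (simp add: b1_def)
  have b1: "b1 i \<in> L" for i
    using b b' by (auto simp: b1_def intro!: additive_subgroup_diff[OF L] additive_subgroup_scale_int[OF L])
  have sumb1: "(\<Sum>i<m. k i *\<^sub>R b1 i) = (\<Sum>i<m. k i *\<^sub>R b' i) - (\<Sum>i<m. k i * real_of_int (e i)) *\<^sub>R b" for k
    by (simp add: b1_def scaleR_right_diff_distrib sum_subtractf scaleR_left.sum)
  have pos: "N (b1 i) > 0" if "i < Suc m" for i
  proof (cases "i < m")
    case True
    then show ?thesis using quot_seminorm_le[OF N, of b "b' i" "e i"] b'(2)[OF True] by (simp add: b1_def)
  qed (use b in \<open>simp add: b1_def\<close>)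
  have gen: "\<exists>k::nat \<Rightarrow> int. N (z - (\<Sum>i<Suc m. real_of_int (k i) *\<^sub>R b1 i)) = 0" if z: "z \<in> L" for z
  proof -
    obtain k :: "nat \<Rightarrow> int" where k: "?Q (z - (\<Sum>i<m. real_of_int (k i) *\<^sub>R b' i)) = 0"
      using rb z unfolding reduced_basis_def by meson
    define u where "u = z - (\<Sum>i<m. real_of_int (k i) *\<^sub>R b' i)"
    obtain s where s: "N (u - s *\<^sub>R b) < N b / 2"
      using quot_seminorm_less[of N b u "N b / 2"] k b by (auto simp: u_def)
    have "N (u - real_of_int (round s) *\<^sub>R b) < N b"
      using round_scale_bound[OF N, of u s b] s by simp
    moreover have "u - real_of_int (round s) *\<^sub>R b \<in> L"
      unfolding u_def using b' b z
      by (intro additive_subgroup_diff[OF L] additive_subgroup_sum[OF L] additive_subgroup_scale_int[OF L]) auto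
    \<comment> \<open>The remainder is shorter than the shortest vector \<open>b\<close>, hence lies
      in the kernel.\<close>
    ultimately have zero: "N (u - real_of_int (round s) *\<^sub>R b) = 0" using short by blast
    \<comment> \<open>The lifts differ from \<open>b'\<close> by the multiples \<open>e i\<close> of
      \<open>b\<close>; the last coefficient compensates for them.\<close>
    define k' where "k' = k(m := round s + (\<Sum>i<m. k i * e i))"
    have "(\<Sum>i<m. real_of_int (k' i) *\<^sub>R b1 i) = (\<Sum>i<m. real_of_int (k i) *\<^sub>R b1 i)"
      by (intro sum.cong) (auto simp: k'_def)
    then have "z - (\<Sum>i<Suc m. real_of_int (k' i) *\<^sub>R b1 i) = u - real_of_int (round s) *\<^sub>R b"
      by (simp add: sumb1 u_def b1m k'_def algebra_simps)
    then show ?thesis using zero by metis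
  qed
  have coef: "\<bar>k i\<bar> * N (b1 i) \<le> 4 * C * N (\<Sum>i<Suc m. k i *\<^sub>R b1 i)" if i: "i < m" for i and k :: "nat \<Rightarrow> real"
  proof -
    have "\<bar>k i\<bar> * N (b1 i) \<le> \<bar>k i\<bar> * (4 * ?Q (b' i))"
      using e[OF i] i by (intro mult_left_mono) (auto simp: b1_def)
    also have "\<dots> = 4 * (\<bar>k i\<bar> * ?Q (b' i))" by simp
    also have "\<dots> \<le> 4 * (C * ?Q (\<Sum>i<m. k i *\<^sub>R b' i))"
      using rb i unfolding reduced_basis_def by (intro mult_left_mono) auto
    also have "?Q (\<Sum>i<m. k i *\<^sub>R b' i) \<le> N ((\<Sum>i<m. k i *\<^sub>R b' i) - ((\<Sum>i<m. k i * real_of_int (e i)) - k m) *\<^sub>R b)"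
      by (rule quot_seminorm_le[OF N])
    also have "\<dots> = N (\<Sum>i<Suc m. k i *\<^sub>R b1 i)"
      by (simp add: sumb1 b1m algebra_simps)
    finally show ?thesis using C by simp
  qed
  have "\<bar>k i\<bar> * N (b1 i) \<le> (1 + 4 * C * (real d + 1)) * N (\<Sum>i<Suc m. k i *\<^sub>R b1 i)"
    if i: "i < Suc m" for i and k :: "nat \<Rightarrow> real"
  proof -
    let ?M = "N (\<Sum>i<Suc m. k i *\<^sub>R b1 i)"
    have M: "?M \<ge> 0" by (rule seminorm_nonneg[OF N])
    show ?thesis
    proof (cases "i < m")
      case True
      have "4 * C * ?M \<le> (1 + 4 * C * (real d + 1)) * ?M"
        using C M by (intro mult_right_mono) (auto simp: algebra_simps)
      then show ?thesis using coef[OF True, of k] by linarith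
    next
      case False
      then have "i = m" using i by simp
      have "\<bar>k m\<bar> * N (b1 m) = N ((\<Sum>i<Suc m. k i *\<^sub>R b1 i) - (\<Sum>i<m. k i *\<^sub>R b1 i))"
        by (simp add: seminorm_scale[OF N])
      also have "\<dots> \<le> ?M + N (\<Sum>i<m. k i *\<^sub>R b1 i)" by (rule seminorm_diff[OF N])
      also have "N (\<Sum>i<m. k i *\<^sub>R b1 i) \<le> (\<Sum>i<m. \<bar>k i\<bar> * N (b1 i))" by (rule seminorm_sum_le[OF N])
      also have "\<dots> \<le> (\<Sum>i<m. 4 * C * ?M)" by (intro sum_mono coef) auto
      also have "\<dots> = real m * (4 * C * ?M)" by simp
      also have "\<dots> \<le> (real d + 1) * (4 * C * ?M)"
        using md C M by (intro mult_right_mono) auto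
      finally show ?thesis using \<open>i = m\<close> by (simp add: algebra_simps)
    qed
  qed
  then show ?thesis using pos b1 gen unfolding reduced_basis_def by blast
qed

text \<open>The induction passes to the quotient seminorm by a shortest vector, which keeps the group and
  enlarges the kernel; this is why discreteness and rank are taken modulo the kernel. The constant
  depends on the rank only.\<close>

lemma reduced_basis_exists:
  "\<exists>C\<ge>1. \<forall>N (L::'v::real_vector set). seminorm N \<longrightarrow> additive_subgroup L \<longrightarrow> discrete_mod N L \<longrightarrow>
     rank_mod_le d N L \<longrightarrow> (\<exists>m\<le>d. \<exists>b. reduced_basis C m N L b)"
proof (induction d)
  case 0
  have "reduced_basis 1 0 N L (\<lambda>_. 0)" if N: "seminorm N" and "rank_mod_le 0 N L" for N and L :: "'v set"
  proof -
    have "N z = 0" if z: "z \<in> L" for z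
    proof -
      obtain c :: "nat \<Rightarrow> real" where "c 0 \<noteq> 0" "N (c 0 *\<^sub>R z) = 0"
        using \<open>rank_mod_le 0 N L\<close> z unfolding rank_mod_le_def by (auto dest!: spec[of _ "\<lambda>_. z"])
      then show ?thesis by (simp add: seminorm_scale[OF N])
    qed
    then show ?thesis by (auto simp: reduced_basis_def)
  qed
  then show ?case by (intro exI[of _ 1]) auto
next
  case (Suc d)
  then obtain C where C: "C \<ge> 1" "\<And>N (L::'v set). seminorm N \<Longrightarrow> additive_subgroup L \<Longrightarrow> discrete_mod N L \<Longrightarrow>
     rank_mod_le d N L \<Longrightarrow> (\<exists>m\<le>d. \<exists>b. reduced_basis C m N L b)" by blast
  have "\<exists>m\<le>Suc d. \<exists>b. reduced_basis (1 + 4 * C * (real d + 1)) m N L b"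
    if N: "seminorm N" and L: "additive_subgroup L" and disc: "discrete_mod N L"
      and rank: "rank_mod_le (Suc d) N L" for N and L :: "'v set"
  proof (cases "\<exists>z\<in>L. N z > 0")
    case False
    then have "\<forall>z\<in>L. N z = 0" using seminorm_nonneg[OF N] less_eq_real_def by fastforce
    then have "reduced_basis (1 + 4 * C * (real d + 1)) 0 N L (\<lambda>_. 0)"
      by (auto simp: reduced_basis_def)
    then show ?thesis by blast
  next
    case True
    then obtain z where "z \<in> L" "N z > 0" by blast
    then obtain b where b: "b \<in> L" "N b > 0" "\<And>x. x \<in> L \<Longrightarrow> N x < N b \<Longrightarrow> N x = 0"
      using shortest_vector_exists[OF N disc] by metis
    obtain m b' where "m \<le> d" "reduced_basis C m (quot_seminorm N b) L b'"
      using C(2)[OF seminorm_quot_seminorm[OF N] L discrete_mod_quot[OF N L disc b(1)]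
        rank_mod_le_quot[OF N rank b(1,2)]] by blast
    then show ?thesis using reduced_basis_step[OF N L b, of C m b' d] C(1) by fastforce
  qed
  moreover have "1 + 4 * C * (real d + 1) \<ge> 1" using C(1) by simp
  ultimately show ?case by blast
qed

section \<open>The lattice and its dual\<close>

locale approx_lattice =
  fixes n :: nat and \<xi> :: "nat \<Rightarrow> real"
  assumes n_pos: "n \<ge> 1" and indep: "Q_lin_indep n \<xi>"
begin

definition L :: "(nat \<Rightarrow> real) set" where
  "L = lattice n \<xi>"

definition supp :: "(nat \<Rightarrow> real) set" where
  "supp = {z. \<forall>i>n. z i = 0}"

definition W :: "(nat \<Rightarrow> real) set" where
  "W = {v \<in> supp. \<forall>i. v i \<in> \<int>}"

text \<open>The integers (x, y_1, ..., y_n) of a lattice point, extended linearly to all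
  vectors.\<close>

definition coef :: "nat \<Rightarrow> (nat \<Rightarrow> real) \<Rightarrow> real" where
  "coef j z = (if j = 0 then z 0 else \<xi> j * z 0 - z j)"

text \<open>For \<open>j \<le> n\<close> the lattice basis dual to \<open>coef\<close>: the vector
  (1, \<xi>_1, ..., \<xi>_n) and the negated unit vectors. The entry of the integer vector at index
  0 is ignored by \<open>lattice_pt\<close>.\<close>

definition gvec :: "nat \<Rightarrow> nat \<Rightarrow> real" where
  "gvec j = lattice_pt n \<xi> (if j = 0 then 1 else 0) (\<lambda>i. if i = j then 1 else 0)"

text \<open>The standard pairing of integer vectors in the coordinates \<open>coef\<close>, so
  integral on \<open>W\<close> and \<open>L\<close>; \<open>pair_eq\<close> expresses it in the
  coordinates of the box.\<close>

definition pair :: "(nat \<Rightarrow> real) \<Rightarrow> (nat \<Rightarrow> real) \<Rightarrow> real" where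
  "pair v z = (\<Sum>j\<le>n. v j * coef j z)"

definition form :: "(nat \<Rightarrow> real) \<Rightarrow> real" where
  "form v = v 0 + (\<Sum>i=1..n. v i * \<xi> i)"

text \<open>Index 0 is left out: its place in the dual gauge is taken by
  \<open>form\<close>.\<close>

definition height :: "(nat \<Rightarrow> real) \<Rightarrow> real" where
  "height v = Max ((\<lambda>i. \<bar>v i\<bar>) ` {1..n})"

definition boxnorm :: "real \<Rightarrow> (nat \<Rightarrow> real) \<Rightarrow> real" where
  "boxnorm q z = Max ((\<lambda>i. \<bar>z i\<bar> * exp (if i = 0 then - (real n * q) else q)) ` {..n})"

text \<open>By \<open>pair_eq\<close> the vector facing \<open>z\<close> is (\<open>form v\<close>,
  -v_1, ..., -v_n); weighting it inversely to \<open>boxnorm\<close> gives the polar gauge up to a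
  factor n + 1.\<close>

definition dualnorm :: "real \<Rightarrow> (nat \<Rightarrow> real) \<Rightarrow> real" where
  "dualnorm q v = max (height v * exp (- q)) (\<bar>form v\<bar> * exp (real n * q))"

section \<open>Elementary properties of height, form and box gauge\<close>

lemma height_ge: "i \<in> {1..n} \<Longrightarrow> \<bar>v i\<bar> \<le> height v"
  unfolding height_def by (rule Max_ge) auto

lemma height_le_iff: "height v \<le> c \<longleftrightarrow> (\<forall>i\<in>{1..n}. \<bar>v i\<bar> \<le> c)"
  unfolding height_def using n_pos by (subst Max_le_iff) auto

lemma height_nonneg: "height v \<ge> 0"
  using height_ge[of 1 v] n_pos by force

lemma seminorm_height: "seminorm height"
proof -
  have "height (x + y) \<le> height x + height y" for x y
    unfolding height_le_iff using height_ge[of _ x] height_ge[of _ y]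
    by (auto intro!: order_trans[OF abs_triangle_ineq] add_mono)
  moreover have le: "height (r *\<^sub>R x) \<le> \<bar>r\<bar> * height x" for r x
    unfolding height_le_iff using height_ge[of _ x] by (auto simp: abs_mult intro!: mult_left_mono)
  moreover have "height (r *\<^sub>R x) = \<bar>r\<bar> * height x" for r x
  proof (cases "r = 0")
    case True
    then show ?thesis using le[of 0 x] height_nonneg[of "0 *\<^sub>R x"] by simp
  next
    case False
    have "\<bar>r\<bar> * height ((1/r) *\<^sub>R (r *\<^sub>R x)) \<le> \<bar>r\<bar> * (\<bar>1/r\<bar> * height (r *\<^sub>R x))"
      by (intro mult_left_mono le) auto
    then show ?thesis using False le[of r x] by (simp add: field_simps)
  qed
  ultimately show ?thesis by (auto simp: seminorm_def)
qed

lemma form_add: "form (x + y) = form x + form y"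
  by (simp add: form_def sum.distrib algebra_simps)

lemma form_scale: "form (r *\<^sub>R x) = r * form x"
  by (simp add: form_def sum_distrib_left algebra_simps)

lemma form_diff: "form (x - y) = form x - form y"
  using form_add[of "x - y" y] by simp

lemma boxnorm_ge: "i \<le> n \<Longrightarrow> \<bar>z i\<bar> * exp (if i = 0 then - (real n * q) else q) \<le> boxnorm q z"
  unfolding boxnorm_def by (rule Max_ge) auto

lemma boxnorm_le_iff:
  "boxnorm q z \<le> c \<longleftrightarrow> (\<forall>i\<le>n. \<bar>z i\<bar> * exp (if i = 0 then - (real n * q) else q) \<le> c)"
  unfolding boxnorm_def by (subst Max_le_iff) auto

lemma boxnorm_nonneg: "boxnorm q z \<ge> 0"
  by (rule order_trans[OF _ boxnorm_ge[of 0]]) auto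

lemma in_scaled_box_iff: "in_scaled_box n q lam z \<longleftrightarrow> boxnorm q z \<le> lam"
proof -
  have *: "(\<forall>i\<le>n. P i) \<longleftrightarrow> P 0 \<and> (\<forall>i\<in>{1..n}. P i)" for P
    by (metis atLeastAtMost_iff less_one not_le zero_le)
  have "\<bar>z 0\<bar> \<le> lam * exp (real n * q) \<longleftrightarrow> \<bar>z 0\<bar> * exp (- (real n * q)) \<le> lam"
    by (simp add: exp_minus field_simps)
  moreover have "\<bar>z i\<bar> \<le> lam * exp (- q) \<longleftrightarrow> \<bar>z i\<bar> * exp q \<le> lam" for i
    by (simp add: exp_minus field_simps)
  ultimately show ?thesis
    unfolding in_scaled_box_def boxnorm_le_iff * by auto
qed

lemma seminorm_boxnorm: "seminorm (boxnorm q)"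
proof -
  have "boxnorm q (x + y) \<le> boxnorm q x + boxnorm q y" for x y
    unfolding boxnorm_le_iff
  proof (intro allI impI)
    fix i assume i: "i \<le> n"
    let ?e = "exp (if i = 0 then - (real n * q) else q)"
    have "\<bar>(x + y) i\<bar> * ?e \<le> (\<bar>x i\<bar> + \<bar>y i\<bar>) * ?e" by (intro mult_right_mono) auto
    then show "\<bar>(x + y) i\<bar> * ?e \<le> boxnorm q x + boxnorm q y"
      using boxnorm_ge[OF i, of x q] boxnorm_ge[OF i, of y q] by (simp only: distrib_right)
  qed
  moreover have le: "boxnorm q (r *\<^sub>R x) \<le> \<bar>r\<bar> * boxnorm q x" for r x
    unfolding boxnorm_le_iff
  proof (intro allI impI)
    fix i assume i: "i \<le> n"
    let ?e = "exp (if i = 0 then - (real n * q) else q)"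
    have "\<bar>(r *\<^sub>R x) i\<bar> * ?e = \<bar>r\<bar> * (\<bar>x i\<bar> * ?e)" by (simp add: abs_mult)
    then show "\<bar>(r *\<^sub>R x) i\<bar> * ?e \<le> \<bar>r\<bar> * boxnorm q x"
      using boxnorm_ge[OF i, of x q] by (simp only: mult_left_mono abs_ge_zero)
  qed
  moreover have "boxnorm q (r *\<^sub>R x) = \<bar>r\<bar> * boxnorm q x" for r x
  proof (cases "r = 0")
    case True
    then show ?thesis using le[of 0 x] boxnorm_nonneg[of q "0 *\<^sub>R x"] by simp
  next
    case False
    have "\<bar>r\<bar> * boxnorm q ((1/r) *\<^sub>R (r *\<^sub>R x)) \<le> \<bar>r\<bar> * (\<bar>1/r\<bar> * boxnorm q (r *\<^sub>R x))"
      by (intro mult_left_mono le) auto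
    then show ?thesis using False le[of r x] by (simp add: field_simps)
  qed
  ultimately show ?thesis by (auto simp: seminorm_def)
qed

lemma boxnorm_eq_0D: "boxnorm q z = 0 \<Longrightarrow> i \<le> n \<Longrightarrow> z i = 0"
  using boxnorm_ge[of i z q] by (auto simp: mult_le_0_iff)

section \<open>Coordinates with respect to the standard lattice basis and the integral
  pairing\<close>

lemma supp_eqI: "x \<in> supp \<Longrightarrow> y \<in> supp \<Longrightarrow> (\<And>i. i \<le> n \<Longrightarrow> x i = y i) \<Longrightarrow> x = y"
  by (auto simp: supp_def fun_eq_iff) (metis not_le)

lemma supp_scale: "x \<in> supp \<Longrightarrow> r *\<^sub>R x \<in> supp"
  by (simp add: supp_def)

lemma supp_sum: "(\<And>i. i \<in> I \<Longrightarrow> F i \<in> supp) \<Longrightarrow> (\<Sum>i\<in>I. F i) \<in> supp"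
  by (auto simp: supp_def intro!: sum.neutral)

lemma coef_lattice_pt: "j \<le> n \<Longrightarrow> coef j (lattice_pt n \<xi> x y) = real_of_int (if j = 0 then x else y j)"
  by (simp add: coef_def lattice_pt_def)

lemma lattice_pt_in_L: "lattice_pt n \<xi> x y \<in> L"
  by (auto simp: L_def lattice_def)

lemma gvec_in_L: "gvec j \<in> L"
  by (simp add: gvec_def lattice_pt_in_L)

lemma L_supp: "L \<subseteq> supp"
  by (auto simp: L_def lattice_def lattice_pt_def supp_def)

lemma gvec_expansion:
  assumes "z \<in> supp"
  shows "z = (\<Sum>j\<le>n. coef j z *\<^sub>R gvec j)"
proof (rule supp_eqI)
  show "(\<Sum>j\<le>n. coef j z *\<^sub>R gvec j) \<in> supp"
    using L_supp gvec_in_L by (intro supp_sum supp_scale) auto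
  fix i assume i: "i \<le> n"
  have "(\<Sum>j\<le>n. coef j z *\<^sub>R gvec j) i
      = (\<Sum>j\<le>n. (if j = 0 then z 0 * (if i = 0 then 1 else \<xi> i) else 0) + (if j = i then (if i = 0 then 0 else - coef i z) else 0))"
    unfolding sum_fun_apply using i
    by (intro sum.cong) (auto simp: gvec_def lattice_pt_def coef_def)
  also have "\<dots> = z i" using i by (simp add: sum.distrib coef_def)
  finally show "z i = (\<Sum>j\<le>n. coef j z *\<^sub>R gvec j) i" by simp
qed (rule assms)

lemma coef_add: "coef j (x + y) = coef j x + coef j y"
  and coef_scale: "coef j (r *\<^sub>R x) = r * coef j x"
  and coef_diff: "coef j (x - y) = coef j x - coef j y"
  by (simp_all add: coef_def algebra_simps)

lemma coef_zero: "coef j 0 = 0" by (simp add: coef_def)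

lemma pair_add: "pair v (x + y) = pair v x + pair v y"
  by (simp add: pair_def coef_add sum.distrib algebra_simps)

lemma pair_scale: "pair v (r *\<^sub>R x) = r * pair v x"
  by (simp add: pair_def coef_scale sum_distrib_left algebra_simps)

lemma pair_zero: "pair v 0 = 0"
  by (simp add: pair_def coef_zero)

lemma pair_sum: "pair v (\<Sum>i\<in>I. k i *\<^sub>R x i) = (\<Sum>i\<in>I. k i * pair v (x i))"
proof (induction I rule: infinite_finite_induct)
  case (insert i I)
  then show ?case by (simp only: sum.insert[OF insert.hyps] pair_add pair_scale)
next
  case (infinite A)
  show ?case by (simp only: sum.infinite[OF infinite] pair_zero)
qed (simp only: sum.empty pair_zero)

lemma pair_sum_left: "pair (\<Sum>i\<in>I. k i *\<^sub>R v i) z = (\<Sum>i\<in>I. k i * pair (v i) z)"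
  unfolding pair_def sum_fun_apply
  by (simp add: sum_distrib_left sum_distrib_right mult.assoc) (rule sum.swap)

lemma pair_gvec: "j \<le> n \<Longrightarrow> pair v (gvec j) = v j"
  unfolding pair_def gvec_def
  by (subst sum.cong[OF refl, of _ _ "\<lambda>i. if i = j then v j else 0"]) (auto simp: coef_lattice_pt)

lemma L_eq: "L = {z \<in> supp. \<forall>j\<le>n. coef j z \<in> \<int>}"
proof
  show "L \<subseteq> {z \<in> supp. \<forall>j\<le>n. coef j z \<in> \<int>}"
    using L_supp coef_lattice_pt by (auto simp: L_def lattice_def)
  show "{z \<in> supp. \<forall>j\<le>n. coef j z \<in> \<int>} \<subseteq> L"
  proof safe
    fix z assume z: "z \<in> supp" "\<forall>j\<le>n. coef j z \<in> \<int>"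
    then have fl: "real_of_int \<lfloor>coef j z\<rfloor> = coef j z" if "j \<le> n" for j
      using that by (metis of_int_floor_cancel Ints_cases)
    have "z = lattice_pt n \<xi> \<lfloor>coef 0 z\<rfloor> (\<lambda>j. \<lfloor>coef j z\<rfloor>)"
    proof (rule supp_eqI[OF z(1)])
      show "lattice_pt n \<xi> \<lfloor>coef 0 z\<rfloor> (\<lambda>j. \<lfloor>coef j z\<rfloor>) \<in> supp"
        using L_supp lattice_pt_in_L by auto
      fix i assume i: "i \<le> n"
      have "real_of_int \<lfloor>z 0\<rfloor> = z 0" using fl[of 0] by (simp add: coef_def)
      then show "z i = lattice_pt n \<xi> \<lfloor>coef 0 z\<rfloor> (\<lambda>j. \<lfloor>coef j z\<rfloor>) i"
        using fl[OF i] fl[of 0] i by (cases "i = 0") (simp_all add: lattice_pt_def coef_def del: of_int_floor_cancel)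
    qed
    then show "z \<in> L" using lattice_pt_in_L by metis
  qed
qed

lemma additive_subgroup_L: "additive_subgroup L"
  unfolding additive_subgroup_def L_eq
  by (auto simp: supp_def coef_diff coef_zero)

lemma additive_subgroup_W: "additive_subgroup W"
  unfolding additive_subgroup_def W_def by (auto simp: supp_def)

lemma pair_Ints: "v \<in> W \<Longrightarrow> z \<in> L \<Longrightarrow> pair v z \<in> \<int>"
  unfolding pair_def W_def L_eq by (auto intro!: Ints_sum Ints_mult)

lemma pair_eq: "pair v z = form v * z 0 - (\<Sum>i=1..n. v i * z i)"
proof -
  have "pair v z = v 0 * z 0 + (\<Sum>i=1..n. v i * coef i z)"
    unfolding pair_def by (simp add: atMost_atLeast0 sum.atLeast_Suc_atMost coef_def)
  also have "(\<Sum>i=1..n. v i * coef i z) = (\<Sum>i=1..n. v i * \<xi> i * z 0 - v i * z i)"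
    by (intro sum.cong) (auto simp: coef_def algebra_simps)
  finally show ?thesis by (simp add: form_def sum_subtractf sum_distrib_right[symmetric] distrib_right)
qed

lemma dualnorm_nonneg: "dualnorm q v \<ge> 0"
  by (simp add: dualnorm_def height_nonneg le_max_iff_disj)

text \<open>The exponential weights of the two gauges cancel in each of the n + 1 products of
  \<open>pair_eq\<close>.\<close>

lemma abs_pair_le: "\<bar>pair v z\<bar> \<le> (real n + 1) * dualnorm q v * boxnorm q z"
proof -
  have "\<bar>form v * z 0\<bar> = (\<bar>form v\<bar> * exp (real n * q)) * (\<bar>z 0\<bar> * exp (- (real n * q)))"
    by (simp add: abs_mult exp_minus)
  also have "\<dots> \<le> dualnorm q v * boxnorm q z"
    using boxnorm_ge[of 0 z q] by (intro mult_mono) (auto simp: dualnorm_def dualnorm_nonneg le_max_iff_disj height_nonneg)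
  finally have 1: "\<bar>form v * z 0\<bar> \<le> dualnorm q v * boxnorm q z" .
  have "\<bar>v i * z i\<bar> \<le> dualnorm q v * boxnorm q z" if i: "i \<in> {1..n}" for i
  proof -
    have "\<bar>v i * z i\<bar> = (\<bar>v i\<bar> * exp (- q)) * (\<bar>z i\<bar> * exp q)"
      by (simp add: abs_mult exp_minus)
    also have "\<dots> \<le> (height v * exp (- q)) * boxnorm q z"
      using boxnorm_ge[of i z q] i height_ge[OF i, of v] height_nonneg
      by (intro mult_mono) auto
    also have "\<dots> \<le> dualnorm q v * boxnorm q z"
      by (intro mult_right_mono boxnorm_nonneg) (auto simp: dualnorm_def)
    finally show ?thesis .
  qed
  then have "(\<Sum>i=1..n. \<bar>v i * z i\<bar>) \<le> (\<Sum>i=1..n. dualnorm q v * boxnorm q z)"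
    by (intro sum_mono) auto
  then have "\<bar>\<Sum>i=1..n. v i * z i\<bar> \<le> real n * (dualnorm q v * boxnorm q z)"
    using order_trans[OF sum_abs[of "\<lambda>i. v i * z i" "{1..n}"]] by simp
  with 1 show ?thesis unfolding pair_eq by (simp add: algebra_simps)
qed

section \<open>Discreteness and rank of the lattice\<close>

lemma boxnorm_L_ge:
  assumes "z \<in> L" "z \<noteq> 0" "q \<ge> 0"
  shows "boxnorm q z \<ge> exp (- (real n * q))"
proof (cases "z 0 = 0")
  case False
  have "z 0 \<in> \<int>" using assms(1) unfolding L_eq by (auto simp: coef_def)
  then have "\<bar>z 0\<bar> \<ge> 1" using False by (rule Ints_nonzero_abs_ge1)
  then have "1 * exp (- (real n * q)) \<le> \<bar>z 0\<bar> * exp (- (real n * q))" by (intro mult_right_mono) auto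
  moreover have "\<bar>z 0\<bar> * exp (- (real n * q)) \<le> boxnorm q z" using boxnorm_ge[of 0 z q] by simp
  ultimately show ?thesis by linarith
next
  case True
  have "0 \<in> supp" by (simp add: supp_def)
  then obtain i where i: "i \<le> n" "z i \<noteq> 0" using supp_eqI[of z 0] assms L_supp by force
  then have "i \<noteq> 0" using True by metis
  \<comment> \<open>With \<open>z 0 = 0\<close> one has \<open>coef i z = - z i\<close>, so the box
    coordinates are themselves integers.\<close>
  then have "z i \<in> \<int>" using assms(1) i True unfolding L_eq coef_def by force
  then have "\<bar>z i\<bar> \<ge> 1" using i(2) by (rule Ints_nonzero_abs_ge1)
  then have "1 * exp q \<le> \<bar>z i\<bar> * exp q" by (intro mult_right_mono) auto
  moreover have "\<bar>z i\<bar> * exp q \<le> boxnorm q z" using boxnorm_ge[of i z q] i \<open>i \<noteq> 0\<close> by simp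
  ultimately have "exp q \<le> boxnorm q z" by linarith
  moreover have "- (real n * q) \<le> q" using assms(3) by (smt (verit) mult_nonneg_nonneg of_nat_0_le_iff)
  then have "exp (- (real n * q)) \<le> exp q" by simp
  ultimately show ?thesis by linarith
qed

lemma finite_bounded_Ints_supp: "finite {v \<in> supp. \<forall>i\<le>n. v i \<in> \<int> \<and> \<bar>v i\<bar> \<le> B}"
proof (rule finite_subset)
  show "{v \<in> supp. \<forall>i\<le>n. v i \<in> \<int> \<and> \<bar>v i\<bar> \<le> B}
      \<subseteq> {v. \<forall>i. (i \<in> {..n} \<longrightarrow> v i \<in> real_of_int ` {- \<lceil>B\<rceil>..\<lceil>B\<rceil>}) \<and> (i \<notin> {..n} \<longrightarrow> v i = 0)}"
  proof (safe, goal_cases)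
    case (1 v i)
    then obtain k where k: "v i = real_of_int k" by (auto elim: Ints_cases)
    moreover have "\<bar>v i\<bar> \<le> B" using 1 by auto
    ultimately have "k \<in> {- \<lceil>B\<rceil>..\<lceil>B\<rceil>}" by (simp add: abs_le_iff) linarith
    then show ?case using k by blast
  next
    case (2 v i)
    then show ?case unfolding supp_def by (metis (mono_tags) atMost_iff mem_Collect_eq not_le)
  qed
  show "finite {v. \<forall>i. (i \<in> {..n} \<longrightarrow> v i \<in> real_of_int ` {- \<lceil>B\<rceil>..\<lceil>B\<rceil>}) \<and> (i \<notin> {..n} \<longrightarrow> v i = 0)}"
    by (rule finite_set_of_finite_funs) auto
qed

text \<open>For fixed \<xi> a bounded box gauge bounds the integer coordinates, and these determine
  the point by \<open>gvec_expansion\<close>.\<close>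

lemma finite_L_bounded: "finite {z \<in> L. boxnorm q z \<le> R}"
proof -
  define T where "T z = (\<lambda>j. if j \<le> n then coef j z else 0)" for z
  define M where "M = R * exp (real n * q) + R * exp (- q)"
  define B where "B = M + (\<Sum>j=1..n. \<bar>\<xi> j\<bar> * M)"
  have "finite (T ` {z \<in> L. boxnorm q z \<le> R})"
  proof (rule finite_subset[OF _ finite_bounded_Ints_supp[of B]], safe, goal_cases)
    case (1 _ z)
    then show ?case by (auto simp: T_def supp_def)
  next
    case (2 _ z i)
    then show ?case by (auto simp: T_def L_eq)
  next
    case (3 _ z i)
    have R: "R \<ge> 0" using 3 boxnorm_nonneg[of q z] by linarith
    have M0: "R * exp (real n * q) \<le> M" "R * exp (- q) \<le> M" "0 \<le> M" using R by (auto simp: M_def)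
    have box: "in_scaled_box n q R z" using 3 by (simp add: in_scaled_box_iff)
    have z: "\<bar>z j\<bar> \<le> M" if "j \<le> n" for j
    proof (cases "j = 0")
      case False
      then have "\<bar>z j\<bar> \<le> R * exp (- q)" using box that by (simp add: in_scaled_box_def)
      then show ?thesis using M0 by linarith
    qed (use box M0 in \<open>auto simp: in_scaled_box_def\<close>)
    have "\<bar>coef i z\<bar> \<le> B"
    proof (cases "i = 0")
      case True
      have "0 \<le> (\<Sum>j=1..n. \<bar>\<xi> j\<bar> * M)" using M0 by (intro sum_nonneg) auto
      then show ?thesis using z[of 0] True by (simp add: coef_def B_def)
    next
      case False
      have "\<bar>\<xi> i\<bar> * M \<le> (\<Sum>j=1..n. \<bar>\<xi> j\<bar> * M)" using M0 False 3 by (intro member_le_sum) auto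
      moreover have "\<bar>\<xi> i * z 0\<bar> \<le> \<bar>\<xi> i\<bar> * M" unfolding abs_mult using z[of 0] by (intro mult_left_mono) auto
      ultimately show ?thesis using z[of i] 3 False by (simp add: coef_def B_def)
    qed
    then show ?case using 3 by (simp add: T_def)
  qed
  moreover have "inj_on T {z \<in> L. boxnorm q z \<le> R}"
  proof (rule inj_onI, clarify)
    fix x y assume "x \<in> L" "y \<in> L" "T x = T y"
    then have "coef j x = coef j y" if "j \<le> n" for j using that by (auto simp: T_def fun_eq_iff split: if_splits)
    then have "(\<Sum>j\<le>n. coef j x *\<^sub>R gvec j) = (\<Sum>j\<le>n. coef j y *\<^sub>R gvec j)" by (intro sum.cong) auto
    then show "x = y" using gvec_expansion \<open>x \<in> L\<close> \<open>y \<in> L\<close> L_supp by (metis subsetD)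
  qed
  ultimately show ?thesis by (rule finite_imageD)
qed

lemma discrete_L: "discrete_mod (boxnorm q) L"
  unfolding discrete_mod_def
proof
  fix R
  show "\<exists>F. finite F \<and> F \<subseteq> L \<and> (\<forall>z\<in>L. boxnorm q z \<le> R \<longrightarrow> (\<exists>f\<in>F. boxnorm q (z - f) = 0))"
    using finite_L_bounded[of q R] seminorm_zero[OF seminorm_boxnorm, of q]
    by (intro exI[of _ "{z \<in> L. boxnorm q z \<le> R}"]) auto
qed

lemma exists_supp_relation:
  assumes "\<And>i. i \<le> Suc n \<Longrightarrow> v i \<in> supp"
  shows "\<exists>c. (\<exists>i\<le>Suc n. c i \<noteq> 0) \<and> (\<Sum>i\<le>Suc n. c i *\<^sub>R v i) = 0"
proof -
  obtain c where c: "\<exists>i\<in>{..Suc n}. c i \<noteq> 0" "\<forall>l\<in>{..n}. (\<Sum>i\<in>{..Suc n}. c i * v i l) = 0"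
    using exists_linear_relation[of "{..n}" "{..Suc n}" v] by auto
  have "(\<Sum>i\<le>Suc n. c i *\<^sub>R v i) = 0"
  proof (rule supp_eqI)
    show "(\<Sum>i\<le>Suc n. c i *\<^sub>R v i) \<in> supp" using assms by (intro supp_sum supp_scale) auto
    show "0 \<in> supp" by (simp add: supp_def)
  qed (use c(2) in auto)
  with c(1) show ?thesis by auto
qed

lemma rank_L: "rank_mod_le (Suc n) (boxnorm q) L"
  unfolding rank_mod_le_def
proof (intro allI impI)
  fix v :: "nat \<Rightarrow> nat \<Rightarrow> real" assume "\<forall>i\<le>Suc n. v i \<in> L"
  then obtain c where "\<exists>i\<le>Suc n. c i \<noteq> 0" "(\<Sum>i\<le>Suc n. c i *\<^sub>R v i) = 0"
    using exists_supp_relation[of v] L_supp by auto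
  then show "\<exists>c. (\<exists>i\<le>Suc n. c i \<noteq> 0) \<and> boxnorm q (\<Sum>i\<le>Suc n. c i *\<^sub>R v i) = 0"
    using seminorm_zero[OF seminorm_boxnorm, of q] by metis
qed

section \<open>Reduced lattice bases with their integral dual bases\<close>

definition good_basis :: "real \<Rightarrow> real \<Rightarrow> (nat \<Rightarrow> nat \<Rightarrow> real) \<Rightarrow> (nat \<Rightarrow> nat \<Rightarrow> real) \<Rightarrow> bool" where
  "good_basis C q b w \<longleftrightarrow>
     (\<forall>i\<le>n. b i \<in> L \<and> boxnorm q (b i) > 0 \<and> w i \<in> W) \<and>
     (\<forall>z\<in>supp. z = (\<Sum>i\<le>n. pair (w i) z *\<^sub>R b i)) \<and>
     (\<forall>k::nat \<Rightarrow> real. (\<Sum>i\<le>n. k i *\<^sub>R b i) = 0 \<longrightarrow> (\<forall>i\<le>n. k i = 0)) \<and>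
     (\<forall>z\<in>supp. \<forall>i\<le>n. \<bar>pair (w i) z\<bar> * boxnorm q (b i) \<le> C * boxnorm q z)"

lemma gvec_independent:
  assumes "(\<Sum>j\<le>n. c j *\<^sub>R gvec j) = 0" "j \<le> n"
  shows "c j = 0"
proof -
  define v :: "nat \<Rightarrow> real" where "v i = (if i = j then 1 else 0)" for i
  have "0 = pair v (\<Sum>j\<le>n. c j *\<^sub>R gvec j)" using assms(1) by (simp only: pair_zero)
  also have "\<dots> = (\<Sum>i\<le>n. c i * v i)" unfolding pair_sum by (intro sum.cong) (auto simp: pair_gvec)
  also have "\<dots> = (\<Sum>i\<le>n. if i = j then c i else 0)" by (intro sum.cong) (auto simp: v_def)
  also have "\<dots> = c j" using assms(2) by simp
  finally show ?thesis by simp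
qed

text \<open>Expanding the \<open>gvec j\<close> in \<open>b\<close> gives an integer matrix whose
  column \<open>i\<close> is \<open>w i\<close>, so that \<open>pair (w i)\<close> reads off the
  coordinate along \<open>b i\<close>. With fewer than n + 1 columns the rows would be dependent,
  and with them the \<open>gvec j\<close>.\<close>

lemma dual_basis_exists:
  assumes rb: "reduced_basis C m (boxnorm q) L b" and m: "m \<le> Suc n"
  shows "m = Suc n \<and> (\<exists>w. good_basis C q b w)"
proof -
  have "\<exists>k::nat \<Rightarrow> int. z = (\<Sum>i<m. real_of_int (k i) *\<^sub>R b i)" if z: "z \<in> L" for z
  proof -
    obtain k :: "nat \<Rightarrow> int" where k: "boxnorm q (z - (\<Sum>i<m. real_of_int (k i) *\<^sub>R b i)) = 0"
      using rb z unfolding reduced_basis_def by meson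
    define s where "s = (\<Sum>i<m. real_of_int (k i) *\<^sub>R b i)"
    have "s \<in> L" unfolding s_def
      using rb by (intro additive_subgroup_sum additive_subgroup_L) (auto simp: reduced_basis_def)
    then have "z = s"
      using z L_supp boxnorm_eq_0D[OF k[folded s_def]] by (intro supp_eqI) auto
    then show ?thesis unfolding s_def by blast
  qed
  then have "\<forall>j. \<exists>k::nat \<Rightarrow> int. gvec j = (\<Sum>i<m. real_of_int (k i) *\<^sub>R b i)" using gvec_in_L by blast
  then obtain K :: "nat \<Rightarrow> nat \<Rightarrow> int" where K: "\<And>j. gvec j = (\<Sum>i<m. real_of_int (K j i) *\<^sub>R b i)" by metis
  define w :: "nat \<Rightarrow> nat \<Rightarrow> real" where "w i = (\<lambda>j. if j \<le> n then real_of_int (K j i) else 0)" for i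
  have wW: "w i \<in> W" for i by (auto simp: w_def W_def supp_def)
  have comb: "(\<Sum>j\<le>n. c j *\<^sub>R gvec j) = (\<Sum>i<m. (\<Sum>j\<le>n. c j * real_of_int (K j i)) *\<^sub>R b i)" for c
  proof -
    have "(\<Sum>j\<le>n. c j *\<^sub>R gvec j) = (\<Sum>j\<le>n. \<Sum>i<m. (c j * real_of_int (K j i)) *\<^sub>R b i)"
      by (subst K) (simp only: scaleR_sum_right scaleR_scaleR)
    also have "\<dots> = (\<Sum>i<m. \<Sum>j\<le>n. (c j * real_of_int (K j i)) *\<^sub>R b i)" by (rule sum.swap)
    also have "\<dots> = (\<Sum>i<m. (\<Sum>j\<le>n. c j * real_of_int (K j i)) *\<^sub>R b i)" by (simp only: scaleR_left.sum)
    finally show ?thesis .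
  qed
  have expand: "z = (\<Sum>i<m. pair (w i) z *\<^sub>R b i)" if z: "z \<in> supp" for z
  proof -
    have "pair (w i) z = (\<Sum>j\<le>n. coef j z * real_of_int (K j i))" for i
      unfolding pair_def w_def by (intro sum.cong) auto
    then show ?thesis using gvec_expansion[OF z] comb[of "\<lambda>j. coef j z"] by simp
  qed
  have "m = Suc n"
  proof (rule ccontr)
    assume "m \<noteq> Suc n"
    then have "card {..<m} < card {..n}" using m by simp
    then obtain c where c: "\<exists>j\<in>{..n}. c j \<noteq> 0" "\<forall>i\<in>{..<m}. (\<Sum>j\<in>{..n}. c j * real_of_int (K j i)) = 0"
      using exists_linear_relation[of "{..<m}" "{..n}" "\<lambda>j i. real_of_int (K j i)"] by auto
    then have "(\<Sum>j\<le>n. c j *\<^sub>R gvec j) = 0" unfolding comb by (intro sum.neutral) auto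
    then show False using gvec_independent c(1) by blast
  qed
  moreover have "good_basis C q b w"
    unfolding good_basis_def
  proof (intro conjI allI ballI impI)
    have eqset: "{..<m} = {..n}" using \<open>m = Suc n\<close> by auto
    fix i assume "i \<le> n"
    then have i: "i < m" using \<open>m = Suc n\<close> by simp
    show "b i \<in> L" "boxnorm q (b i) > 0" using rb i by (auto simp: reduced_basis_def)
    have ii: "\<bar>k i\<bar> * boxnorm q (b i) \<le> C * boxnorm q (\<Sum>i\<le>n. k i *\<^sub>R b i)" for k :: "nat \<Rightarrow> real"
      using rb i unfolding reduced_basis_def eqset by blast
    show "w i \<in> W" by (rule wW)
    show "k i = 0" if "(\<Sum>i\<le>n. k i *\<^sub>R b i) = 0" for k :: "nat \<Rightarrow> real"
      using ii[of k] that \<open>boxnorm q (b i) > 0\<close> seminorm_zero[OF seminorm_boxnorm, of q]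
      by (simp add: mult_le_0_iff)
    show "\<bar>pair (w i) z\<bar> * boxnorm q (b i) \<le> C * boxnorm q z" if "z \<in> supp" for z
      using ii[of "\<lambda>i. pair (w i) z"] expand[OF that] unfolding eqset by metis
  next
    fix z assume "z \<in> supp"
    then show "z = (\<Sum>i\<le>n. pair (w i) z *\<^sub>R b i)"
      using expand[of z] \<open>m = Suc n\<close> by (simp only: lessThan_Suc_atMost)
  qed
  ultimately show ?thesis by blast
qed

text \<open>The constant is fixed before \<open>q\<close>; it therefore disappears once logarithms
  are divided by \<open>q\<close>.\<close>

lemma good_basis_exists: "\<exists>C\<ge>1. \<forall>q. \<exists>b w. good_basis C q b w"
proof -
  obtain C where C: "C \<ge> 1" "\<And>q. \<exists>m\<le>Suc n. \<exists>b. reduced_basis C m (boxnorm q) L b"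
    using reduced_basis_exists[where 'v = "nat \<Rightarrow> real", of "Suc n"]
      seminorm_boxnorm additive_subgroup_L discrete_L rank_L by blast
  then show ?thesis using dual_basis_exists by blast
qed

text \<open>Double counting of lattice points of gauge at most \<open>R\<close>. The explicit points
  \<open>h\<close> number at least half of R^(n + 1), while the integer coordinates along
  \<open>b i\<close> are bounded by \<open>C * R / boxnorm q (b i)\<close>. Taking the side length
  in the directions 1, ..., n to be the integer \<open>Y\<close> confines the rounding loss to
  direction 0.\<close>

lemma lattice_count:
  fixes Y :: nat
  assumes gb: "good_basis C q b w" and C: "C \<ge> 1" and Y: "Y \<ge> 1" and q: "q \<ge> 0"
  defines "R \<equiv> real Y * exp q"
  shows "R ^ (n + 1) \<le> 2 * (\<Prod>i\<le>n. 2 * (C * R / boxnorm q (b i)) + 1)"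
proof -
  define X where "X = nat \<lfloor>R * exp (real n * q)\<rfloor>"
  have R1: "R * exp (real n * q) \<ge> 1"
  proof -
    have "R \<ge> 1" using Y q unfolding R_def by (simp add: mult_ge1_I)
    then show ?thesis using q by (simp add: mult_ge1_I)
  qed
  define D where "D = {..<X} \<times> PiE {1..n} (\<lambda>_. {..<Y})"
  \<comment> \<open>After removal of the integer part, coordinate \<open>i\<close> is a fractional
    part minus a number below \<open>Y\<close>.\<close>
  define h where "h p = lattice_pt n \<xi> (int (fst p)) (\<lambda>i. \<lfloor>\<xi> i * real (fst p)\<rfloor> + int (snd p i))" for p
  define M where "M i = \<lfloor>C * R / boxnorm q (b i)\<rfloor>" for i
  define kc where "kc z = (\<lambda>i\<in>{..n}. \<lfloor>pair (w i) z\<rfloor>)" for z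
  have hL: "h p \<in> L" for p by (simp add: h_def lattice_pt_in_L)
  have hbox: "boxnorm q (h p) \<le> R" if p: "p \<in> D" for p
    unfolding in_scaled_box_iff[symmetric] in_scaled_box_def
  proof (intro conjI ballI)
    have "fst p < X" using p by (auto simp: D_def)
    then have "real (fst p) \<le> R * exp (real n * q)" unfolding X_def by linarith
    then show "\<bar>h p 0\<bar> \<le> R * exp (real n * q)" by (simp add: h_def lattice_pt_def)
    fix i assume i: "i \<in> {1..n}"
    have "snd p i < Y" using p i by (auto simp: D_def)
    have "\<bar>h p i\<bar> = \<bar>frac (\<xi> i * real (fst p)) - real (snd p i)\<bar>"
      using i by (simp add: h_def lattice_pt_def frac_def)
    also have "\<dots> \<le> real Y"
      using \<open>snd p i < Y\<close> frac_ge_0[of "\<xi> i * real (fst p)"] frac_lt_1[of "\<xi> i * real (fst p)"] Y by linarith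
    also have "\<dots> = R * exp (- q)" by (simp add: R_def exp_minus)
    finally show "\<bar>h p i\<bar> \<le> R * exp (- q)" .
  qed
  have kcin: "kc z \<in> PiE {..n} (\<lambda>i. {- M i..M i})" if z: "z \<in> L" "boxnorm q z \<le> R" for z
  proof -
    have "\<lfloor>pair (w i) z\<rfloor> \<in> {- M i..M i}" if i: "i \<le> n" for i
    proof -
      have N: "boxnorm q (b i) > 0" and wi: "w i \<in> W" using gb i by (auto simp: good_basis_def)
      obtain k where k: "pair (w i) z = real_of_int k" using pair_Ints[OF wi z(1)] by (auto elim: Ints_cases)
      have "\<bar>pair (w i) z\<bar> * boxnorm q (b i) \<le> C * boxnorm q z"
        using gb i z L_supp by (auto simp: good_basis_def)
      also have "\<dots> \<le> C * R" using z C by (intro mult_left_mono) auto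
      finally have "\<bar>real_of_int k\<bar> \<le> C * R / boxnorm q (b i)" using N k by (simp add: field_simps)
      then have "\<bar>k\<bar> \<le> M i" unfolding M_def by (simp add: le_floor_iff)
      then show ?thesis using k by auto
    qed
    then show ?thesis by (auto simp: kc_def)
  qed
  have kcinj: "x = y" if "x \<in> L" "y \<in> L" "kc x = kc y" for x y
  proof -
    have "pair (w i) x = pair (w i) y" if i: "i \<le> n" for i
    proof -
      have wi: "w i \<in> W" using gb i by (auto simp: good_basis_def)
      have "\<lfloor>pair (w i) x\<rfloor> = \<lfloor>pair (w i) y\<rfloor>"
        using fun_cong[OF \<open>kc x = kc y\<close>, of i] i by (simp add: kc_def)
      then show ?thesis using pair_Ints[OF wi \<open>x \<in> L\<close>] pair_Ints[OF wi \<open>y \<in> L\<close>]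
        by (metis Ints_cases floor_of_int)
    qed
    then have "(\<Sum>i\<le>n. pair (w i) x *\<^sub>R b i) = (\<Sum>i\<le>n. pair (w i) y *\<^sub>R b i)" by (intro sum.cong) auto
    moreover have "x = (\<Sum>i\<le>n. pair (w i) x *\<^sub>R b i)" "y = (\<Sum>i\<le>n. pair (w i) y *\<^sub>R b i)"
      using gb that L_supp unfolding good_basis_def by blast+
    ultimately show ?thesis by metis
  qed
  have hinj: "inj_on h D"
  proof (rule inj_onI)
    fix p r assume pr: "p \<in> D" "r \<in> D" "h p = h r"
    have f: "fst p = fst r" using fun_cong[OF pr(3), of 0] by (simp add: h_def lattice_pt_def)
    have "snd p = snd r"
    proof (rule PiE_ext)
      show "snd p \<in> PiE {1..n} (\<lambda>_. {..<Y})" "snd r \<in> PiE {1..n} (\<lambda>_. {..<Y})"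
        using pr by (auto simp: D_def)
      fix i assume "i \<in> {1..n}"
      then show "snd p i = snd r i"
        using fun_cong[OF pr(3), of i] f by (simp add: h_def lattice_pt_def)
    qed
    with f show "p = r" by (simp add: prod_eq_iff)
  qed
  have "card D \<le> card (PiE {..n} (\<lambda>i. {- M i..M i}))"
  proof (rule card_inj_on_le)
    show "inj_on (kc \<circ> h) D"
      using hinj kcinj hL by (auto simp: inj_on_def)
    show "(kc \<circ> h) ` D \<subseteq> PiE {..n} (\<lambda>i. {- M i..M i})" using kcin[OF hL hbox] by (simp only: image_subset_iff comp_apply) blast
    show "finite (PiE {..n} (\<lambda>i. {- M i..M i}))" by (intro finite_PiE) auto
  qed
  also have "\<dots> = (\<Prod>i\<le>n. nat (2 * M i + 1))" by (simp add: card_PiE)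
  finally have "X * Y ^ n \<le> (\<Prod>i\<le>n. nat (2 * M i + 1))"
    unfolding D_def by (simp add: card_cartesian_product card_PiE)
  then have "real (X * Y ^ n) \<le> real (\<Prod>i\<le>n. nat (2 * M i + 1))" by (rule of_nat_mono)
  also have "\<dots> = (\<Prod>i\<le>n. real (nat (2 * M i + 1)))" by simp
  also have "\<dots> \<le> (\<Prod>i\<le>n. 2 * (C * R / boxnorm q (b i)) + 1)"
  proof (intro prod_mono conjI)
    fix i assume "i \<in> {..n}"
    have nn: "C * R / boxnorm q (b i) \<ge> 0" using C boxnorm_nonneg by (simp add: R_def)
    then have "real (nat (2 * M i + 1)) = 2 * real_of_int (M i) + 1" by (simp add: M_def)
    also have "\<dots> \<le> 2 * (C * R / boxnorm q (b i)) + 1"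
      using of_int_floor_le[of "C * R / boxnorm q (b i)"] unfolding M_def by linarith
    finally show "real (nat (2 * M i + 1)) \<le> 2 * (C * R / boxnorm q (b i)) + 1" .
  qed auto
  finally have le: "real X * real Y ^ n \<le> (\<Prod>i\<le>n. 2 * (C * R / boxnorm q (b i)) + 1)" by simp
  have "\<lfloor>R * exp (real n * q)\<rfloor> \<ge> 1" using R1 by (simp add: le_floor_iff)
  then have "real X = real_of_int \<lfloor>R * exp (real n * q)\<rfloor>" "real X \<ge> 1" by (simp_all add: X_def)
  \<comment> \<open>Rounding down a number that is at least 1 loses at most a factor 2.\<close>
  then have "R * exp (real n * q) \<le> 2 * real X"
    using floor_correct[of "R * exp (real n * q)"] by linarith
  then have "R * exp (real n * q) * real Y ^ n \<le> 2 * real X * real Y ^ n" by (intro mult_right_mono) auto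
  moreover have "R * exp (real n * q) * real Y ^ n = R ^ (n + 1)"
    by (simp add: R_def power_mult_distrib exp_of_nat_mult)
  ultimately show ?thesis using le by simp
qed

text \<open>Counting lattice points in large boxes stands in for the determinant of the lattice, which is
  \<open>1\<close> at every \<open>q\<close>; this gives the hard half of Minkowski's second theorem with a worse constant.\<close>

lemma good_basis_prod_le:
  assumes gb: "good_basis C q b w" and C: "C \<ge> 1" and q: "q \<ge> 0"
  shows "(\<Prod>i\<le>n. boxnorm q (b i)) \<le> 2 * (3 * C) ^ (n + 1)"
proof -
  let ?N = "\<lambda>i. boxnorm q (b i)"
  have N: "?N i > 0" if "i \<le> n" for i using gb that by (auto simp: good_basis_def)
  \<comment> \<open>This makes \<open>R\<close> at least every norm, so the summand 1 in each factor
    of the count is absorbed, 2 C R / N + 1 \<le> 3 C R / N, and the powers of \<open>R\<close>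
    cancel.\<close>
  define Y where "Y = nat \<lceil>\<Sum>i\<le>n. ?N i\<rceil> + 1"
  define R where "R = real Y * exp q"
  have Y: "Y \<ge> 1" by (simp add: Y_def)
  have RN: "R \<ge> ?N i" if "i \<le> n" for i
  proof -
    have "?N i \<le> (\<Sum>i\<le>n. ?N i)" using that boxnorm_nonneg by (intro member_le_sum) auto
    also have "\<dots> \<le> real Y" unfolding Y_def by linarith
    also have "\<dots> \<le> R" using q by (simp add: R_def mult_le_cancel_left1)
    finally show ?thesis .
  qed
  have R: "R > 0" using Y by (simp add: R_def)
  have "R ^ (n + 1) \<le> 2 * (\<Prod>i\<le>n. 2 * (C * R / ?N i) + 1)"
    using lattice_count[OF gb C Y q] by (simp add: R_def)
  also have "(\<Prod>i\<le>n. 2 * (C * R / ?N i) + 1) \<le> (\<Prod>i\<le>n. 3 * C * R / ?N i)"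
  proof (intro prod_mono conjI)
    fix i assume "i \<in> {..n}"
    then have i: "?N i > 0" "?N i \<le> R" using N RN by auto
    then show "0 \<le> 2 * (C * R / ?N i) + 1" using C by simp
    have "?N i \<le> C * R" using i C R mult_mono[of 1 C "?N i" R] by simp
    then show "2 * (C * R / ?N i) + 1 \<le> 3 * C * R / ?N i" using i by (simp add: field_simps)
  qed
  also have "\<dots> = (3 * C * R) ^ (n + 1) / (\<Prod>i\<le>n. ?N i)" by (simp add: prod_dividef)
  finally have "R ^ (n + 1) \<le> 2 * ((3 * C) ^ (n + 1) * R ^ (n + 1) / (\<Prod>i\<le>n. ?N i))"
    by (simp only: power_mult_distrib)
  moreover have "(\<Prod>i\<le>n. ?N i) > 0" using N by (intro prod_pos) auto
  ultimately have "(\<Prod>i\<le>n. ?N i) * R ^ (n + 1) \<le> 2 * (3 * C) ^ (n + 1) * R ^ (n + 1)"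
    by (simp only: pos_le_divide_eq times_divide_eq_right mult.commute mult.left_commute mult.assoc)
  then show ?thesis using R by (simp only: mult_le_cancel_right_pos zero_less_power)
qed

section \<open>Successive minima, transference and Minkowski's inequality\<close>

definition W0 :: "(nat \<Rightarrow> real) set" where "W0 = W - {0}"

definition lam1 :: "real \<Rightarrow> real" where "lam1 q = succ_min n \<xi> q 1"

definition lamtop :: "real \<Rightarrow> real" where "lamtop q = succ_min n \<xi> q (n + 1)"

lemma succ_min_eq:
  "succ_min n \<xi> q j = Inf {lam. lam > 0 \<and> (\<exists>vs. (\<forall>k<j. vs k \<in> L \<and> boxnorm q (vs k) \<le> lam) \<and> lin_indep_fam n j vs)}"
  unfolding succ_min_def L_def in_scaled_box_iff ..

lemma succ_min_le:
  assumes "lam > 0" "\<And>k. k < j \<Longrightarrow> vs k \<in> L" "\<And>k. k < j \<Longrightarrow> boxnorm q (vs k) \<le> lam" "lin_indep_fam n j vs"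
  shows "succ_min n \<xi> q j \<le> lam"
  unfolding succ_min_eq using assms by (intro cInf_lower bdd_belowI[of _ 0]) auto

lemma succ_min_ge:
  assumes "\<exists>lam vs. lam > 0 \<and> (\<forall>k<j. vs k \<in> L \<and> boxnorm q (vs k) \<le> lam) \<and> lin_indep_fam n j vs"
    and "\<And>lam vs. lam > 0 \<Longrightarrow> (\<And>k. k < j \<Longrightarrow> vs k \<in> L) \<Longrightarrow> (\<And>k. k < j \<Longrightarrow> boxnorm q (vs k) \<le> lam)
           \<Longrightarrow> lin_indep_fam n j vs \<Longrightarrow> c \<le> lam"
  shows "c \<le> succ_min n \<xi> q j"
  unfolding succ_min_eq
proof (rule cInf_greatest)
  show "{lam. lam > 0 \<and> (\<exists>vs. (\<forall>k<j. vs k \<in> L \<and> boxnorm q (vs k) \<le> lam) \<and> lin_indep_fam n j vs)} \<noteq> {}"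
    using assms(1) by auto
qed (use assms(2) in auto)

lemma lin_indep_fam_1: "z \<in> supp \<Longrightarrow> z \<noteq> 0 \<Longrightarrow> lin_indep_fam n 1 (\<lambda>_. z)"
proof -
  assume z: "z \<in> supp" "z \<noteq> 0"
  have "0 \<in> supp" by (simp add: supp_def)
  then obtain i where "i \<le> n" "z i \<noteq> 0" using supp_eqI[of z 0] z by force
  then show ?thesis by (auto simp: lin_indep_fam_def)
qed

lemma L_nonzero_boxnorm_pos: "z \<in> L \<Longrightarrow> z \<noteq> 0 \<Longrightarrow> boxnorm q z > 0"
proof -
  assume z: "z \<in> L" "z \<noteq> 0"
  have "0 \<in> supp" by (simp add: supp_def)
  then obtain i where "i \<le> n" "z i \<noteq> 0" using supp_eqI[of z 0] z L_supp by force
  then show ?thesis using boxnorm_eq_0D[of q z i] boxnorm_nonneg[of q z] by force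
qed

lemma lam1_le: "z \<in> L \<Longrightarrow> z \<noteq> 0 \<Longrightarrow> lam1 q \<le> boxnorm q z"
  unfolding lam1_def using L_supp
  by (intro succ_min_le[where vs = "\<lambda>_. z"] lin_indep_fam_1 L_nonzero_boxnorm_pos) auto

lemma gvec_nonzero: "gvec 0 \<noteq> 0"
proof
  assume "gvec 0 = 0"
  then have "gvec 0 0 = 0" by simp
  then show False by (simp add: gvec_def lattice_pt_def)
qed

lemma lam1_pos:
  assumes "q \<ge> 0"
  shows "lam1 q > 0"
proof -
  have "exp (- (real n * q)) \<le> lam1 q"
    unfolding lam1_def
  proof (rule succ_min_ge)
    have "gvec 0 \<in> supp" using gvec_in_L L_supp by auto
    then show "\<exists>lam vs. lam > 0 \<and> (\<forall>k<1. vs k \<in> L \<and> boxnorm q (vs k) \<le> lam) \<and> lin_indep_fam n 1 vs"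
      using lin_indep_fam_1[OF _ gvec_nonzero] L_nonzero_boxnorm_pos[OF gvec_in_L gvec_nonzero, of q] gvec_in_L
      by (intro exI[of _ "boxnorm q (gvec 0)"] exI[of _ "\<lambda>_. gvec 0"]) auto
    fix lam vs assume a: "\<And>k. k < 1 \<Longrightarrow> vs k \<in> L" "\<And>k. k < 1 \<Longrightarrow> boxnorm q (vs k) \<le> lam" "lin_indep_fam n 1 vs"
    have "vs 0 \<noteq> 0"
    proof
      assume "vs 0 = 0"
      then have "\<forall>k<1. (1::real) = 0" using a(3) unfolding lin_indep_fam_def by (auto dest!: spec[of _ "\<lambda>_. 1"])
      then show False by auto
    qed
    then show "exp (- (real n * q)) \<le> lam" using boxnorm_L_ge[OF a(1)] a(2)[of 0] assms by force
  qed
  then show ?thesis by (meson exp_gt_zero less_le_trans)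
qed

lemma good_basis_lin_indep:
  assumes gb: "good_basis C q b w"
  shows "lin_indep_fam n (n + 1) b"
  unfolding lin_indep_fam_def
proof (intro allI impI)
  fix c k assume c: "\<forall>i\<le>n. (\<Sum>k<n+1. c k * b k i) = 0" and k: "k < n + 1"
  have "(\<Sum>i\<le>n. c i *\<^sub>R b i) = 0"
  proof (rule supp_eqI)
    show "(\<Sum>i\<le>n. c i *\<^sub>R b i) \<in> supp"
      using gb L_supp unfolding good_basis_def by (intro supp_sum supp_scale) auto
  qed (use c in \<open>auto simp: supp_def lessThan_Suc_atMost\<close>)
  then show "c k = 0" using gb k unfolding good_basis_def by auto
qed

lemma good_basis_dual_nonzero:
  assumes gb: "good_basis C q b w" and i: "i \<le> n"
  shows "w i \<in> W0"
proof -
  have "b i \<in> supp" using gb i L_supp by (auto simp: good_basis_def)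
  then have e: "b i = (\<Sum>j\<le>n. pair (w j) (b i) *\<^sub>R b j)" using gb unfolding good_basis_def by blast
  define k where "k j = (if j = i then 1 else 0) - pair (w j) (b i)" for j
  have "(\<Sum>j\<le>n. k j *\<^sub>R b j) = (\<Sum>j\<le>n. (if j = i then b j else 0)) - (\<Sum>j\<le>n. pair (w j) (b i) *\<^sub>R b j)"
    unfolding sum_subtractf[symmetric] by (intro sum.cong) (auto simp: k_def scaleR_left_diff_distrib)
  also have "\<dots> = 0" unfolding e[symmetric] using i by (subst sum.delta) auto
  finally have "k i = 0" using gb i unfolding good_basis_def by blast
  then have "pair (w i) (b i) = 1" by (simp add: k_def)
  then have "w i \<noteq> 0" by (auto simp: pair_def)
  then show ?thesis using gb i by (auto simp: W0_def good_basis_def)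
qed

text \<open>The longest basis vector bounds the last minimum from above, and its dual vector is
  short because reducedness controls the coordinate along it.\<close>

lemma lamtop_dual_upper:
  assumes gb: "good_basis C q b w" and q: "q \<ge> 0"
  shows "\<exists>v\<in>W0. dualnorm q v * lamtop q \<le> C"
proof -
  define M where "M = Max ((\<lambda>i. boxnorm q (b i)) ` {..n})"
  have "M \<in> (\<lambda>i. boxnorm q (b i)) ` {..n}" unfolding M_def by (rule Max_in) auto
  then obtain i where iM: "i \<le> n" "M = boxnorm q (b i)" by (metis atMost_iff imageE)
  have i: "i \<le> n" "\<And>j. j \<le> n \<Longrightarrow> boxnorm q (b j) \<le> boxnorm q (b i)"
    using iM(1) unfolding iM(2)[symmetric] M_def by (auto intro!: Max_ge)
  let ?N = "boxnorm q (b i)"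
  have N: "?N > 0" using gb i by (auto simp: good_basis_def)
  have le: "lamtop q \<le> ?N" unfolding lamtop_def
  proof (rule succ_min_le[OF N])
    show "lin_indep_fam n (n + 1) b" by (rule good_basis_lin_indep[OF gb])
  qed (use gb i in \<open>auto simp: good_basis_def\<close>)
  have bound: "\<bar>pair (w i) z\<bar> * ?N \<le> C * boxnorm q z" if "z \<in> supp" for z
    using gb i(1) that unfolding good_basis_def by blast
  \<comment> \<open>Evaluating on unit vectors gives the entries of the dual vector. They need not
    lie in \<open>L\<close>, which is why \<open>good_basis\<close> bounds coordinates on all of
    \<open>supp\<close>.\<close>
  have unit: "boxnorm q (\<lambda>l. if l = j then 1 else 0) \<le> exp (if j = 0 then - (real n * q) else q)" for j
    unfolding boxnorm_le_iff by auto
  have C: "C \<ge> 0"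
  proof -
    have "b i \<in> supp" using gb i L_supp by (auto simp: good_basis_def)
    then have "0 \<le> C * ?N" using bound[of "b i"] N by (smt (verit) abs_ge_zero mult_nonneg_nonneg)
    then show ?thesis using N by (simp add: zero_le_mult_iff)
  qed
  have bj: "\<bar>pair (w i) (\<lambda>l. if l = j then 1 else 0)\<bar> * ?N \<le> C * exp (if j = 0 then - (real n * q) else q)" if "j \<le> n" for j
    using bound[of "\<lambda>l. if l = j then 1 else 0"] mult_left_mono[OF unit[of j] C] that
    by (auto simp: supp_def)
  have "\<bar>form (w i)\<bar> * exp (real n * q) * ?N \<le> C"
    using bj[of 0] by (simp add: pair_eq exp_minus field_simps)
  moreover have "height (w i) * exp (- q) * ?N \<le> C"
  proof -
    have "height (w i) \<le> C * exp q / ?N"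
      unfolding height_le_iff
    proof
      fix j assume j: "j \<in> {1..n}"
      have "(\<Sum>l=1..n. w i l * (if l = j then 1 else 0)) = (\<Sum>l=1..n. if l = j then w i l else 0)"
        by (intro sum.cong) auto
      also have "\<dots> = w i j" using j by simp
      finally have "pair (w i) (\<lambda>l. if l = j then 1 else 0) = - w i j"
        using j by (simp add: pair_eq)
      then show "\<bar>w i j\<bar> \<le> C * exp q / ?N" using bj[of j] j N by (simp add: field_simps)
    qed
    then show ?thesis using N by (simp add: exp_minus field_simps)
  qed
  ultimately have "dualnorm q (w i) * ?N \<le> C" by (simp add: dualnorm_def max_def)
  moreover have "dualnorm q (w i) * lamtop q \<le> dualnorm q (w i) * ?N"
    by (intro mult_left_mono le dualnorm_nonneg)
  ultimately show ?thesis using good_basis_dual_nonzero[OF gb i(1)] by (intro bexI[of _ "w i"]) auto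
qed

lemma W_eqI: "v \<in> W \<Longrightarrow> (\<And>j. j \<le> n \<Longrightarrow> v j = 0) \<Longrightarrow> v = 0"
  by (rule supp_eqI) (auto simp: W_def supp_def)

text \<open>Among n + 1 independent lattice vectors one pairs with \<open>v\<close> to a non-zero
  integer. The basis \<open>b\<close> supplies one such family, so that the infimum defining the
  minimum is over a non-empty set.\<close>

lemma lamtop_dual_lower:
  assumes v: "v \<in> W0" and gb: "good_basis C q b w"
  shows "1 \<le> (real n + 1) * dualnorm q v * lamtop q"
proof -
  have key: "1 \<le> (real n + 1) * dualnorm q v * lam"
    if vs: "\<And>k. k < n + 1 \<Longrightarrow> vs k \<in> L" "\<And>k. k < n + 1 \<Longrightarrow> boxnorm q (vs k) \<le> lam" "lin_indep_fam n (n + 1) vs" for lam vs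
  proof -
    have "\<exists>k<n+1. pair v (vs k) \<noteq> 0"
    proof (rule ccontr)
      assume "\<not> ?thesis"
      then have zero: "pair v (vs k) = 0" if "k \<le> n" for k using that by auto
      have "v j = 0" if j: "j \<le> n" for j
      proof -
        \<comment> \<open>Adjoining \<open>gvec j\<close> makes n + 2 vectors in dimension n + 1.
          The resulting relation expresses \<open>gvec j\<close> by the family, and pairing it with
          \<open>v\<close> gives \<open>v j = 0\<close>.\<close>
        define u where "u = vs(Suc n := gvec j)"
        have "u i \<in> supp" if "i \<le> Suc n" for i
          using that vs(1) gvec_in_L L_supp by (cases "i = Suc n") (auto simp: u_def)
        then obtain c where c: "\<exists>i\<le>Suc n. c i \<noteq> 0" "(\<Sum>i\<le>Suc n. c i *\<^sub>R u i) = 0"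
          using exists_supp_relation[of u] by blast
        have s: "(\<Sum>i\<le>n. c i *\<^sub>R u i) = (\<Sum>i\<le>n. c i *\<^sub>R vs i)" by (intro sum.cong) (auto simp: u_def)
        have eq: "(\<Sum>i\<le>n. c i *\<^sub>R vs i) + c (Suc n) *\<^sub>R gvec j = 0"
          using c(2) by (simp only: sum.atMost_Suc s) (simp add: u_def)
        have "c (Suc n) \<noteq> 0"
        proof
          assume 0: "c (Suc n) = 0"
          have "(\<Sum>k<n+1. c k * vs k i) = 0" for i
            using fun_cong[OF eq, of i] 0 by (simp add: lessThan_Suc_atMost)
          then have "\<forall>k<n+1. c k = 0" using vs(3) unfolding lin_indep_fam_def by blast
          then show False using c(1) 0 by (auto simp: le_Suc_eq)
        qed
        moreover have "pair v (\<Sum>i\<le>n. c i *\<^sub>R vs i) = 0" unfolding pair_sum using zero by (intro sum.neutral) auto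
        then have "c (Suc n) * v j = 0"
          using arg_cong[OF eq, of "pair v"] j by (simp only: pair_add pair_scale pair_gvec pair_zero)
        ultimately show ?thesis by simp
      qed
      then show False using v W_eqI by (auto simp: W0_def)
    qed
    then obtain k where k: "k < n + 1" "pair v (vs k) \<noteq> 0" by blast
    have "v \<in> W" using v by (simp add: W0_def)
    then have "1 \<le> \<bar>pair v (vs k)\<bar>" using pair_Ints[OF _ vs(1)[OF k(1)]] k(2) by (intro Ints_nonzero_abs_ge1) auto
    also have "\<dots> \<le> (real n + 1) * dualnorm q v * boxnorm q (vs k)" by (rule abs_pair_le)
    also have "\<dots> \<le> (real n + 1) * dualnorm q v * lam"
      using vs(2)[OF k(1)] dualnorm_nonneg by (intro mult_left_mono) auto
    finally show ?thesis .
  qed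
  define M where "M = (\<Sum>i\<le>n. boxnorm q (b i))"
  have bM: "boxnorm q (b k) \<le> M" if "k < n + 1" for k
    unfolding M_def using that boxnorm_nonneg by (intro member_le_sum) auto
  have ind: "lin_indep_fam n (n + 1) b" by (rule good_basis_lin_indep[OF gb])
  have bL: "b k \<in> L" "boxnorm q (b k) > 0" if "k < n + 1" for k using gb that by (auto simp: good_basis_def)
  have M: "M > 0" using bL(2)[of 0] bM[of 0] by simp
  have d: "dualnorm q v > 0"
    using key[OF bL(1) bM ind] dualnorm_nonneg[of q v] by (cases "dualnorm q v = 0") auto
  have "1 / ((real n + 1) * dualnorm q v) \<le> lamtop q"
    unfolding lamtop_def
  proof (rule succ_min_ge)
    show "\<exists>lam vs. lam > 0 \<and> (\<forall>k<n + 1. vs k \<in> L \<and> boxnorm q (vs k) \<le> lam) \<and> lin_indep_fam n (n + 1) vs"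
      using M ind bL bM by blast
    fix lam vs assume "\<And>k. k < n + 1 \<Longrightarrow> vs k \<in> L" "\<And>k. k < n + 1 \<Longrightarrow> boxnorm q (vs k) \<le> lam" "lin_indep_fam n (n + 1) vs"
    from key[OF this] show "1 / ((real n + 1) * dualnorm q v) \<le> lam"
      using d by (simp add: divide_le_eq mult.commute)
  qed
  then show ?thesis using d by (simp add: divide_le_eq mult.commute)
qed

lemma good_basis_pair_nonzero:
  assumes gb: "good_basis C q b w" and v: "v \<in> supp" and z: "\<And>l. l \<le> n \<Longrightarrow> pair v (b l) = 0"
  shows "v = 0"
proof (rule supp_eqI[OF v])
  show "0 \<in> supp" by (simp add: supp_def)
  fix j assume j: "j \<le> n"
  have "gvec j \<in> supp" using gvec_in_L L_supp by auto
  then have "gvec j = (\<Sum>i\<le>n. pair (w i) (gvec j) *\<^sub>R b i)" using gb unfolding good_basis_def by blast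
  then have "pair v (gvec j) = (\<Sum>i\<le>n. pair (w i) (gvec j) * pair v (b i))" by (metis pair_sum)
  also have "\<dots> = 0" using z by (intro sum.neutral) auto
  finally show "v j = 0 j" using j by (simp add: pair_gvec)
qed

text \<open>Independence of the forms yields distinct basis vectors \<open>b (l j)\<close>, each paired non-trivially with
  one of \<open>v 0, \<dots>, v j\<close>; integrality of the pairing bounds their norms from below, and the remaining
  basis vectors are bounded by the first minimum.\<close>

lemma dual_prod_lower:
  fixes k :: nat
  assumes gb: "good_basis C q b w" and C: "C \<ge> 1" and q: "q \<ge> 0"
    and v: "\<And>i. i < k \<Longrightarrow> v i \<in> W"
    and ind: "\<And>c. (\<Sum>i<k. c i *\<^sub>R v i) = 0 \<Longrightarrow> \<forall>i<k. c i = 0"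
    and sorted: "\<And>i j. i \<le> j \<Longrightarrow> j < k \<Longrightarrow> dualnorm q (v i) \<le> dualnorm q (v j)"
    and k: "k \<le> n + 1"
  shows "lam1 q ^ (n + 1 - k) \<le> 2 * (3 * C) ^ (n + 1) * (real n + 1) ^ k * (\<Prod>j<k. dualnorm q (v j))"
proof -
  let ?N = "\<lambda>l. boxnorm q (b l)"
  define A where "A j = {l \<in> {..n}. \<exists>i\<le>j. pair (v i) (b l) \<noteq> 0}" for j
  have finA: "finite (A j)" for j by (simp add: A_def)
  \<comment> \<open>Otherwise elimination gives a non-trivial combination of
    \<open>v 0, ..., v j\<close> that pairs to zero with every basis vector; it must vanish, against
    independence.\<close>
  have cardA: "card (A j) > j" if j: "j < k" for j
  proof (rule ccontr)
    assume "\<not> ?thesis"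
    then have "card (A j) < card {..j}" by simp
    then obtain c where c: "\<exists>i\<in>{..j}. c i \<noteq> 0" "\<forall>l\<in>A j. (\<Sum>i\<in>{..j}. c i * pair (v i) (b l)) = 0"
      using exists_linear_relation[of "A j" "{..j}" "\<lambda>i l. pair (v i) (b l)"] finA by auto
    have "pair (\<Sum>i\<le>j. c i *\<^sub>R v i) (b l) = 0" if "l \<le> n" for l
    proof (cases "l \<in> A j")
      case True
      then show ?thesis using c(2) by (simp only: pair_sum_left)
    next
      case False
      then show ?thesis unfolding pair_sum_left using \<open>l \<le> n\<close> by (intro sum.neutral) (auto simp: A_def)
    qed
    moreover have "(\<Sum>i\<le>j. c i *\<^sub>R v i) \<in> supp"
      using v j by (intro supp_sum supp_scale) (auto simp: W_def)
    ultimately have zero: "(\<Sum>i\<le>j. c i *\<^sub>R v i) = 0" using good_basis_pair_nonzero[OF gb] by blast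
    define c' where "c' i = (if i \<le> j then c i else 0)" for i
    have "(\<Sum>i<k. c' i *\<^sub>R v i) = (\<Sum>i\<le>j. c i *\<^sub>R v i)"
      by (rule sum.mono_neutral_cong_right) (use j in \<open>auto simp: c'_def\<close>)
    then have "\<forall>i<k. c' i = 0" using zero ind by presburger
    then have "c i = 0" if "i \<le> j" for i using that j by (metis c'_def le_less_trans)
    then show False using c(1) by auto
  qed
  \<comment> \<open>A greedy choice suffices: \<open>A j\<close> has more than \<open>j\<close>
    elements and only \<open>j\<close> of them can be taken.\<close>
  have "\<exists>l. inj_on l {..<j} \<and> (\<forall>i<j. l i \<in> A i)" if "j \<le> k" for j
    using that
  proof (induction j)
    case (Suc j)
    then obtain l where l: "inj_on l {..<j}" "\<forall>i<j. l i \<in> A i" by auto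
    have "card (l ` {..<j}) \<le> j" using card_image_le[of "{..<j}" l] by simp
    then have "\<not> A j \<subseteq> l ` {..<j}" using cardA[of j] Suc.prems card_mono[of "l ` {..<j}" "A j"] by auto
    then obtain x where x: "x \<in> A j" "x \<notin> l ` {..<j}" by blast
    have "inj_on (l(j := x)) {..<Suc j}"
      using l(1) x(2) by (auto simp: lessThan_Suc inj_on_def)
    moreover have "\<forall>i<Suc j. (l(j := x)) i \<in> A i" using l(2) x(1) by (auto simp: less_Suc_eq)
    ultimately show ?case by blast
  qed auto
  then obtain l where l: "inj_on l {..<k}" "\<forall>i<k. l i \<in> A i" by blast
  have one: "1 \<le> (real n + 1) * dualnorm q (v j) * ?N (l j)" if j: "j < k" for j
  proof -
    obtain i where i: "i \<le> j" "pair (v i) (b (l j)) \<noteq> 0" "l j \<le> n" using l(2) j by (auto simp: A_def)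
    have "v i \<in> W" using v i j by auto
    moreover have "b (l j) \<in> L" using gb i by (auto simp: good_basis_def)
    ultimately have "1 \<le> \<bar>pair (v i) (b (l j))\<bar>" using pair_Ints i(2) by (intro Ints_nonzero_abs_ge1) auto
    also have "\<dots> \<le> (real n + 1) * dualnorm q (v i) * ?N (l j)" by (rule abs_pair_le)
    \<comment> \<open>\<open>b (l j)\<close> may pair with an earlier \<open>v i\<close> only; the
      ordering of the gauges allows \<open>v j\<close> instead, so that each gauge occurs once in
      the product.\<close>
    also have "\<dots> \<le> (real n + 1) * dualnorm q (v j) * ?N (l j)"
      using sorted[OF i(1) j] boxnorm_nonneg by (intro mult_right_mono mult_left_mono) auto
    finally show ?thesis .
  qed
  define S where "S = l ` {..<k}"
  have S: "S \<subseteq> {..n}" "card S = k" using l by (auto simp: S_def A_def card_image)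
  have "lam1 q ^ (n + 1 - k) = (\<Prod>i\<in>{..n} - S. lam1 q)"
    using S by (simp add: card_Diff_subset finite_subset)
  also have "\<dots> \<le> (\<Prod>i\<in>{..n} - S. ?N i)"
  proof (intro prod_mono conjI)
    fix i assume "i \<in> {..n} - S"
    then have i: "b i \<in> L" "?N i > 0" using gb by (auto simp: good_basis_def)
    then have "b i \<noteq> 0" using seminorm_zero[OF seminorm_boxnorm, of q] by force
    then show "lam1 q \<le> ?N i" using lam1_le i by blast
  qed (use lam1_pos[OF q] in auto)
  finally have 1: "lam1 q ^ (n + 1 - k) \<le> (\<Prod>i\<in>{..n} - S. ?N i)" .
  have "1 \<le> (\<Prod>j<k. (real n + 1) * dualnorm q (v j) * ?N (l j))" using one by (intro prod_ge_1) auto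
  also have "\<dots> = (real n + 1) ^ k * (\<Prod>j<k. dualnorm q (v j)) * (\<Prod>i\<in>S. ?N i)"
    unfolding S_def using l(1) by (simp add: prod.distrib prod.reindex)
  finally have 2: "1 \<le> (real n + 1) ^ k * (\<Prod>j<k. dualnorm q (v j)) * (\<Prod>i\<in>S. ?N i)" .
  let ?P = "(real n + 1) ^ k * (\<Prod>j<k. dualnorm q (v j))"
  have P: "?P \<ge> 0" using dualnorm_nonneg by (intro mult_nonneg_nonneg prod_nonneg) auto
  have "(\<Prod>i\<in>{..n} - S. ?N i) \<ge> 0" using boxnorm_nonneg by (intro prod_nonneg) auto
  then have "(\<Prod>i\<in>{..n} - S. ?N i) * 1 \<le> (\<Prod>i\<in>{..n} - S. ?N i) * (?P * (\<Prod>i\<in>S. ?N i))"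
    using 2 by (intro mult_left_mono) auto
  also have "\<dots> = ?P * ((\<Prod>i\<in>{..n} - S. ?N i) * (\<Prod>i\<in>S. ?N i))" by (simp only: mult_ac)
  also have "(\<Prod>i\<in>{..n} - S. ?N i) * (\<Prod>i\<in>S. ?N i) = (\<Prod>i\<le>n. ?N i)"
    using prod.subset_diff[OF S(1), of ?N] by simp
  also have "?P * (\<Prod>i\<le>n. ?N i) \<le> ?P * (2 * (3 * C) ^ (n + 1))"
    by (intro mult_left_mono good_basis_prod_le[OF gb C q] P)
  finally show ?thesis using 1 by (simp add: mult_ac)
qed

section \<open>Small values of the linear form and finiteness\<close>

lemma Dirichlet_linear_form:
  assumes q: "q \<ge> 0"
  shows "\<exists>v\<in>W0. dualnorm q v \<le> 2"
proof -
  define Y where "Y = nat \<lceil>exp q\<rceil>"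
  have Yq: "exp q \<le> real Y" "real Y \<le> 2 * exp q"
  proof -
    show "exp q \<le> real Y" unfolding Y_def by linarith
    have "exp q \<ge> 1" using q by simp
    then show "real Y \<le> 2 * exp q" unfolding Y_def by linarith
  qed
  have Y: "Y \<ge> 1"
  proof -
    have "real Y > 0" by (rule less_le_trans[OF exp_gt_zero Yq(1)])
    then show ?thesis by simp
  qed
  define D where "D = PiE {1..n} (\<lambda>_. {0..int Y})"
  define s where "s k = (\<Sum>i=1..n. real_of_int (k i) * \<xi> i)" for k :: "nat \<Rightarrow> int"
  define g where "g k = nat \<lfloor>frac (s k) * real (Y ^ n)\<rfloor>" for k
  have gr: "g ` D \<subseteq> {..<Y ^ n}"
  proof
    fix x assume "x \<in> g ` D"
    then obtain k where x: "x = g k" by auto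
    have "frac (s k) * real (Y ^ n) < 1 * real (Y ^ n)"
      using Y by (intro mult_strict_right_mono frac_lt_1) auto
    moreover have "frac (s k) * real (Y ^ n) \<ge> 0" by simp
    ultimately show "x \<in> {..<Y ^ n}" unfolding x g_def by (simp add: nat_less_iff floor_less_iff)
  qed
  have "card (g ` D) < card D"
  proof -
    have "card (g ` D) \<le> Y ^ n" using card_mono[OF _ gr] by simp
    \<comment> \<open>Each coefficient takes Y + 1 values, while the fractional parts fall into Y^n
      cells, so two coefficient vectors share a cell.\<close>
    also have "\<dots> < (Y + 1) ^ n" using n_pos by (intro power_strict_mono) auto
    also have "\<dots> = card D" by (simp add: D_def card_PiE nat_add_distrib)
    finally show ?thesis .
  qed
  then have "\<not> inj_on g D" by (intro pigeonhole) auto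
  then obtain k k' where k: "k \<in> D" "k' \<in> D" "k \<noteq> k'" "g k = g k'" by (auto simp: inj_on_def)
  define v :: "nat \<Rightarrow> real" where
    "v i = (if i = 0 then real_of_int (\<lfloor>s k'\<rfloor> - \<lfloor>s k\<rfloor>) else if i \<le> n then real_of_int (k i - k' i) else 0)" for i
  have vW: "v \<in> W" by (auto simp: v_def W_def supp_def)
  have "v \<noteq> 0"
  proof
    assume "v = 0"
    then have "v i = 0" for i by simp
    then have "k i = k' i" if "i \<in> {1..n}" for i
      using v_def[of i] that by auto
    then have "k = k'" using k(1,2) unfolding D_def by (intro PiE_ext[of k "{1..n}" _ k']) auto
    then show False using k(3) by simp
  qed
  have f: "form v = frac (s k) - frac (s k')"
  proof -
    have "(\<Sum>i=1..n. v i * \<xi> i) = (\<Sum>i=1..n. real_of_int (k i) * \<xi> i - real_of_int (k' i) * \<xi> i)"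
      by (intro sum.cong) (auto simp: v_def algebra_simps)
    then show ?thesis by (simp add: form_def s_def sum_subtractf frac_def v_def)
  qed
  have Yn: "real (Y ^ n) > 0" using Y by simp
  have "\<bar>frac (s k) * real (Y ^ n) - frac (s k') * real (Y ^ n)\<bar> \<le> 1"
  proof -
    have "\<lfloor>frac (s k) * real (Y ^ n)\<rfloor> = \<lfloor>frac (s k') * real (Y ^ n)\<rfloor>"
      using k(4) unfolding g_def by (subst (asm) nat_eq_iff2) (auto simp: le_nat_iff)
    then show ?thesis by linarith
  qed
  then have "\<bar>form v\<bar> * real (Y ^ n) \<le> 1"
    using Yn by (simp add: f abs_mult_pos left_diff_distrib[symmetric] del: of_nat_power)
  moreover have "exp (real n * q) \<le> real (Y ^ n)"
    using Yq(1) power_mono[of "exp q" "real Y" n] by (simp add: exp_of_nat_mult)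
  ultimately have "\<bar>form v\<bar> * exp (real n * q) \<le> 1"
    by (meson abs_ge_zero mult_left_mono order_trans)
  moreover have "height v * exp (- q) \<le> 2"
  proof -
    have "height v \<le> real Y" unfolding height_le_iff
    proof
      fix i assume i: "i \<in> {1..n}"
      then have "k i \<in> {0..int Y}" "k' i \<in> {0..int Y}" using k(1,2) by (auto simp: D_def)
      then have "\<bar>k i - k' i\<bar> \<le> int Y" by auto
      then show "\<bar>v i\<bar> \<le> real Y" using i by (simp add: v_def)
    qed
    then have "height v \<le> 2 * exp q" using Yq(2) by linarith
    then show ?thesis by (simp add: exp_minus field_simps)
  qed
  ultimately have "dualnorm q v \<le> 2" by (simp add: dualnorm_def)
  then show ?thesis using vW \<open>v \<noteq> 0\<close> by (auto simp: W0_def)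
qed

lemma form_nonzero:
  assumes "v \<in> W0"
  shows "form v \<noteq> 0"
proof
  assume 0: "form v = 0"
  have v: "v \<in> W" "v \<noteq> 0" using assms by (auto simp: W0_def)
  define a :: "nat \<Rightarrow> rat" where "a i = of_int \<lfloor>v i\<rfloor>" for i
  have a: "of_rat (a i) = v i" for i
  proof -
    have "v i \<in> \<int>" using v by (auto simp: W_def)
    then show ?thesis unfolding a_def by (metis of_rat_of_int_eq floor_of_int Ints_cases)
  qed
  have "of_rat (a 0) + (\<Sum>i=1..n. of_rat (a i) * \<xi> i) = 0" using 0 by (simp add: a form_def)
  then have "a 0 = 0 \<and> (\<forall>i\<in>{1..n}. a i = 0)" using indep unfolding Q_lin_indep_def by blast
  then have "v j = 0" if "j \<le> n" for j using a[of j] that by (cases "j = 0") auto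
  then show False using W_eqI v by blast
qed

text \<open>A height below 1 kills every coordinate except the integer \<open>v 0\<close>, which is
  then the value of the form.\<close>

lemma height_ge_1:
  assumes "v \<in> W0" "\<bar>form v\<bar> < 1"
  shows "height v \<ge> 1"
proof (rule ccontr)
  assume h: "\<not> height v \<ge> 1"
  have v: "v \<in> W" "v \<noteq> 0" using assms by (auto simp: W0_def)
  have z: "v i = 0" if "i \<in> {1..n}" for i
  proof (rule ccontr)
    assume "v i \<noteq> 0"
    moreover have "v i \<in> \<int>" using v by (auto simp: W_def)
    ultimately have "1 \<le> \<bar>v i\<bar>" by (intro Ints_nonzero_abs_ge1)
    then show False using h height_ge[OF that, of v] by linarith
  qed
  then have "form v = v 0" by (simp add: form_def)
  moreover have "v 0 \<in> \<int>" using v by (auto simp: W_def)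
  ultimately have "v 0 = 0" using assms(2) Ints_nonzero_abs_ge1 by force
  then have "v j = 0" if "j \<le> n" for j using z that by (cases "j = 0") auto
  then show False using W_eqI v by blast
qed

text \<open>The height does not see \<open>v 0\<close>; the bound on the form recovers it.\<close>

lemma finite_W_bounded: "finite {v \<in> W. height v \<le> h \<and> \<bar>form v\<bar> \<le> M}"
proof (rule finite_subset[OF _ finite_bounded_Ints_supp[of "\<bar>h\<bar> + \<bar>M\<bar> + (\<Sum>i=1..n. \<bar>h\<bar> * \<bar>\<xi> i\<bar>)"]], safe, goal_cases)
  case (3 v i)
  have s0: "(\<Sum>i=1..n. \<bar>h\<bar> * \<bar>\<xi> i\<bar>) \<ge> 0" by (intro sum_nonneg) auto
  have vi: "\<bar>v i\<bar> \<le> \<bar>h\<bar>" if "i \<in> {1..n}" for i using height_ge[OF that, of v] 3 by linarith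
  show ?case
  proof (cases "i = 0")
    case True
    have "\<bar>\<Sum>i=1..n. v i * \<xi> i\<bar> \<le> (\<Sum>i=1..n. \<bar>v i * \<xi> i\<bar>)" by (rule sum_abs)
    also have "\<dots> \<le> (\<Sum>i=1..n. \<bar>h\<bar> * \<bar>\<xi> i\<bar>)"
      by (intro sum_mono) (auto simp: abs_mult intro!: mult_right_mono vi)
    finally have "\<bar>\<Sum>i=1..n. v i * \<xi> i\<bar> \<le> (\<Sum>i=1..n. \<bar>h\<bar> * \<bar>\<xi> i\<bar>)" .
    then show ?thesis using 3(3)[unfolded form_def] \<open>i = 0\<close> by (simp only:)
  next
    case False
    then show ?thesis using vi[of i] 3 s0 by auto
  qed
qed (auto simp: W_def)

section \<open>Minimal points of the linear form\<close>

lemma W0_W: "v \<in> W0 \<Longrightarrow> v \<in> W" by (simp add: W0_def)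

lemma abs_form_pos: "v \<in> W0 \<Longrightarrow> \<bar>form v\<bar> > 0"
  using form_nonzero by simp

lemma W_comb: "x \<in> W \<Longrightarrow> y \<in> W \<Longrightarrow> z \<in> W \<Longrightarrow>
  x - real_of_int k *\<^sub>R y - real_of_int l *\<^sub>R z \<in> W"
  by (intro additive_subgroup_diff[OF additive_subgroup_W] additive_subgroup_scale_int[OF additive_subgroup_W])

text \<open>The bound \<open>M\<close> on the form leaves only finitely many competitors of height
  at most that of \<open>w\<close>.\<close>

lemma minimal_height_exists:
  assumes w: "w \<in> W0" "P w" and M: "\<And>v. v \<in> W0 \<Longrightarrow> P v \<Longrightarrow> \<bar>form v\<bar> \<le> M"
  obtains v where "v \<in> W0" "P v" "\<And>v'. v' \<in> W0 \<Longrightarrow> P v' \<Longrightarrow> height v \<le> height v'"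
proof -
  define S where "S = {v \<in> W0. P v \<and> height v \<le> height w}"
  have "finite S"
    by (rule finite_subset[OF _ finite_W_bounded[of "height w" M]]) (auto simp: S_def W0_W M)
  moreover have "S \<noteq> {}" using w by (auto simp: S_def)
  ultimately have a: "arg_min_on height S \<in> S" "\<And>v. v \<in> S \<Longrightarrow> height (arg_min_on height S) \<le> height v"
    using arg_min_if_finite(1)[of S height] arg_min_least[of S _ height] by auto
  show thesis
  proof (rule that[of "arg_min_on height S"])
    fix v' assume "v' \<in> W0" "P v'"
    then show "height (arg_min_on height S) \<le> height v'"
      using a(2)[of v'] a(1) by (cases "height v' \<le> height w") (auto simp: S_def)
  qed (use a(1) in \<open>auto simp: S_def\<close>)
qed

lemma minimal_form_exists:
  assumes w: "w \<in> W0" "height w \<le> h"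
  obtains u where "u \<in> W0" "height u \<le> h" "\<And>v. v \<in> W0 \<Longrightarrow> height v \<le> h \<Longrightarrow> \<bar>form u\<bar> \<le> \<bar>form v\<bar>"
proof -
  define S where "S = {v \<in> W0. height v \<le> h \<and> \<bar>form v\<bar> \<le> \<bar>form w\<bar>}"
  let ?f = "\<lambda>v. \<bar>form v\<bar>"
  have "finite S"
    by (rule finite_subset[OF _ finite_W_bounded[of h "\<bar>form w\<bar>"]]) (auto simp: S_def W0_W)
  moreover have "S \<noteq> {}" using w by (auto simp: S_def)
  ultimately have a: "arg_min_on ?f S \<in> S" "\<And>v. v \<in> S \<Longrightarrow> ?f (arg_min_on ?f S) \<le> ?f v"
    using arg_min_if_finite(1)[of S ?f] arg_min_least[of S _ ?f] by auto
  show thesis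
  proof (rule that[of "arg_min_on ?f S"])
    fix v assume "v \<in> W0" "height v \<le> h"
    then show "?f (arg_min_on ?f S) \<le> ?f v"
      using a(2)[of v] a(1) by (cases "?f v \<le> ?f w") (auto simp: S_def)
  qed (use a(1) in \<open>auto simp: S_def\<close>)
qed

lemma small_form_exists:
  assumes "\<delta> > 0"
  obtains v where "v \<in> W0" "\<bar>form v\<bar> < \<delta>"
proof -
  \<comment> \<open>The numerator 3 beats Dirichlet's bound 2, which makes the inequality for the
    form strict.\<close>
  define q where "q = max 0 (ln (3 / \<delta>))"
  obtain v where v: "v \<in> W0" "dualnorm q v \<le> 2" using Dirichlet_linear_form[of q] by (auto simp: q_def)
  have "3 / \<delta> = exp (ln (3 / \<delta>))" using assms by simp
  also have "\<dots> \<le> exp q" by (simp add: q_def)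
  also have "\<dots> \<le> exp (real n * q)"
    using n_pos mult_right_mono[of 1 "real n" q] by (simp add: q_def)
  finally have "3 / \<delta> \<le> exp (real n * q)" .
  then have "\<bar>form v\<bar> * (3 / \<delta>) \<le> \<bar>form v\<bar> * exp (real n * q)" by (intro mult_left_mono) auto
  also have "\<dots> \<le> 2" using v(2) by (simp add: dualnorm_def)
  finally have "\<bar>form v\<bar> < \<delta>" using assms by (simp add: field_simps)
  with v(1) show thesis by (rule that)
qed

lemma next_minimal_exists:
  assumes "\<delta> > 0"
  obtains v where "v \<in> W0" "\<bar>form v\<bar> < \<delta>" "\<And>v'. v' \<in> W0 \<Longrightarrow> \<bar>form v'\<bar> < \<delta> \<Longrightarrow> height v \<le> height v'"
proof -
  obtain w where "w \<in> W0" "\<bar>form w\<bar> < \<delta>" using small_form_exists[OF assms] .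
  then show thesis using minimal_height_exists[of w "\<lambda>v. \<bar>form v\<bar> < \<delta>" \<delta>] that by (metis less_imp_le)
qed

text \<open>Valley estimate. For consecutive minimal points, \<delta> is the form of the first and
  \<open>h\<close> the height of the second; \<open>c\<close> is the time with h exp (- c) =
  \<delta> exp (n c), when the second takes over. No vector of \<open>W0\<close> has a smaller gauge
  there, and \<open>ev\<close> compares this gauge with the lower exponent \<open>s\<close>.\<close>

lemma crossing_bound:
  assumes ev: "\<And>q. q \<ge> q0 \<Longrightarrow> \<exists>v\<in>W0. dualnorm q v \<le> exp (- (s * q))"
    and h: "h > 0" and d: "\<delta> > 0"
    and min: "\<And>v. v \<in> W0 \<Longrightarrow> \<bar>form v\<bar> \<ge> \<delta> \<or> height v \<ge> h"
    and c: "(ln h - ln \<delta>) / (real n + 1) \<ge> q0"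
  shows "(real n + s) * ln h \<le> (1 - s) * (- ln \<delta>)"
proof -
  define c where "c = (ln h - ln \<delta>) / (real n + 1)"
  have c': "(real n + 1) * c = ln h - ln \<delta>" by (simp add: c_def)
  obtain v where v: "v \<in> W0" "dualnorm c v \<le> exp (- (s * c))" using ev[of c] c unfolding c_def by blast
  have e1: "h * exp (- c) = exp (ln h - c)" using h by (simp add: exp_diff exp_minus field_simps)
  have e2: "\<delta> * exp (real n * c) = exp (ln h - c)"
  proof -
    have "ln \<delta> + real n * c = ln h - c" using c' by (simp add: algebra_simps)
    then show ?thesis using d by (metis exp_add exp_ln)
  qed
  have "exp (ln h - c) \<le> dualnorm c v"
    using min[OF v(1)]
  proof
    assume "\<delta> \<le> \<bar>form v\<bar>"
    then have "\<delta> * exp (real n * c) \<le> \<bar>form v\<bar> * exp (real n * c)" by (intro mult_right_mono) auto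
    then show ?thesis unfolding e2 by (simp add: dualnorm_def)
  next
    assume "h \<le> height v"
    then have "h * exp (- c) \<le> height v * exp (- c)" by (intro mult_right_mono) auto
    then show ?thesis unfolding e1 by (simp add: dualnorm_def)
  qed
  then have "exp (ln h - c) \<le> exp (- (s * c))" using v(2) by linarith
  then have "ln h \<le> (1 - s) * c" by (simp add: algebra_simps)
  then have "(real n + 1) * ln h \<le> (real n + 1) * ((1 - s) * c)" by (intro mult_left_mono) auto
  also have "\<dots> = (1 - s) * (ln h - ln \<delta>)" unfolding c'[symmetric] by (simp add: algebra_simps)
  finally show ?thesis by (simp add: algebra_simps)
qed

text \<open>Peak estimate. At the time \<open>c\<close> the two terms of \<open>dualnorm\<close> of
  \<open>v\<close> agree and the gauge of \<open>v\<close> is least; the upper exponent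
  \<open>s\<close> applies there.\<close>

lemma peak_bound:
  assumes ev: "\<And>q v. q \<ge> q0 \<Longrightarrow> v \<in> W0 \<Longrightarrow> exp (- (s * q)) \<le> dualnorm q v"
    and v: "v \<in> W0" and h: "height v > 0"
    and c: "(ln (height v) - ln \<bar>form v\<bar>) / (real n + 1) \<ge> q0"
  shows "(1 - s) * (- ln \<bar>form v\<bar>) \<le> (real n + s) * ln (height v)"
proof -
  define c where "c = (ln (height v) - ln \<bar>form v\<bar>) / (real n + 1)"
  have c': "(real n + 1) * c = ln (height v) - ln \<bar>form v\<bar>" by (simp add: c_def)
  have e1: "height v * exp (- c) = exp (ln (height v) - c)" using h by (simp add: exp_diff exp_minus field_simps)
  have e2: "\<bar>form v\<bar> * exp (real n * c) = exp (ln (height v) - c)"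
  proof -
    have "ln \<bar>form v\<bar> + real n * c = ln (height v) - c" using c' by (simp add: algebra_simps)
    then show ?thesis using abs_form_pos[OF v] by (metis exp_add exp_ln)
  qed
  have "exp (- (s * c)) \<le> exp (ln (height v) - c)"
    using ev[OF _ v, of c] c unfolding dualnorm_def e1 e2 by (simp add: c_def)
  then have "(1 - s) * c \<le> ln (height v)" by (simp add: algebra_simps)
  then have "(real n + 1) * ((1 - s) * c) \<le> (real n + 1) * ln (height v)" by (intro mult_left_mono) auto
  moreover have "(real n + 1) * ((1 - s) * c) = (1 - s) * (ln (height v) - ln \<bar>form v\<bar>)"
    unfolding c'[symmetric] by (simp add: algebra_simps)
  ultimately show ?thesis by (simp add: algebra_simps)
qed

section \<open>Planes spanned by consecutive minimal points\<close>

lemma consecutive_independent: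
  assumes v: "v0 \<in> W0" "v1 \<in> W0" and f: "\<bar>form v1\<bar> < \<bar>form v0\<bar>"
    and h: "height v0 \<le> height v1" "height v0 > 0"
    and z: "\<alpha> *\<^sub>R v0 + \<beta> *\<^sub>R v1 = 0"
  shows "\<alpha> = 0 \<and> \<beta> = 0"
proof -
  have eq: "\<beta> *\<^sub>R v1 = (- \<alpha>) *\<^sub>R v0" using z by (simp add: eq_neg_iff_add_eq_0 add.commute)
  have F: "\<bar>\<beta>\<bar> * \<bar>form v1\<bar> = \<bar>\<alpha>\<bar> * \<bar>form v0\<bar>"
    using arg_cong[OF eq, of "\<lambda>x. \<bar>form x\<bar>"] by (simp only: form_scale abs_mult abs_minus_cancel)
  have H: "\<bar>\<beta>\<bar> * height v1 = \<bar>\<alpha>\<bar> * height v0"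
    using arg_cong[OF eq, of height] by (simp only: seminorm_scale[OF seminorm_height] abs_minus_cancel)
  \<comment> \<open>Proportional vectors have forms and heights in the same ratio, but from
    \<open>v0\<close> to \<open>v1\<close> the form drops strictly and the height does not.\<close>
  have b: "\<beta> = 0"
  proof (rule ccontr)
    assume "\<beta> \<noteq> 0"
    then have "\<bar>\<alpha>\<bar> * \<bar>form v0\<bar> < \<bar>\<beta>\<bar> * \<bar>form v0\<bar>" unfolding F[symmetric] using f by simp
    then have "\<bar>\<alpha>\<bar> < \<bar>\<beta>\<bar>" using mult_less_cancel_right abs_ge_zero not_le by metis
    then have "\<bar>\<alpha>\<bar> * height v0 < \<bar>\<beta>\<bar> * height v0" using h by simp
    also have "\<dots> \<le> \<bar>\<beta>\<bar> * height v1" using h by (intro mult_left_mono) auto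
    finally show False using H by simp
  qed
  then have "\<alpha> = 0" using F abs_form_pos[OF v(1)] by simp
  with b show ?thesis by simp
qed

text \<open>Rounding the coordinates leaves a remainder whose form is below that of
  \<open>v0\<close>. If non-zero, it is at least as high as \<open>v1\<close>, and this forces both
  fractional parts to be 1/2 in absolute value. That case is kept, hence the doubling.\<close>

lemma half_integral_coordinates:
  assumes v: "v0 \<in> W0" "v1 \<in> W0" and f: "\<bar>form v1\<bar> < \<bar>form v0\<bar>"
    and h: "height v0 \<le> height v1" "height v0 > 0"
    and min: "\<And>v. v \<in> W0 \<Longrightarrow> \<bar>form v\<bar> < \<bar>form v0\<bar> \<Longrightarrow> height v1 \<le> height v"
    and w: "w \<in> W" "w = \<alpha> *\<^sub>R v0 + \<beta> *\<^sub>R v1"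
  shows "2 * \<alpha> \<in> \<int> \<and> 2 * \<beta> \<in> \<int>"
proof -
  define \<rho> where "\<rho> = \<alpha> - real_of_int (round \<alpha>)"
  define \<sigma> where "\<sigma> = \<beta> - real_of_int (round \<beta>)"
  have rs: "\<bar>\<rho>\<bar> \<le> 1 / 2" "\<bar>\<sigma>\<bar> \<le> 1 / 2"
    using of_int_round_abs_le[of \<alpha>] of_int_round_abs_le[of \<beta>] by (auto simp: \<rho>_def \<sigma>_def abs_minus_commute)
  define w' where "w' = w - real_of_int (round \<alpha>) *\<^sub>R v0 - real_of_int (round \<beta>) *\<^sub>R v1"
  have w'W: "w' \<in> W" unfolding w'_def by (intro W_comb w v W0_W)
  have w': "w' = \<rho> *\<^sub>R v0 + \<sigma> *\<^sub>R v1" by (simp add: w'_def w \<rho>_def \<sigma>_def algebra_simps)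
  show ?thesis
  proof (cases "w' = 0")
    case True
    then have "\<rho> = 0 \<and> \<sigma> = 0" using consecutive_independent[OF v f h] w' by metis
    then have "\<alpha> = real_of_int (round \<alpha>)" "\<beta> = real_of_int (round \<beta>)" by (simp_all add: \<rho>_def \<sigma>_def)
    then show ?thesis by (metis Ints_mult Ints_numeral Ints_of_int)
  next
    case False
    then have W0: "w' \<in> W0" using w'W by (simp add: W0_def)
    have "\<bar>form w'\<bar> \<le> \<bar>\<rho>\<bar> * \<bar>form v0\<bar> + \<bar>\<sigma>\<bar> * \<bar>form v1\<bar>"
      unfolding w' form_add form_scale using abs_triangle_ineq[of "\<rho> * form v0" "\<sigma> * form v1"] by (simp add: abs_mult)
    also have "\<dots> \<le> 1 / 2 * \<bar>form v0\<bar> + 1 / 2 * \<bar>form v1\<bar>" using rs by (intro add_mono mult_right_mono) auto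
    also have "\<dots> < \<bar>form v0\<bar>" using f by simp
    finally have "height v1 \<le> height w'" using min W0 by blast
    also have "\<dots> \<le> \<bar>\<rho>\<bar> * height v0 + \<bar>\<sigma>\<bar> * height v1"
      unfolding w' using seminorm_add[OF seminorm_height, of "\<rho> *\<^sub>R v0" "\<sigma> *\<^sub>R v1"]
      by (simp only: seminorm_scale[OF seminorm_height])
    also have "\<dots> \<le> \<bar>\<rho>\<bar> * height v1 + \<bar>\<sigma>\<bar> * height v1" using h by (intro add_mono mult_left_mono) auto
    finally have "1 * height v1 \<le> (\<bar>\<rho>\<bar> + \<bar>\<sigma>\<bar>) * height v1" by (simp add: distrib_right)
    moreover have "height v1 > 0" using h by linarith
    ultimately have "1 \<le> \<bar>\<rho>\<bar> + \<bar>\<sigma>\<bar>" by (simp only: mult_le_cancel_right_pos)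
    then have "2 * \<rho> \<in> {1, -1}" "2 * \<sigma> \<in> {1, -1}" using rs by auto
    moreover have "2 * \<alpha> = 2 * \<rho> + real_of_int (2 * round \<alpha>)" "2 * \<beta> = 2 * \<sigma> + real_of_int (2 * round \<beta>)"
      by (simp_all add: \<rho>_def \<sigma>_def)
    ultimately show ?thesis by (auto intro!: Ints_add Ints_diff)
  qed
qed

text \<open>The determinant of a rank-two lattice of linear forms, read off a pair of consecutive minimal
  points, is comparable to the one read off any later pair in the same plane.\<close>

lemma consecutive_covolume:
  assumes v: "v0 \<in> W0" "v1 \<in> W0" and f: "\<bar>form v1\<bar> < \<bar>form v0\<bar>"
    and h: "height v0 \<le> height v1" "height v0 > 0"
    and min: "\<And>v. v \<in> W0 \<Longrightarrow> \<bar>form v\<bar> < \<bar>form v0\<bar> \<Longrightarrow> height v1 \<le> height v"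
    and u: "u \<in> W0" "u = \<alpha> *\<^sub>R v0 + \<beta> *\<^sub>R v1"
    and x: "x \<in> W0" "x = \<alpha>' *\<^sub>R v0 + \<beta>' *\<^sub>R v1"
    and ux: "\<bar>form x\<bar> < \<bar>form u\<bar>" "height u \<le> height x" "height x > 0"
  shows "\<bar>form v0\<bar> * height v1 \<le> 16 * (\<bar>form u\<bar> * height x)"
proof -
  note hs = seminorm_scale[OF seminorm_height] and hd = seminorm_diff[OF seminorm_height]
  \<comment> \<open>\<open>E\<close> spans the kernel of the form inside the plane, and its height
    plays the part of the determinant; the pair \<open>u\<close>, \<open>x\<close> gives
    \<open>\<Delta>\<close> times the same vector.\<close>
  define E where "E = form v0 *\<^sub>R v1 - form v1 *\<^sub>R v0"
  define \<Delta> where "\<Delta> = \<alpha> * \<beta>' - \<alpha>' * \<beta>"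
  have f0: "\<bar>form v0\<bar> > 0" by (rule abs_form_pos[OF v(1)])
  have EH: "\<bar>form v0\<bar> * height v1 / 2 \<le> height E"
  proof -
    define k where "k = form v1 / form v0"
    have E: "E = form v0 *\<^sub>R (v1 - k *\<^sub>R v0)" using f0 by (simp add: E_def k_def algebra_simps)
    \<comment> \<open>The vector \<open>v1 - k *\<^sub>R v0\<close> lies between \<open>v1\<close>
      and \<open>v\<close>, both at least as high as \<open>v1\<close>. Adding the two triangle
      inequalities yields half of \<open>height v1\<close>.\<close>
    define s where "s = (if k \<ge> 0 then 1 else -1 :: real)"
    define v where "v = v1 - s *\<^sub>R v0"
    have k: "\<bar>k\<bar> < 1" using f f0 by (simp add: k_def abs_divide)
    have "\<bar>form v\<bar> < \<bar>form v0\<bar>"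
    proof -
      have "form v1 = k * form v0" using f0 by (simp add: k_def)
      then have "form v = (k - s) * form v0" by (simp add: v_def form_diff form_scale algebra_simps)
      moreover have "form v1 \<noteq> 0" using form_nonzero v by blast
      then have "k \<noteq> 0" by (simp add: k_def form_nonzero[OF v(1)])
      then have "\<bar>k - s\<bar> < 1" using k by (auto simp: s_def)
      ultimately show ?thesis using f0 by (simp add: abs_mult)
    qed
    moreover have "v \<in> W"
    proof -
      have "s = real_of_int (if k \<ge> 0 then 1 else -1)" by (simp add: s_def)
      then show ?thesis unfolding v_def using v W0_W
        by (metis additive_subgroup_diff additive_subgroup_W additive_subgroup_scale_int)
    qed
    moreover have "v \<noteq> 0" using consecutive_independent[OF v f h, of "- s" 1] by (auto simp: v_def algebra_simps)
    ultimately have hv: "height v1 \<le> height v" using min by (simp add: W0_def)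
    have "v1 - k *\<^sub>R v0 = v - (k - s) *\<^sub>R v0" by (simp add: v_def algebra_simps)
    then have "v = (v1 - k *\<^sub>R v0) - (- (k - s)) *\<^sub>R v0" by (simp add: algebra_simps)
    then have "height v \<le> height (v1 - k *\<^sub>R v0) + \<bar>k - s\<bar> * height v0"
      using hd hs by (metis abs_minus_cancel)
    moreover have "height v1 \<le> height (v1 - k *\<^sub>R v0) + \<bar>k\<bar> * height v0"
      using hd[of "v1 - k *\<^sub>R v0" "(- k) *\<^sub>R v0"] hs[of "- k" v0] by (simp only:) simp
    moreover have "\<bar>k - s\<bar> * height v0 \<le> (1 - \<bar>k\<bar>) * height v1"
    proof -
      have "\<bar>k - s\<bar> = 1 - \<bar>k\<bar>" using k by (auto simp: s_def)
      then show ?thesis using h k by (simp add: mult_left_mono)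
    qed
    moreover have "\<bar>k\<bar> * height v0 \<le> \<bar>k\<bar> * height v1" using h by (intro mult_left_mono) auto
    ultimately have "height v1 / 2 \<le> height (v1 - k *\<^sub>R v0)"
      using hv by (simp add: algebra_simps)
    then have "\<bar>form v0\<bar> * (height v1 / 2) \<le> \<bar>form v0\<bar> * height (v1 - k *\<^sub>R v0)" by (intro mult_left_mono) auto
    then show ?thesis unfolding E hs by simp
  qed
  have D: "form u *\<^sub>R x - form x *\<^sub>R u = \<Delta> *\<^sub>R E"
    unfolding u(2) x(2) E_def \<Delta>_def form_add form_scale by (simp add: algebra_simps)
  have "\<Delta> \<noteq> 0"
  proof
    assume "\<Delta> = 0"
    then have "form u *\<^sub>R x = form x *\<^sub>R u" using D by simp
    then have "\<bar>form u\<bar> * height x = \<bar>form x\<bar> * height u" by (metis hs)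
    also have "\<dots> \<le> \<bar>form x\<bar> * height x" using ux by (intro mult_left_mono) auto
    also have "\<dots> < \<bar>form u\<bar> * height x" using ux by (intro mult_strict_right_mono) auto
    finally show False by simp
  qed
  moreover have "4 * \<Delta> \<in> \<int>"
  proof -
    have "2 * \<alpha> \<in> \<int>" "2 * \<beta> \<in> \<int>" "2 * \<alpha>' \<in> \<int>" "2 * \<beta>' \<in> \<int>"
      using half_integral_coordinates[OF v f h min, of u \<alpha> \<beta>] half_integral_coordinates[OF v f h min, of x \<alpha>' \<beta>']
        u x W0_W by auto
    then have "(2 * \<alpha>) * (2 * \<beta>') - (2 * \<alpha>') * (2 * \<beta>) \<in> \<int>"
      by (metis Ints_diff Ints_mult)
    then show ?thesis by (simp add: \<Delta>_def algebra_simps)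
  qed
  ultimately have "1 \<le> \<bar>4 * \<Delta>\<bar>" by (intro Ints_nonzero_abs_ge1) auto
  \<comment> \<open>The factor 16 consists of 4 from half-integral coordinates, 2 from the height of
    \<open>E\<close> and 2 from the two terms for \<open>u\<close> and \<open>x\<close>.\<close>
  then have D4: "1 / 4 \<le> \<bar>\<Delta>\<bar>" by simp
  have "1 / 4 * (\<bar>form v0\<bar> * height v1 / 2) \<le> \<bar>\<Delta>\<bar> * height E"
    using D4 EH height_nonneg by (intro mult_mono) auto
  also have "\<dots> = height (form u *\<^sub>R x - form x *\<^sub>R u)" unfolding D hs ..
  also have "\<dots> \<le> \<bar>form u\<bar> * height x + \<bar>form x\<bar> * height u" using hd by (metis hs)
  also have "\<bar>form x\<bar> * height u \<le> \<bar>form u\<bar> * height x" using ux height_nonneg by (intro mult_mono) auto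
  finally show ?thesis by linarith
qed

section \<open>The inequality at a peak\<close>

lemma dualnorm_at_peak:
  assumes "h0 * exp (- a) = \<delta>0 * exp (real n * a)" "h0 \<le> height v" "\<bar>form v\<bar> \<le> \<delta>0"
  shows "dualnorm a v = height v * exp (- a)"
proof -
  have "\<bar>form v\<bar> * exp (real n * a) \<le> \<delta>0 * exp (real n * a)" using assms(3) by (intro mult_right_mono) auto
  also have "\<dots> = h0 * exp (- a)" using assms(1) by simp
  also have "\<dots> \<le> height v * exp (- a)" using assms(2) by (intro mult_right_mono) auto
  finally show ?thesis by (simp add: dualnorm_def)
qed

text \<open>All logarithms are measured in units of the peak time \<open>a\<close>. By
  \<open>hX\<close> the cut exp (X a) is at least the height of \<open>v1\<close>; by
  \<open>hP\<close> the consecutive points \<open>u\<close>, \<open>w\<close> around the cut cannot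
  both stay in the plane of \<open>v0\<close>, \<open>v1\<close>. The conclusion compares the height
  that Minkowski's inequality then forces on \<open>w\<close> with the height that \<open>t\<close>
  and \<nu> permit.\<close>

lemma key_inequality:
  fixes t \<nu> \<mu> \<epsilon> X C q0 :: real
  assumes n2: "n \<ge> 2" and eps: "0 < \<epsilon>" "\<epsilon> < 1" "t + \<epsilon> < 1" "0 \<le> t" "0 \<le> \<nu>" "\<nu> \<le> t"
    and up: "\<And>q v. q \<ge> q0 \<Longrightarrow> v \<in> W0 \<Longrightarrow> exp (- ((t + \<epsilon>) * q)) \<le> dualnorm q v"
    and low: "\<And>q. q \<ge> q0 \<Longrightarrow> \<exists>v\<in>W0. dualnorm q v \<le> exp (- ((\<nu> - \<epsilon>) * q))"
    and freq: "\<And>Q. \<exists>q\<ge>Q. \<exists>v\<in>W0. dualnorm q v \<le> exp (- ((t - \<epsilon>) * q))"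
    and S: "\<And>q k v. q \<ge> q0 \<Longrightarrow> k \<le> 3 \<Longrightarrow> (\<And>i. i < k \<Longrightarrow> v i \<in> W) \<Longrightarrow>
        (\<And>c. (\<Sum>i<k. c i *\<^sub>R v i) = 0 \<Longrightarrow> \<forall>i<k. c i = 0) \<Longrightarrow>
        (\<And>i j. i \<le> j \<Longrightarrow> j < k \<Longrightarrow> dualnorm q (v i) \<le> dualnorm q (v j)) \<Longrightarrow>
        exp (real (n + 1 - k) * (\<mu> - \<epsilon>) * q) \<le> C * (\<Prod>j<k. dualnorm q (v j))"
    and C: "C \<ge> 1"
    and hX: "(1 - \<nu> + \<epsilon>) * (real n + t + \<epsilon>) \<le> (real n + \<nu> - \<epsilon>) * X"
    and hP: "(1 - \<nu> + \<epsilon>) * (real n - 1 - (real n - 1) * (\<mu> - \<epsilon>) + 3 * \<epsilon>) < (real n - 1 + 2 * \<nu> - 2 * \<epsilon>) * X"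
    and nu2: "real n - 1 + 2 * \<nu> - 2 * \<epsilon> > 0"
  shows "(1 - t - \<epsilon>) * (real n + \<nu> - \<epsilon>) * ((real n - 2) * (\<mu> - \<epsilon>) + 2 + t - 2 * \<epsilon> - X)
         \<le> (1 - \<nu> + \<epsilon>) * (real n + t + \<epsilon>) * X"
proof -
  \<comment> \<open>Beyond \<open>B\<close> the constants cost at most \<epsilon> a in logarithms.
    The factor 3 in the choice of \<open>q\<close> pays for passing to the peak time, since q \<le>
    3 a when n \<ge> 2.\<close>
  define B where "B = max (max q0 1) ((ln C + ln 16) / \<epsilon>)"
  obtain q v where q: "q \<ge> 3 * B" and v: "v \<in> W0" "dualnorm q v \<le> exp (- ((t - \<epsilon>) * q))"
    using freq[of "3 * B"] by blast
  have B1: "B \<ge> 1" "B \<ge> q0" "B \<ge> (ln C + ln 16) / \<epsilon>" by (auto simp: B_def)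
  have q3: "q \<ge> 3" using q B1 by linarith
  have n1: "real n + 1 > 0" by simp
  \<comment> \<open>\<open>v\<close> is short at time \<open>q\<close>, which need not be its own
    peak time; \<open>v0\<close> is at least as good in form and height, and its peak time
    \<open>a\<close> is used from here on.\<close>
  obtain v0 where v0: "v0 \<in> W0" "\<bar>form v0\<bar> \<le> \<bar>form v\<bar>"
    and v0min: "\<And>v'. v' \<in> W0 \<Longrightarrow> \<bar>form v'\<bar> \<le> \<bar>form v\<bar> \<Longrightarrow> height v0 \<le> height v'"
    using minimal_height_exists[of v "\<lambda>v'. \<bar>form v'\<bar> \<le> \<bar>form v\<bar>" "\<bar>form v\<bar>"] v(1) by blast
  define x0 p where "x0 = ln (height v0)" and "p = - ln \<bar>form v0\<bar>"
  have f0: "\<bar>form v0\<bar> > 0" by (rule abs_form_pos[OF v0(1)])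
  have fv: "\<bar>form v\<bar> \<le> exp (- ((real n + t - \<epsilon>) * q))"
  proof -
    have "\<bar>form v\<bar> * exp (real n * q) \<le> exp (- ((t - \<epsilon>) * q))" using v(2) by (simp add: dualnorm_def)
    then have "\<bar>form v\<bar> \<le> exp (- ((t - \<epsilon>) * q)) / exp (real n * q)" by (simp add: pos_le_divide_eq)
    also have "\<dots> = exp (- ((real n + t - \<epsilon>) * q))" by (simp add: exp_diff[symmetric] algebra_simps)
    finally show ?thesis .
  qed
  have nte: "real n + t - \<epsilon> \<ge> 1" using n2 eps by linarith
  have p: "p \<ge> (real n + t - \<epsilon>) * q"
  proof -
    have "ln \<bar>form v0\<bar> \<le> ln (exp (- ((real n + t - \<epsilon>) * q)))"
      using v0(2) fv f0 by (intro ln_mono) auto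
    then show ?thesis by (simp add: p_def)
  qed
  have pq: "p \<ge> q" using p nte q3 mult_right_mono[of 1 "real n + t - \<epsilon>" q] by linarith
  have f1: "\<bar>form v0\<bar> < 1"
  proof -
    have "ln \<bar>form v0\<bar> < 0" using pq q3 by (simp add: p_def)
    then show ?thesis using f0 by simp
  qed
  have H0: "height v0 \<ge> 1" by (rule height_ge_1[OF v0(1) f1])
  have x0: "x0 \<ge> 0" "x0 \<le> (1 - t + \<epsilon>) * q"
  proof -
    show "x0 \<ge> 0" using H0 by (simp add: x0_def)
    have "height v0 \<le> height v" using v0min v(1) by simp
    then have "height v0 * exp (- q) \<le> height v * exp (- q)" by (intro mult_right_mono) auto
    also have "\<dots> \<le> exp (- ((t - \<epsilon>) * q))" using v(2) by (simp add: dualnorm_def)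
    finally have "height v0 \<le> exp (- ((t - \<epsilon>) * q)) * exp q" by (simp add: exp_minus field_simps)
    also have "\<dots> = exp ((1 - t + \<epsilon>) * q)" by (simp add: exp_add[symmetric] algebra_simps)
    finally have "ln (height v0) \<le> ln (exp ((1 - t + \<epsilon>) * q))" using H0 by (intro ln_mono) auto
    then show "x0 \<le> (1 - t + \<epsilon>) * q" by (simp add: x0_def)
  qed
  define a where "a = (x0 + p) / (real n + 1)"
  have a': "(real n + 1) * a = x0 + p" by (simp add: a_def)
  have aB: "a \<ge> B"
  proof -
    have "(real n - 1) * q \<le> p"
      using p eps q3 mult_right_mono[of "real n - 1" "real n + t - \<epsilon>" q] by linarith
    then have "(real n - 1) * q \<le> (real n + 1) * a" using x0 a' by linarith
    moreover have "(real n + 1) * q \<le> 3 * ((real n - 1) * q)"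
      using n2 q3 mult_right_mono[of "real n + 1" "3 * (real n - 1)" q] by simp
    ultimately have "(real n + 1) * q \<le> (real n + 1) * (3 * a)" by linarith
    then have "q \<le> 3 * a" using mult_le_cancel_left_pos[OF n1] by blast
    then show ?thesis using q by linarith
  qed
  have a0: "a \<ge> q0" "a \<ge> 1" using aB B1 by linarith+
  have "(ln C + ln 16) / \<epsilon> \<le> a" using aB B1 by linarith
  then have lnCa: "ln C + ln 16 \<le> \<epsilon> * a" using eps by (simp add: divide_le_eq mult.commute)
  \<comment> \<open>Since \<open>x0 + p\<close> equals (n + 1) a, this bound and the next pin both
    down: p is about (n + t) a and x0 about (1 - t) a.\<close>
  have p_le: "p \<le> (real n + t + \<epsilon>) * a"
  proof -
    have "(1 - (t + \<epsilon>)) * (- ln \<bar>form v0\<bar>) \<le> (real n + (t + \<epsilon>)) * ln (height v0)"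
      using peak_bound[OF up v0(1)] H0 a0(1) by (simp add: a_def x0_def p_def)
    then have "(1 - (t + \<epsilon>)) * p \<le> (real n + (t + \<epsilon>)) * x0" by (simp add: p_def x0_def)
    then have "(real n + 1) * p \<le> (real n + 1) * ((real n + t + \<epsilon>) * a)"
      using arg_cong[OF a', of "\<lambda>x. (real n + t + \<epsilon>) * x"] by (simp add: algebra_simps)
    then show ?thesis using mult_le_cancel_left_pos[OF n1] by blast
  qed
  have x0_le: "x0 \<le> (1 - t + \<epsilon>) * a"
  proof -
    have "(real n + t - \<epsilon>) * x0 \<le> (real n + t - \<epsilon>) * ((1 - t + \<epsilon>) * q)"
      using x0 nte by (intro mult_left_mono) auto
    also have "\<dots> = (1 - t + \<epsilon>) * ((real n + t - \<epsilon>) * q)" by simp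
    also have "\<dots> \<le> (1 - t + \<epsilon>) * p" using p eps by (intro mult_left_mono) auto
    finally have "(real n + 1) * x0 \<le> (1 - t + \<epsilon>) * (x0 + p)" by (simp add: algebra_simps)
    also have "\<dots> = (real n + 1) * ((1 - t + \<epsilon>) * a)" unfolding a'[symmetric] by simp
    finally show ?thesis using mult_le_cancel_left_pos[OF n1] by blast
  qed
  have peak: "height v0 * exp (- a) = \<bar>form v0\<bar> * exp (real n * a)"
  proof -
    have e: "height v0 = exp x0" "\<bar>form v0\<bar> = exp (- p)" using H0 f0 by (simp_all add: x0_def p_def)
    have "x0 - a = - p + real n * a" using a' by (simp add: algebra_simps)
    then show ?thesis unfolding e by (simp add: exp_add[symmetric])
  qed
  obtain v1 where v1: "v1 \<in> W0" "\<bar>form v1\<bar> < \<bar>form v0\<bar>"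
    and v1min: "\<And>v'. v' \<in> W0 \<Longrightarrow> \<bar>form v'\<bar> < \<bar>form v0\<bar> \<Longrightarrow> height v1 \<le> height v'"
    using next_minimal_exists[OF f0] by blast
  have H1: "height v0 \<le> height v1" using v0min v1 v0(2) by simp
  define x where "x = ln (height v1)"
  have x: "x \<ge> x0" using H1 H0 by (simp add: x_def x0_def)
  have time: "(ln h - ln \<delta>) / (real n + 1) \<ge> q0" if "h \<ge> height v0" "\<delta> \<le> \<bar>form v0\<bar>" "\<delta> > 0" for h \<delta>
  proof -
    have "ln h \<ge> x0" "ln \<delta> \<le> - p" using that H0 by (simp_all add: x0_def p_def)
    then have "a \<le> (ln h - ln \<delta>) / (real n + 1)" unfolding a_def by (intro divide_right_mono) auto
    then show ?thesis using a0 by linarith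
  qed
  have pos: "1 - \<nu> + \<epsilon> > 0" "real n + \<nu> - \<epsilon> > 0" "real n + t + \<epsilon> > 0" "1 - t - \<epsilon> > 0" using eps n2 by linarith+
  have xX: "x \<le> X * a"
  proof -
    have "(real n + (\<nu> - \<epsilon>)) * ln (height v1) \<le> (1 - (\<nu> - \<epsilon>)) * (- ln \<bar>form v0\<bar>)"
    proof (rule crossing_bound[OF low])
      show "\<And>v. v \<in> W0 \<Longrightarrow> \<bar>form v0\<bar> \<le> \<bar>form v\<bar> \<or> height v1 \<le> height v" using v1min by force
    qed (use H1 H0 f0 time in auto)
    then have "(real n + \<nu> - \<epsilon>) * x \<le> (1 - \<nu> + \<epsilon>) * p" by (simp add: x_def p_def algebra_simps)
    also have "\<dots> \<le> (1 - \<nu> + \<epsilon>) * ((real n + t + \<epsilon>) * a)" using p_le pos by (intro mult_left_mono) auto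
    also have "\<dots> \<le> (real n + \<nu> - \<epsilon>) * (X * a)"
      using mult_right_mono[OF hX, of a] a0 by (simp add: mult.assoc)
    finally show ?thesis using pos by (simp only: mult_le_cancel_left_pos)
  qed
  have dn: "dualnorm a v' = exp (ln (height v') - a)" if "height v' \<ge> height v0" "\<bar>form v'\<bar> \<le> \<bar>form v0\<bar>" for v'
  proof -
    have "height v' > 0" using that H0 by linarith
    then have "height v' * exp (- a) = exp (ln (height v') - a)" by (simp add: exp_diff exp_minus field_simps)
    then show ?thesis using dualnorm_at_peak[OF peak that] by simp
  qed
  have dn0: "dualnorm a v0 = exp (x0 - a)" using dn[of v0] by (simp add: x0_def)
  have dn1: "dualnorm a v1 = exp (x - a)" using dn[of v1] H1 v1 by (simp add: x_def)
  note ci = consecutive_independent[OF v0(1) v1 H1]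
  have H0': "height v0 > 0" using H0 by linarith
  have lnC: "C = exp (ln C)" using C by simp
  \<comment> \<open>Minkowski's inequality for the pair \<open>v0\<close>, \<open>v1\<close>, with
    the remaining n - 1 minima bounded by the first one.\<close>
  have x_ge: "x \<ge> ((real n - 1) * (\<mu> - \<epsilon>) + 1 + t - \<epsilon>) * a - ln C"
  proof -
    define V where "V i = (if i = 0 then v0 else v1)" for i :: nat
    have "exp (real (n + 1 - 2) * (\<mu> - \<epsilon>) * a) \<le> C * (\<Prod>j<2. dualnorm a (V j))"
    proof (rule S[OF a0(1)])
      show "V i \<in> W" for i using v0 v1 W0_W by (simp add: V_def)
      show "\<forall>i<2. c i = 0" if "(\<Sum>i<2. c i *\<^sub>R V i) = 0" for c
        using that ci[OF H0', of "c 0" "c 1"]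
        by (simp add: V_def numeral_2_eq_2 less_Suc_eq del: sum_fun_apply)
      show "dualnorm a (V i) \<le> dualnorm a (V j)" if "i \<le> j" "j < 2" for i j
        using that x by (auto simp: V_def dn0 dn1)
    qed auto
    also have "(\<Prod>j<2. dualnorm a (V j)) = exp (x0 - a) * exp (x - a)"
      by (simp add: V_def numeral_2_eq_2 dn0 dn1)
    also have "C * (exp (x0 - a) * exp (x - a)) = exp (ln C + (x0 - a) + (x - a))"
      by (simp only: exp_add lnC[symmetric] mult.assoc)
    finally have "real (n - 1) * (\<mu> - \<epsilon>) * a \<le> ln C + (x0 - a) + (x - a)" by simp
    moreover have "real (n - 1) = real n - 1" using n2 by simp
    ultimately have "(real n - 1) * (\<mu> - \<epsilon>) * a \<le> ln C + (x0 - a) + (x - a)" by simp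
    then show ?thesis using x0_le by (simp add: algebra_simps)
  qed
  \<comment> \<open>Minimal points after \<open>v1\<close> may stay in the plane for a while. Those
    below this cut are harmless, because their logarithmic heights obey the bound X a used for
    \<open>v1\<close>.\<close>
  define h where "h = exp (X * a)"
  have hv1: "height v1 \<le> h"
  proof -
    have "height v1 = exp x" using H1 H0 by (simp add: x_def)
    then show ?thesis using xX by (simp add: h_def)
  qed
  obtain u where u: "u \<in> W0" "height u \<le> h" and umin: "\<And>v'. v' \<in> W0 \<Longrightarrow> height v' \<le> h \<Longrightarrow> \<bar>form u\<bar> \<le> \<bar>form v'\<bar>"
    using minimal_form_exists[OF v1(1) hv1] by blast
  have fu: "\<bar>form u\<bar> \<le> \<bar>form v1\<bar>" using umin v1 hv1 by blast
  have fu0: "\<bar>form u\<bar> > 0" by (rule abs_form_pos[OF u(1)])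
  have Hu: "height v1 \<le> height u" using v1min u fu v1 by force
  obtain w where w: "w \<in> W0" "\<bar>form w\<bar> < \<bar>form u\<bar>"
    and wmin: "\<And>v'. v' \<in> W0 \<Longrightarrow> \<bar>form v'\<bar> < \<bar>form u\<bar> \<Longrightarrow> height w \<le> height v'"
    using next_minimal_exists[OF fu0] by blast
  have Hw: "h < height w" using umin[of w] w by force
  define x' y r where "x' = ln (height u)" and "y = ln (height w)" and "r = - ln \<bar>form u\<bar>"
  have Hpos: "height u > 0" "height w > 0" "height w \<ge> height v0" using Hu H1 H0 Hw u by linarith+
  have x'X: "x' \<le> X * a"
  proof -
    have "ln (height u) \<le> ln h" using u Hpos by (intro ln_mono) auto
    then show ?thesis by (simp add: x'_def h_def)
  qed
  have yX: "X * a \<le> y"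
  proof -
    have "ln h \<le> ln (height w)" using Hw Hpos by (intro ln_mono) (auto simp: h_def)
    then show ?thesis by (simp add: y_def h_def)
  qed
  have E3: "(1 - t - \<epsilon>) * r \<le> (real n + t + \<epsilon>) * x'"
    using peak_bound[OF up u(1) Hpos(1) time] Hu H1 fu v1 fu0 by (simp add: r_def x'_def algebra_simps)
  have E4: "(real n + \<nu> - \<epsilon>) * y \<le> (1 - \<nu> + \<epsilon>) * r"
  proof -
    have "(real n + (\<nu> - \<epsilon>)) * ln (height w) \<le> (1 - (\<nu> - \<epsilon>)) * (- ln \<bar>form u\<bar>)"
    proof (rule crossing_bound[OF low])
      show "\<And>v. v \<in> W0 \<Longrightarrow> \<bar>form u\<bar> \<le> \<bar>form v\<bar> \<or> height w \<le> height v" using wmin by force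
      show "(ln (height w) - ln \<bar>form u\<bar>) / (real n + 1) \<ge> q0"
        using Hpos fu v1 fu0 by (intro time) auto
    qed (use Hpos fu0 in auto)
    then show ?thesis by (simp add: y_def r_def algebra_simps)
  qed
  \<comment> \<open>A vector off the plane completes \<open>v0\<close>, \<open>v1\<close> to three
    independent ones, which leaves n - 2 minima to be bounded by the first.\<close>
  have y_ge: "((real n - 2) * (\<mu> - \<epsilon>) + 2 + t - \<epsilon>) * a - ln C - x \<le> ln (height z)"
    if z: "z \<in> W0" "height v1 \<le> height z" "\<bar>form z\<bar> \<le> \<bar>form v1\<bar>" "\<nexists>\<alpha> \<beta>. z = \<alpha> *\<^sub>R v0 + \<beta> *\<^sub>R v1" for z
  proof -
    define V where "V i = (if i = 0 then v0 else if i = 1 then v1 else z)" for i :: nat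
    have dnz: "dualnorm a z = exp (ln (height z) - a)" using dn[of z] z H1 v1 by linarith
    have xz: "x \<le> ln (height z)" unfolding x_def using z H1 H0 by (intro ln_mono) auto
    have "exp (real (n + 1 - 3) * (\<mu> - \<epsilon>) * a) \<le> C * (\<Prod>j<3. dualnorm a (V j))"
    proof (rule S[OF a0(1)])
      show "V i \<in> W" for i using v0 v1 z W0_W by (simp add: V_def)
      show "\<forall>i<3. c i = 0" if "(\<Sum>i<3. c i *\<^sub>R V i) = 0" for c
      proof -
        have eq: "c 0 *\<^sub>R v0 + c 1 *\<^sub>R v1 + c 2 *\<^sub>R z = 0"
          using that by (simp add: V_def numeral_3_eq_3 numeral_2_eq_2 del: sum_fun_apply)
        have c2: "c 2 = 0"
        proof (rule ccontr)
          assume c2: "c 2 \<noteq> 0"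
          have "z = (1 / c 2) *\<^sub>R (c 2 *\<^sub>R z)" using c2 by simp
          also have "c 2 *\<^sub>R z = - (c 0 *\<^sub>R v0 + c 1 *\<^sub>R v1)" using eq by (metis add_eq_0_iff)
          also have "(1 / c 2) *\<^sub>R - (c 0 *\<^sub>R v0 + c 1 *\<^sub>R v1) = (- c 0 / c 2) *\<^sub>R v0 + (- c 1 / c 2) *\<^sub>R v1"
            by (simp add: algebra_simps)
          finally show False using z(4) by blast
        qed
        then have "c 0 = 0 \<and> c 1 = 0" using ci[OF H0', of "c 0" "c 1"] eq by simp
        with c2 show ?thesis by (auto simp: numeral_3_eq_3 numeral_2_eq_2 less_Suc_eq)
      qed
      show "dualnorm a (V i) \<le> dualnorm a (V j)" if "i \<le> j" "j < 3" for i j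
        using that x xz by (auto simp: V_def dn0 dn1 dnz)
    qed auto
    also have "(\<Prod>j<3. dualnorm a (V j)) = exp (x0 - a) * exp (x - a) * exp (ln (height z) - a)"
      by (simp add: V_def numeral_3_eq_3 dn0 dn1 dnz)
    also have "C * (exp (x0 - a) * exp (x - a) * exp (ln (height z) - a))
        = exp (ln C + (x0 - a) + (x - a) + (ln (height z) - a))"
      by (simp only: exp_add lnC[symmetric] mult.assoc)
    finally have "real (n - 2) * (\<mu> - \<epsilon>) * a \<le> ln C + (x0 - a) + (x - a) + (ln (height z) - a)" by simp
    moreover have "real (n - 2) = real n - 2" using n2 by simp
    ultimately have "(real n - 2) * (\<mu> - \<epsilon>) * a \<le> ln C + (x0 - a) + (x - a) + (ln (height z) - a)" by simp
    then show ?thesis using x0_le by (simp add: algebra_simps)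
  qed
  have yK: "((real n - 2) * (\<mu> - \<epsilon>) + 2 + t - \<epsilon>) * a - ln C - x \<le> y"
  proof (cases "\<exists>\<alpha> \<beta>. u = \<alpha> *\<^sub>R v0 + \<beta> *\<^sub>R v1")
    case False
    have "ln (height u) \<le> y" unfolding y_def using u Hw Hpos by (intro ln_mono) auto
    then show ?thesis using y_ge[OF u(1) Hu fu False] by linarith
  next
    case True
    then obtain \<alpha> \<beta> where uP: "u = \<alpha> *\<^sub>R v0 + \<beta> *\<^sub>R v1" by blast
    show ?thesis
    proof (cases "\<exists>\<alpha> \<beta>. w = \<alpha> *\<^sub>R v0 + \<beta> *\<^sub>R v1")
      case False
      have "height v1 \<le> height w" "\<bar>form w\<bar> \<le> \<bar>form v1\<bar>" using Hw hv1 w fu by linarith+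
      then show ?thesis unfolding y_def using y_ge[OF w(1) _ _ False] by blast
    next
      case True
      then obtain \<alpha>' \<beta>' where wP: "w = \<alpha>' *\<^sub>R v0 + \<beta>' *\<^sub>R v1" by blast
      \<comment> \<open>With both points in the plane the determinants of (\<open>v0\<close>,
        \<open>v1\<close>) and (\<open>u\<close>, \<open>w\<close>) are comparable, so r is at most
        y + p - x up to a constant. Together with the valley bound \<open>E4\<close> this pushes
        \<open>w\<close> below the cut.\<close>
      have "height u \<le> height w" using u Hw by linarith
      then have "\<bar>form v0\<bar> * height v1 \<le> 16 * (\<bar>form u\<bar> * height w)"
        using consecutive_covolume[OF v0(1) v1 H1 H0' v1min u(1) uP w(1) wP w(2)] Hpos by blast
      then have "ln (\<bar>form v0\<bar> * height v1) \<le> ln (16 * (\<bar>form u\<bar> * height w))"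
        using f0 H1 H0' by (intro ln_mono) auto
      then have "x - p \<le> ln 16 + (y - r)"
        using f0 fu0 H1 H0' Hpos by (simp add: ln_mult x_def p_def y_def r_def)
      then have "r \<le> y + (p - x + ln 16)" by simp
      then have "(1 - \<nu> + \<epsilon>) * r \<le> (1 - \<nu> + \<epsilon>) * (y + (p - x + ln 16))" using pos by (intro mult_left_mono) auto
      with E4 have "(real n - 1 + 2 * \<nu> - 2 * \<epsilon>) * y \<le> (1 - \<nu> + \<epsilon>) * (p - x + ln 16)"
        by (simp add: algebra_simps)
      also have "p - x + ln 16 \<le> (real n - 1 - (real n - 1) * (\<mu> - \<epsilon>) + 3 * \<epsilon>) * a"
        using p_le x_ge lnCa by (simp add: algebra_simps)
      then have "(1 - \<nu> + \<epsilon>) * (p - x + ln 16) \<le> (1 - \<nu> + \<epsilon>) * ((real n - 1 - (real n - 1) * (\<mu> - \<epsilon>) + 3 * \<epsilon>) * a)"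
        using pos by (intro mult_left_mono) auto
      also have "\<dots> < (real n - 1 + 2 * \<nu> - 2 * \<epsilon>) * X * a"
        using mult_strict_right_mono[OF hP, of a] a0 by (simp add: mult.assoc)
      also have "\<dots> \<le> (real n - 1 + 2 * \<nu> - 2 * \<epsilon>) * y"
        using yX nu2 by (simp add: mult.assoc)
      finally show ?thesis by simp
    qed
  qed
  have "ln (16::real) \<ge> 0" by simp
  then have "ln C \<le> \<epsilon> * a" using lnCa by linarith
  then have "((real n - 2) * (\<mu> - \<epsilon>) + 2 + t - 2 * \<epsilon> - X) * a \<le> y"
    using yK xX by (simp add: algebra_simps)
  then have "(1 - t - \<epsilon>) * (real n + \<nu> - \<epsilon>) * (((real n - 2) * (\<mu> - \<epsilon>) + 2 + t - 2 * \<epsilon> - X) * a)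
      \<le> (1 - t - \<epsilon>) * (real n + \<nu> - \<epsilon>) * y"
    using pos by (intro mult_left_mono) auto
  also have "\<dots> \<le> (1 - t - \<epsilon>) * ((1 - \<nu> + \<epsilon>) * r)"
    using E4 pos by (simp add: mult.assoc)
  also have "\<dots> = (1 - \<nu> + \<epsilon>) * ((1 - t - \<epsilon>) * r)" by simp
  also have "\<dots> \<le> (1 - \<nu> + \<epsilon>) * ((real n + t + \<epsilon>) * x')" using E3 pos by (intro mult_left_mono) auto
  also have "\<dots> \<le> (1 - \<nu> + \<epsilon>) * ((real n + t + \<epsilon>) * (X * a))" using x'X pos by (intro mult_left_mono) auto
  finally have "(1 - t - \<epsilon>) * (real n + \<nu> - \<epsilon>) * ((real n - 2) * (\<mu> - \<epsilon>) + 2 + t - 2 * \<epsilon> - X) * a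
      \<le> (1 - \<nu> + \<epsilon>) * (real n + t + \<epsilon>) * X * a" by (simp only: mult.assoc)
  then show ?thesis using a0 by (simp only: mult_le_cancel_right_pos)
qed

section \<open>Asymptotics\<close>

text \<open>On the dual side: the limsup as an eventual bound, the liminf as an eventual bound, the
  limsup as approached at arbitrarily late times, and Minkowski's inequality for up to three
  vectors.\<close>

definition dual_profile :: "real \<Rightarrow> real \<Rightarrow> real \<Rightarrow> real \<Rightarrow> real \<Rightarrow> real \<Rightarrow> bool" where
  "dual_profile t \<nu> \<mu> \<epsilon> q0 C \<longleftrightarrow>
     (\<forall>q\<ge>q0. \<forall>v\<in>W0. exp (- ((t + \<epsilon>) * q)) \<le> dualnorm q v) \<and>
     (\<forall>q\<ge>q0. \<exists>v\<in>W0. dualnorm q v \<le> exp (- ((\<nu> - \<epsilon>) * q))) \<and>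
     (\<forall>Q. \<exists>q\<ge>Q. \<exists>v\<in>W0. dualnorm q v \<le> exp (- ((t - \<epsilon>) * q))) \<and>
     (\<forall>q k v. q \<ge> q0 \<longrightarrow> k \<le> 3 \<longrightarrow> (\<forall>i<k. v i \<in> W) \<longrightarrow>
        (\<forall>c. (\<Sum>i<k. c i *\<^sub>R v i) = 0 \<longrightarrow> (\<forall>i<k. c i = 0)) \<longrightarrow>
        (\<forall>i j. i \<le> j \<longrightarrow> j < k \<longrightarrow> dualnorm q (v i) \<le> dualnorm q (v j)) \<longrightarrow>
        exp (real (n + 1 - k) * (\<mu> - \<epsilon>) * q) \<le> C * (\<Prod>j<k. dualnorm q (v j)))"

text \<open>Dirichlet's theorem gives a dual vector of gauge at most 2 at each time; transference
  then keeps the last minimum away from 0.\<close>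

lemma lamtop_ge: "q \<ge> 0 \<Longrightarrow> lamtop q \<ge> 1 / (2 * (real n + 1))"
proof -
  assume q: "q \<ge> 0"
  obtain C b w where gb: "good_basis C q b w" using good_basis_exists by blast
  obtain v where v: "v \<in> W0" "dualnorm q v \<le> 2" using Dirichlet_linear_form[OF q] by blast
  have one: "1 \<le> (real n + 1) * dualnorm q v * lamtop q" by (rule lamtop_dual_lower[OF v(1) gb])
  have "lamtop q \<ge> 0"
  proof (rule ccontr)
    assume "\<not> ?thesis"
    then have "(real n + 1) * dualnorm q v * lamtop q \<le> 0"
      using dualnorm_nonneg by (intro mult_nonneg_nonpos) auto
    then show False using one by linarith
  qed
  then have "(real n + 1) * dualnorm q v * lamtop q \<le> (real n + 1) * 2 * lamtop q"
    using v(2) by (intro mult_right_mono mult_left_mono) auto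
  then have "1 \<le> (real n + 1) * 2 * lamtop q" using one by linarith
  then show ?thesis by (simp add: divide_le_eq mult.commute)
qed

lemma lamtop_pos: "q \<ge> 0 \<Longrightarrow> lamtop q > 0"
  by (rule less_le_trans[OF _ lamtop_ge]) auto

lemma phi_top: "q > 0 \<Longrightarrow> lamtop q = exp (phi n \<xi> (n + 1) q * q)"
  using lamtop_pos[of q] by (simp add: phi_def lamtop_def)

lemma phi_1: "q > 0 \<Longrightarrow> lam1 q = exp (phi n \<xi> 1 q * q)"
  using lam1_pos[of q] by (simp add: phi_def lam1_def)

text \<open>In the clauses obtained by transference, one half of \<epsilon> is left to the limits
  and the other absorbs the factors n + 1 and \<open>C0\<close>, once exp (\<epsilon> q / 2) exceeds
  them.\<close>

lemma dual_profile_exists: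
  assumes n2: "n \<ge> 2" and eps: "\<epsilon> > 0"
    and t: "phi_upper n \<xi> (n + 1) = ereal t" and nu: "phi_lower n \<xi> (n + 1) = ereal \<nu>"
    and mu: "phi_lower n \<xi> 1 = ereal \<mu>"
  shows "\<exists>q0 C. C \<ge> 1 \<and> dual_profile t \<nu> \<mu> \<epsilon> q0 C"
proof -
  obtain C0 where C0: "C0 \<ge> 1" "\<And>q. \<exists>b w. good_basis C0 q b w" using good_basis_exists by blast
  define C where "C = 2 * (3 * C0) ^ (n + 1) * (real n + 1) ^ (n + 1)"
  have e1: "\<forall>\<^sub>F q in at_top. phi n \<xi> (n + 1) q < t + \<epsilon> / 2"
    using Limsup_lessD[of at_top "\<lambda>q. ereal (phi n \<xi> (n + 1) q)" "ereal (t + \<epsilon> / 2)"] t eps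
    by (simp add: phi_upper_def)
  have e2: "\<forall>\<^sub>F q in at_top. \<nu> - \<epsilon> / 2 < phi n \<xi> (n + 1) q"
    using less_LiminfD[of "ereal (\<nu> - \<epsilon> / 2)" at_top "\<lambda>q. ereal (phi n \<xi> (n + 1) q)"] nu eps
    by (simp add: phi_lower_def)
  have e3: "\<forall>\<^sub>F q in at_top. \<mu> - \<epsilon> < phi n \<xi> 1 q"
    using less_LiminfD[of "ereal (\<mu> - \<epsilon>)" at_top "\<lambda>q. ereal (phi n \<xi> 1 q)"] mu eps
    by (simp add: phi_lower_def)
  have e4: "\<forall>\<^sub>F q in at_top. max (real n + 1) C0 \<le> exp (\<epsilon> / 2 * q) \<and> q > 0"
  proof (rule eventually_conj)
    show "\<forall>\<^sub>F q in at_top. max (real n + 1) C0 \<le> exp (\<epsilon> / 2 * q)"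
    proof (rule eventually_at_top_linorderI)
      fix q assume "q \<ge> ln (max (real n + 1) C0) / (\<epsilon> / 2)"
      then have "ln (max (real n + 1) C0) \<le> \<epsilon> / 2 * q" using eps by (simp add: field_simps)
      then have "exp (ln (max (real n + 1) C0)) \<le> exp (\<epsilon> / 2 * q)" by (simp only: exp_le_cancel_iff)
      moreover have "max (real n + 1) C0 > 0" using C0(1) by linarith
      ultimately show "max (real n + 1) C0 \<le> exp (\<epsilon> / 2 * q)" by (simp only: exp_ln)
    qed
    show "\<forall>\<^sub>F q::real in at_top. q > 0" by (rule eventually_gt_at_top)
  qed
  obtain q0 where q0: "\<And>q. q \<ge> q0 \<Longrightarrow> phi n \<xi> (n + 1) q < t + \<epsilon> / 2 \<and> \<nu> - \<epsilon> / 2 < phi n \<xi> (n + 1) q \<and>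
      \<mu> - \<epsilon> < phi n \<xi> 1 q \<and> max (real n + 1) C0 \<le> exp (\<epsilon> / 2 * q) \<and> q > 0"
    using eventually_conj[OF e1 eventually_conj[OF e2 eventually_conj[OF e3 e4]]]
    unfolding eventually_at_top_linorder by blast
  have small: "\<exists>v\<in>W0. dualnorm q v \<le> exp (- ((s - \<epsilon>) * q))"
    if q: "q \<ge> q0" and s: "s - \<epsilon> / 2 \<le> phi n \<xi> (n + 1) q" for s q
  proof -
    note qq = q0[OF q]
    obtain b w where gb: "good_basis C0 q b w" using C0(2) by blast
    obtain v where v: "v \<in> W0" "dualnorm q v * lamtop q \<le> C0"
      using lamtop_dual_upper[OF gb] qq by (meson less_imp_le)
    have "exp ((s - \<epsilon> / 2) * q) \<le> lamtop q"
      using s qq by (simp add: phi_top mult_right_mono)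
    then have "dualnorm q v * exp ((s - \<epsilon> / 2) * q) \<le> C0"
      using v(2) mult_left_mono[OF _ dualnorm_nonneg] by (meson order_trans)
    also have "C0 \<le> exp (\<epsilon> / 2 * q)" using qq by simp
    finally have "dualnorm q v \<le> exp (\<epsilon> / 2 * q) / exp ((s - \<epsilon> / 2) * q)" by (simp add: pos_le_divide_eq)
    also have "\<dots> = exp (- ((s - \<epsilon>) * q))" by (simp add: exp_diff[symmetric] algebra_simps)
    finally show ?thesis using v(1) by blast
  qed
  have "dual_profile t \<nu> \<mu> \<epsilon> q0 C"
    unfolding dual_profile_def
  proof (intro conjI allI impI ballI)
    fix q v assume q: "q \<ge> q0" and v: "v \<in> W0"
    note qq = q0[OF q]
    obtain b w where gb: "good_basis C0 q b w" using C0(2) by blast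
    have "lamtop q \<le> exp ((t + \<epsilon> / 2) * q)"
      using qq by (simp add: phi_top)
    then have "(real n + 1) * dualnorm q v * lamtop q \<le> exp (\<epsilon> / 2 * q) * dualnorm q v * exp ((t + \<epsilon> / 2) * q)"
      using qq dualnorm_nonneg lamtop_pos[of q] by (intro mult_mono mult_right_mono) auto
    then have "1 \<le> dualnorm q v * (exp (\<epsilon> / 2 * q) * exp ((t + \<epsilon> / 2) * q))"
      using lamtop_dual_lower[OF v gb] by (simp add: mult_ac)
    also have "exp (\<epsilon> / 2 * q) * exp ((t + \<epsilon> / 2) * q) = exp ((t + \<epsilon>) * q)"
      by (simp add: exp_add[symmetric] algebra_simps)
    finally have "1 / exp ((t + \<epsilon>) * q) \<le> dualnorm q v" by (simp only: pos_divide_le_eq[OF exp_gt_zero])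
    then show "exp (- ((t + \<epsilon>) * q)) \<le> dualnorm q v" by (simp only: exp_minus inverse_eq_divide)
  next
    fix q assume q: "q \<ge> q0"
    then show "\<exists>v\<in>W0. dualnorm q v \<le> exp (- ((\<nu> - \<epsilon>) * q))" using small[OF q, of \<nu>] q0[OF q] by simp
  next
    fix Q
    have "\<not> (\<forall>\<^sub>F q in at_top. phi n \<xi> (n + 1) q \<le> t - \<epsilon> / 2)"
    proof
      assume "\<forall>\<^sub>F q in at_top. phi n \<xi> (n + 1) q \<le> t - \<epsilon> / 2"
      then have "\<forall>\<^sub>F q in at_top. ereal (phi n \<xi> (n + 1) q) \<le> ereal (t - \<epsilon> / 2)" by simp
      then have "phi_upper n \<xi> (n + 1) \<le> ereal (t - \<epsilon> / 2)" unfolding phi_upper_def by (rule Limsup_bounded)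
      then show False using t eps by simp
    qed
    then obtain q where "q \<ge> max Q q0" "phi n \<xi> (n + 1) q > t - \<epsilon> / 2"
      unfolding eventually_at_top_linorder by (meson not_le)
    then show "\<exists>q\<ge>Q. \<exists>v\<in>W0. dualnorm q v \<le> exp (- ((t - \<epsilon>) * q))"
      using small[of q t] by (intro exI[of _ q]) auto
  next
    fix q k and v :: "nat \<Rightarrow> nat \<Rightarrow> real"
    assume q: "q \<ge> q0" and k: "k \<le> 3" and v: "\<forall>i<k. v i \<in> W"
      and ind: "\<forall>c. (\<Sum>i<k. c i *\<^sub>R v i) = 0 \<longrightarrow> (\<forall>i<k. c i = 0)"
      and sorted: "\<forall>i j. i \<le> j \<longrightarrow> j < k \<longrightarrow> dualnorm q (v i) \<le> dualnorm q (v j)"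
    note qq = q0[OF q]
    obtain b w where gb: "good_basis C0 q b w" using C0(2) by blast
    have "exp ((\<mu> - \<epsilon>) * q) \<le> lam1 q" using qq by (simp add: phi_1)
    then have "exp ((\<mu> - \<epsilon>) * q) ^ (n + 1 - k) \<le> lam1 q ^ (n + 1 - k)" by (intro power_mono) auto
    then have "exp (real (n + 1 - k) * (\<mu> - \<epsilon>) * q) \<le> lam1 q ^ (n + 1 - k)"
      by (simp add: exp_of_nat_mult[symmetric] mult.assoc)
    also have "\<dots> \<le> 2 * (3 * C0) ^ (n + 1) * (real n + 1) ^ k * (\<Prod>j<k. dualnorm q (v j))"
      using qq v ind sorted k n2 by (intro dual_prod_lower[OF gb C0(1)]) auto
    also have "\<dots> \<le> C * (\<Prod>j<k. dualnorm q (v j))"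
      unfolding C_def using k n2 C0(1) dualnorm_nonneg
      by (intro mult_right_mono mult_left_mono power_increasing prod_nonneg) auto
    finally show "exp (real (n + 1 - k) * (\<mu> - \<epsilon>) * q) \<le> C * (\<Prod>j<k. dualnorm q (v j))" .
  qed
  moreover have "C \<ge> 1"
  proof -
    have "(3 * C0) ^ (n + 1) \<ge> 1" "(real n + 1) ^ (n + 1) \<ge> 1" using C0(1) by (intro one_le_power, simp)+
    then have "(3 * C0) ^ (n + 1) * (real n + 1) ^ (n + 1) \<ge> 1" by (rule mult_ge1_I)
    then show ?thesis unfolding C_def by linarith
  qed
  ultimately show ?thesis by blast
qed

lemma phi_lower_top_nonneg:
  assumes nu: "phi_lower n \<xi> (n + 1) = ereal \<nu>"
  shows "\<nu> \<ge> 0"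
proof (rule ccontr)
  assume neg: "\<not> \<nu> \<ge> 0"
  define B where "B = max 1 (ln (2 * (real n + 1)) / (- \<nu> / 2))"
  have "\<forall>\<^sub>F q in at_top. ereal (\<nu> / 2) \<le> ereal (phi n \<xi> (n + 1) q)"
  proof (rule eventually_at_top_linorderI)
    fix q assume q: "q \<ge> B"
    then have q1: "q > 0" "ln (2 * (real n + 1)) / (- \<nu> / 2) \<le> q" by (auto simp: B_def)
    then have "ln (2 * (real n + 1)) \<le> - \<nu> / 2 * q" using neg by (simp add: field_simps)
    then have "\<nu> / 2 * q \<le> ln (1 / (2 * (real n + 1)))" by (simp add: ln_div)
    also have "\<dots> \<le> ln (lamtop q)" using lamtop_ge[of q] q1 by (intro ln_mono) auto
    also have "\<dots> = phi n \<xi> (n + 1) q * q" using q1 by (simp add: phi_top)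
    finally show "ereal (\<nu> / 2) \<le> ereal (phi n \<xi> (n + 1) q)" using q1 by simp
  qed
  then have "ereal (\<nu> / 2) \<le> phi_lower n \<xi> (n + 1)" unfolding phi_lower_def by (rule Liminf_bounded)
  then show False using nu neg by simp
qed

text \<open>Minkowski's inequality for a single vector of gauge about exp (- t q), with the other n
  minima bounded by the first.\<close>

lemma khintchine_bound:
  assumes n2: "n \<ge> 2"
    and t: "phi_upper n \<xi> (n + 1) = ereal t" and nu: "phi_lower n \<xi> (n + 1) = ereal \<nu>"
    and mu: "phi_lower n \<xi> 1 = ereal \<mu>"
  shows "real n * \<mu> + t \<le> 0"
proof (rule field_le_epsilon)
  fix e :: real assume e: "e > 0"
  \<comment> \<open>Of the n + 2 shares, n are lost with \<mu>, one with t and one to the constant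
    \<open>C\<close>.\<close>
  define \<epsilon> where "\<epsilon> = e / (real n + 2)"
  have eps: "\<epsilon> > 0" "(real n + 2) * \<epsilon> = e" using e by (auto simp: \<epsilon>_def)
  obtain q0 C where C: "C \<ge> 1" and prof: "dual_profile t \<nu> \<mu> \<epsilon> q0 C"
    using dual_profile_exists[OF n2 eps(1) t nu mu] by blast
  obtain q v where q: "q \<ge> max (max q0 1) (ln C / \<epsilon>)" and v: "v \<in> W0" "dualnorm q v \<le> exp (- ((t - \<epsilon>) * q))"
    using prof unfolding dual_profile_def by meson
  have "exp (real (n + 1 - 1) * (\<mu> - \<epsilon>) * q) \<le> C * (\<Prod>j<(1::nat). dualnorm q v)"
  proof -
    have ind: "\<forall>c. (\<Sum>i<(1::nat). c i *\<^sub>R v) = 0 \<longrightarrow> (\<forall>i<1. c i = 0)"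
      using v(1) by (auto simp: W0_def simp del: sum_fun_apply)
    show ?thesis using prof q v(1) ind W0_W unfolding dual_profile_def
      by (elim conjE allE[of _ q] allE[of _ "1::nat"] allE[of _ "\<lambda>_. v"]) auto
  qed
  also have "\<dots> \<le> C * exp (- ((t - \<epsilon>) * q))" using v(2) C by simp
  also have "\<dots> = exp (ln C - (t - \<epsilon>) * q)" using C by (simp add: exp_diff exp_minus divide_inverse del: minus_diff_eq mult_minus_left)
  finally have "real n * (\<mu> - \<epsilon>) * q \<le> ln C - (t - \<epsilon>) * q" by simp
  moreover have "ln C \<le> \<epsilon> * q" using q eps by (simp add: field_simps)
  ultimately have "(real n * \<mu> + t) * q \<le> ((real n + 2) * \<epsilon>) * q" by (simp add: algebra_simps)
  then show "real n * \<mu> + t \<le> 0 + e" using q eps by simp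
qed

text \<open>At the extremal \<nu> the conditions \<open>hX\<close> and \<open>hP\<close> hold with
  equality, leaving no room for \<epsilon>. Replacing X by X + \<kappa> makes them strict;
  \<epsilon> tends to 0 for fixed \<kappa>, and only then \<kappa> does.\<close>

lemma limit_inequality:
  fixes X :: real
  assumes n2: "n \<ge> 2"
    and t: "phi_upper n \<xi> (n + 1) = ereal t" and nu: "phi_lower n \<xi> (n + 1) = ereal \<nu>"
    and mu: "phi_lower n \<xi> 1 = ereal \<mu>"
    and t01: "0 \<le> t" "t < 1" and nu0: "0 \<le> \<nu>" "\<nu> \<le> t"
    and hX: "(1 - \<nu>) * (real n + t) = (real n + \<nu>) * X"
    and hP: "(1 - \<nu>) * ((real n - 1) * (1 - \<mu>)) = (real n - 1 + 2 * \<nu>) * X"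
  shows "(1 - t) * (real n + \<nu>) * ((real n - 2) * \<mu> + 2 + t - X) \<le> (1 - \<nu>) * (real n + t) * X"
proof -
  have gen: "(1 - t) * (real n + \<nu>) * ((real n - 2) * \<mu> + 2 + t - (X + \<kappa>)) \<le> (1 - \<nu>) * (real n + t) * (X + \<kappa>)"
    if k: "\<kappa> > 0" for \<kappa>
  proof -
    let ?F = "at_right (0::real)"
    let ?l = "\<lambda>\<epsilon>. (1 - t - \<epsilon>) * (real n + \<nu> - \<epsilon>) * ((real n - 2) * (\<mu> - \<epsilon>) + 2 + t - 2 * \<epsilon> - (X + \<kappa>))"
    let ?r = "\<lambda>\<epsilon>. (1 - \<nu> + \<epsilon>) * (real n + t + \<epsilon>) * (X + \<kappa>)"
    have n2': "real n \<ge> 2" using n2 by simp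
    have "((\<lambda>\<epsilon>. (real n + \<nu> - \<epsilon>) * (X + \<kappa>) - (1 - \<nu> + \<epsilon>) * (real n + t + \<epsilon>)) \<longlongrightarrow>
        (real n + \<nu> - 0) * (X + \<kappa>) - (1 - \<nu> + 0) * (real n + t + 0)) ?F"
      by (intro tendsto_intros)
    moreover have "(real n + \<nu> - 0) * (X + \<kappa>) - (1 - \<nu> + 0) * (real n + t + 0) > 0"
      using hX k n2' nu0 by (simp add: distrib_left)
    ultimately have 1: "\<forall>\<^sub>F \<epsilon> in ?F. (real n + \<nu> - \<epsilon>) * (X + \<kappa>) - (1 - \<nu> + \<epsilon>) * (real n + t + \<epsilon>) > 0"
      by (rule order_tendstoD)
    have "((\<lambda>\<epsilon>. (real n - 1 + 2 * \<nu> - 2 * \<epsilon>) * (X + \<kappa>)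
          - (1 - \<nu> + \<epsilon>) * (real n - 1 - (real n - 1) * (\<mu> - \<epsilon>) + 3 * \<epsilon>)) \<longlongrightarrow>
        (real n - 1 + 2 * \<nu> - 2 * 0) * (X + \<kappa>) - (1 - \<nu> + 0) * (real n - 1 - (real n - 1) * (\<mu> - 0) + 3 * 0)) ?F"
      by (intro tendsto_intros)
    moreover have "(real n - 1 + 2 * \<nu> - 2 * 0) * (X + \<kappa>) - (1 - \<nu> + 0) * (real n - 1 - (real n - 1) * (\<mu> - 0) + 3 * 0) > 0"
    proof -
      have "real n - 1 - (real n - 1) * (\<mu> - 0) + 3 * 0 = (real n - 1) * (1 - \<mu>)" by (simp add: algebra_simps)
      moreover have "(real n - 1 + 2 * \<nu>) * \<kappa> > 0" using k n2' nu0 by (intro mult_pos_pos) auto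
      ultimately show ?thesis using hP by (simp add: distrib_left)
    qed
    ultimately have 2: "\<forall>\<^sub>F \<epsilon> in ?F. (real n - 1 + 2 * \<nu> - 2 * \<epsilon>) * (X + \<kappa>)
          - (1 - \<nu> + \<epsilon>) * (real n - 1 - (real n - 1) * (\<mu> - \<epsilon>) + 3 * \<epsilon>) > 0"
      by (rule order_tendstoD)
    \<comment> \<open>Below (1 - t) / 2 the side conditions \<epsilon> < 1, t + \<epsilon> < 1 and n
      - 1 + 2 \<nu> - 2 \<epsilon> > 0 all hold.\<close>
    have 3: "\<forall>\<^sub>F \<epsilon> in ?F. \<epsilon> < (1 - t) / 2" "\<forall>\<^sub>F \<epsilon> in ?F. \<epsilon> > (0::real)"
      using t01 by (auto simp: eventually_at_right_less intro!: eventually_at_rightI[of 0 "(1 - t) / 2"])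
    have "\<forall>\<^sub>F \<epsilon> in ?F. ?l \<epsilon> \<le> ?r \<epsilon>"
      using 1 2 3
    proof eventually_elim
      case (elim \<epsilon>)
      obtain q0 C where C: "C \<ge> 1" and prof: "dual_profile t \<nu> \<mu> \<epsilon> q0 C"
        using dual_profile_exists[OF n2 elim(4) t nu mu] by blast
      show ?case
      proof (rule key_inequality[of \<epsilon> t \<nu> q0 \<mu> C])
        show "real n - 1 + 2 * \<nu> - 2 * \<epsilon> > 0" using n2' nu0 elim t01 by (simp add: field_simps)
      qed (use prof elim n2 t01 nu0 C in \<open>auto simp: dual_profile_def\<close>)
    qed
    moreover have "(?l \<longlongrightarrow> (1 - t - 0) * (real n + \<nu> - 0) * ((real n - 2) * (\<mu> - 0) + 2 + t - 2 * 0 - (X + \<kappa>))) ?F"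
      by (intro tendsto_intros)
    moreover have "(?r \<longlongrightarrow> (1 - \<nu> + 0) * (real n + t + 0) * (X + \<kappa>)) ?F"
      by (intro tendsto_intros)
    ultimately show ?thesis using tendsto_le[of ?F] by fastforce
  qed
  let ?F = "at_right (0::real)"
  have "\<forall>\<^sub>F \<kappa> in ?F. (1 - t) * (real n + \<nu>) * ((real n - 2) * \<mu> + 2 + t - (X + \<kappa>)) \<le> (1 - \<nu>) * (real n + t) * (X + \<kappa>)"
    using gen by (auto simp: eventually_at_right_less intro!: eventually_at_rightI[of 0 1])
  moreover have "((\<lambda>\<kappa>. (1 - t) * (real n + \<nu>) * ((real n - 2) * \<mu> + 2 + t - (X + \<kappa>))) \<longlongrightarrow>
      (1 - t) * (real n + \<nu>) * ((real n - 2) * \<mu> + 2 + t - (X + 0))) ?F"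
    by (intro tendsto_intros)
  moreover have "((\<lambda>\<kappa>. (1 - \<nu>) * (real n + t) * (X + \<kappa>)) \<longlongrightarrow> (1 - \<nu>) * (real n + t) * (X + 0)) ?F"
    by (intro tendsto_intros)
  ultimately show ?thesis using tendsto_le[of ?F] by fastforce
qed

end

section \<open>Elimination of \<nu> and the quadratic inequality for \<mu>\<close>

lemma algebraic_conclusion:
  fixes N t \<mu> \<nu> :: real
  assumes N: "N \<ge> 2" and t: "0 \<le> t" "t \<le> 1" and D0: "N + 1 + 2 * t + (N - 1) * \<mu> \<noteq> 0"
    and nu: "\<nu> = (1 - N) * (t + N * \<mu>) / (N + 1 + 2 * t + (N - 1) * \<mu>)"
    and nu0: "0 \<le> \<nu>" "\<nu> \<le> t" and mut: "N * \<mu> + t \<le> 0"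
    and lim: "\<And>X. t < 1 \<Longrightarrow> (1 - \<nu>) * (N + t) = (N + \<nu>) * X \<Longrightarrow>
        (1 - \<nu>) * ((N - 1) * (1 - \<mu>)) = (N - 1 + 2 * \<nu>) * X \<Longrightarrow>
        (1 - t) * (N + \<nu>) * ((N - 2) * \<mu> + 2 + t - X) \<le> (1 - \<nu>) * (N + t) * X"
  shows "((3 - 2 * N) * t + 1 - 2 * N + sqrt ((1 - t) * ((4 * N - 5) * t + 4 * N^2 - 4 * N + 1))) / (2 * (N - 1)^2) \<le> \<mu>"
proof -
  define D where "D = N + 1 + 2 * t + (N - 1) * \<mu>"
  have nuD: "\<nu> * D = (1 - N) * (t + N * \<mu>)" using nu D0 by (simp add: D_def)
  \<comment> \<open>For D \<le> 0 the two sides of \<open>nuD\<close> have opposite signs, so both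
    vanish and t = - N \<mu>; but this value makes D positive.\<close>
  have Dpos: "D > 0"
  proof (rule ccontr)
    assume "\<not> D > 0"
    then have "\<nu> * D \<le> 0" using nu0 by (intro mult_nonneg_nonpos) auto
    moreover have "(1 - N) * (t + N * \<mu>) \<ge> 0" using N mut by (intro mult_nonpos_nonpos) auto
    ultimately have "(1 - N) * (t + N * \<mu>) = 0" using nuD by linarith
    then have "t = - (N * \<mu>)" using N by auto
    then have mu0: "N * \<mu> = - t" by simp
    then have "N * D = N * (N + 1) + 2 * (N * t) - (N - 1) * t" unfolding D_def by algebra
    moreover have "(N - 1) * t \<le> N * t" using t by (intro mult_right_mono) auto
    moreover have "N * (N + 1) > 0" "N * t \<ge> 0" using N t by auto
    ultimately have "N * D > 0" by linarith
    then show False using \<open>\<not> D > 0\<close> N by (simp add: zero_less_mult_iff)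
  qed
  have nuND: "(N + \<nu>) * D = (N + 1) * (N + t)"
    using nuD unfolding D_def by algebra
  have nu1D: "(1 - \<nu>) * D = (N + 1) * (1 + t + (N - 1) * \<mu>)"
    using nuD unfolding D_def by algebra
  have nu2D: "(N - 1 + 2 * \<nu>) * D = (N - 1) * (1 - \<mu>) * (N + 1)"
    using nuD unfolding D_def by algebra
  \<comment> \<open>This is where \<nu> \<le> t enters: multiplied by D, the difference factors with
    the positive factor N + t.\<close>
  have mulow: "2 * t + (N - 1) * \<mu> \<ge> 0"
  proof -
    have "\<nu> * D \<le> t * D" using nu0 Dpos by (intro mult_right_mono) auto
    moreover have "t * D - \<nu> * D = (N + t) * (2 * t + (N - 1) * \<mu>)" unfolding nuD unfolding D_def by algebra
    ultimately have "0 \<le> (N + t) * (2 * t + (N - 1) * \<mu>)" by linarith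
    then show ?thesis using N t by (simp add: zero_le_mult_iff)
  qed
  \<comment> \<open>The expression is the derivative in \<mu> of (1 + t + (N - 1) \<mu>)^2 - (1 - t)
    (1 - \<mu>), so \<mu> is not to the left of the vertex and only the larger root matters.\<close>
  have vertex: "2 * (N - 1)^2 * \<mu> + ((2 * N - 3) * t + 2 * N - 1) \<ge> 0"
  proof -
    have "0 \<le> 2 * (N - 1) * (2 * t + (N - 1) * \<mu>)" using mulow N by (intro mult_nonneg_nonneg) simp_all
    moreover have "0 \<le> (2 * N - 1) * (1 - t)" using N t by (intro mult_nonneg_nonneg) simp_all
    ultimately have "0 \<le> 2 * (N - 1) * (2 * t + (N - 1) * \<mu>) + (2 * N - 1) * (1 - t)" by linarith
    also have "\<dots> = 2 * (N - 1)^2 * \<mu> + ((2 * N - 3) * t + 2 * N - 1)" by algebra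
    finally show ?thesis .
  qed
  have "(1 - t) * ((4 * N - 5) * t + 4 * N^2 - 4 * N + 1) \<le> (2 * (N - 1)^2 * \<mu> + ((2 * N - 3) * t + 2 * N - 1))^2"
  \<comment> \<open>At t = 1 the left side is 0; the limit inequality is available for t < 1
    only.\<close>
  proof (cases "t = 1")
    case True
    then show ?thesis by simp
  next
    case False
    \<comment> \<open>By \<open>nuND\<close> and \<open>nu1D\<close> this is 1 + t + (N - 1) \<mu>,
      whence (N - 2) \<mu> + 2 + t - X = 1 - \<mu>; the identity \<open>K\<close> rests on
      this.\<close>
    define X where "X = (1 - \<nu>) * (N + t) / (N + \<nu>)"
    have Nnu: "N + \<nu> > 0" using N nu0 by simp
    have X: "(1 - \<nu>) * (N + t) = (N + \<nu>) * X" using Nnu by (simp add: X_def)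
    \<comment> \<open>This identity expresses that both conditions on X, the one defining it and
      \<open>X2\<close>, have the same solution.\<close>
    have I: "(N - 1) * (1 - \<mu>) * (N + \<nu>) = (N - 1 + 2 * \<nu>) * (N + t)"
    proof -
      have "((N - 1) * (1 - \<mu>) * (N + \<nu>)) * D = ((N - 1 + 2 * \<nu>) * (N + t)) * D"
        using nuND nu2D by algebra
      then show ?thesis using Dpos by simp
    qed
    have X2: "(1 - \<nu>) * ((N - 1) * (1 - \<mu>)) = (N - 1 + 2 * \<nu>) * X"
    proof -
      have "((1 - \<nu>) * ((N - 1) * (1 - \<mu>))) * (N + \<nu>) = ((N - 1 + 2 * \<nu>) * X) * (N + \<nu>)"
        using I X by algebra
      then show ?thesis using Nnu by simp
    qed
    have L: "(1 - t) * (N + \<nu>) * ((N - 2) * \<mu> + 2 + t - X) \<le> (1 - \<nu>) * (N + t) * X"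
      using lim[OF _ X X2] False t by simp
    have K: "(N - 1) * ((N + \<nu>) * ((N - 2) * \<mu> + 2 + t - X)) = (N - 1 + 2 * \<nu>) * (N + t)"
      using X I by algebra
    have "(N - 1) * (N + \<nu>) * ((1 - t) * (N + \<nu>) * ((N - 2) * \<mu> + 2 + t - X)) \<le> (N - 1) * (N + \<nu>) * ((1 - \<nu>) * (N + t) * X)"
      using L N Nnu by (intro mult_left_mono) auto
    moreover have "(N - 1) * (N + \<nu>) * ((1 - t) * (N + \<nu>) * ((N - 2) * \<mu> + 2 + t - X))
        = (N + t) * ((1 - t) * ((N - 1 + 2 * \<nu>) * (N + \<nu>)))"
      using K by algebra
    moreover have "(N - 1) * (N + \<nu>) * ((1 - \<nu>) * (N + t) * X) = (N + t) * ((N - 1) * (1 - \<nu>)^2 * (N + t))"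
      using X by algebra
    ultimately have "(N + t) * ((1 - t) * ((N - 1 + 2 * \<nu>) * (N + \<nu>))) \<le> (N + t) * ((N - 1) * (1 - \<nu>)^2 * (N + t))"
      by linarith
    then have E1: "(1 - t) * ((N - 1 + 2 * \<nu>) * (N + \<nu>)) \<le> (N - 1) * (1 - \<nu>)^2 * (N + t)"
      using N t by simp
    then have "(1 - t) * ((N - 1 + 2 * \<nu>) * (N + \<nu>)) * D^2 \<le> (N - 1) * (1 - \<nu>)^2 * (N + t) * D^2"
      by (intro mult_right_mono) auto
    moreover have "(1 - t) * ((N - 1 + 2 * \<nu>) * (N + \<nu>)) * D^2 = ((N - 1) * (N + 1)^2 * (N + t)) * ((1 - t) * (1 - \<mu>))"
      using nuND nu2D by algebra
    moreover have "(N - 1) * (1 - \<nu>)^2 * (N + t) * D^2 = ((N - 1) * (N + 1)^2 * (N + t)) * (1 + t + (N - 1) * \<mu>)^2"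
      using nu1D by algebra
    ultimately have "((N - 1) * (N + 1)^2 * (N + t)) * ((1 - t) * (1 - \<mu>)) \<le> ((N - 1) * (N + 1)^2 * (N + t)) * (1 + t + (N - 1) * \<mu>)^2"
      by simp
    moreover have "(N - 1) * (N + 1)^2 * (N + t) > 0" using N t by simp
    ultimately have "(1 - t) * (1 - \<mu>) \<le> (1 + t + (N - 1) * \<mu>)^2" by (simp only: mult_le_cancel_left_pos)
    \<comment> \<open>Completing the square: the factor 4 (N - 1)^2 brings out the discriminant that
      stands under the root in \<open>\<mu>0\<close>.\<close>
    then have "0 \<le> 4 * (N - 1)^2 * ((1 + t + (N - 1) * \<mu>)^2 - (1 - t) * (1 - \<mu>))" by simp
    also have "\<dots> = (2 * (N - 1)^2 * \<mu> + ((2 * N - 3) * t + 2 * N - 1))^2 - (1 - t) * ((4 * N - 5) * t + 4 * N^2 - 4 * N + 1)"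
      by algebra
    finally show ?thesis by simp
  qed
  then have "sqrt ((1 - t) * ((4 * N - 5) * t + 4 * N^2 - 4 * N + 1)) \<le> 2 * (N - 1)^2 * \<mu> + ((2 * N - 3) * t + 2 * N - 1)"
    using vertex by (rule real_le_lsqrt[rotated])
  then show ?thesis using N by (simp add: divide_le_eq algebra_simps)
qed

theorem theorem5p3:
  fixes n :: nat and t \<mu> \<mu>0 :: real
  assumes "n \<ge> 2"
    and "0 \<le> t" "t \<le> 1"
    and "\<mu>0 = ((3 - 2 * real n) * t + 1 - 2 * real n
                 + sqrt ((1 - t) * ((4 * real n - 5) * t + 4 * (real n)^2 - 4 * real n + 1)))
               / (2 * (real n - 1)^2)"
    and "\<mu> \<notin> {\<mu>0 .. - t / real n}"
    and "real n + 1 + 2 * t + (real n - 1) * \<mu> \<noteq> 0"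
  shows "\<not> (\<exists>\<xi> :: nat \<Rightarrow> real.
             Q_lin_indep n \<xi> \<and>
             phi_upper n \<xi> (n + 1) = ereal t \<and>
             phi_lower n \<xi> (n + 1) =
               ereal ((1 - real n) * (t + real n * \<mu>) / (real n + 1 + 2 * t + (real n - 1) * \<mu>)) \<and>
             phi_lower n \<xi> 1 = ereal \<mu>)"
proof
  define \<nu> where "\<nu> = (1 - real n) * (t + real n * \<mu>) / (real n + 1 + 2 * t + (real n - 1) * \<mu>)"
  assume "\<exists>\<xi> :: nat \<Rightarrow> real. Q_lin_indep n \<xi> \<and> phi_upper n \<xi> (n + 1) = ereal t \<and>
             phi_lower n \<xi> (n + 1) =
               ereal ((1 - real n) * (t + real n * \<mu>) / (real n + 1 + 2 * t + (real n - 1) * \<mu>)) \<and>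
             phi_lower n \<xi> 1 = ereal \<mu>"
  then obtain \<xi> where \<xi>: "Q_lin_indep n \<xi>" "phi_upper n \<xi> (n + 1) = ereal t"
      "phi_lower n \<xi> (n + 1) = ereal \<nu>" "phi_lower n \<xi> 1 = ereal \<mu>"
    unfolding \<nu>_def by blast
  interpret approx_lattice n \<xi> using \<xi>(1) assms(1) by unfold_locales auto
  have "phi_lower n \<xi> (n + 1) \<le> phi_upper n \<xi> (n + 1)"
    unfolding phi_lower_def phi_upper_def by (rule Liminf_le_Limsup) simp
  then have nut: "\<nu> \<le> t" using \<xi> by simp
  have nu0: "0 \<le> \<nu>" by (rule phi_lower_top_nonneg[OF \<xi>(3)])
  have mut: "real n * \<mu> + t \<le> 0" by (rule khintchine_bound[OF assms(1) \<xi>(2-4)])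
  have "\<mu>0 \<le> \<mu>"
    unfolding assms(4)
  proof (rule algebraic_conclusion[OF _ assms(2,3,6) \<nu>_def nu0 nut mut])
    show "real n \<ge> 2" using assms(1) by simp
  qed (rule limit_inequality[OF assms(1) \<xi>(2-4) assms(2) _ nu0 nut])
  moreover have "\<mu> \<le> - t / real n" using mut assms(1) by (simp add: field_simps)
  ultimately show False using assms(5) by simp
qed

end
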